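(* In the setting described in the context, for every $v\in V$ and every $t\in(0,1]$, $$E\big|Y^v_n(t)-Y^v(t)\big|^2\longrightarrow0\qquad(n\to\infty).$$
   Context: $V=\bigcup_{k\ge0}\{1,2\}^k$ is the binary tree of finite words over $\{1,2\}$ (root $\emptyset$, concatenation $vw$, $V_{<m}$ the words of length $<m$); $(U^v)_{v\in V}$ are i.i.d. uniform on $[0,1]$. $C(x)=1+2x\ln x+2(1-x)\ln(1-x)$ (with $0\ln0=0$) and $C(t,x)=C(x)+2\,\mathbf 1_{t<x}\big(-1+x+(1-t)\ln(1-t)-(1-x)\ln(1-x)-(x-t)\ln(x-t)\big)$. Let $H_j=\sum_{i=1}^j1/i$, $a(0,0)=0$ and $a(n,l)=2n+2(n+1)H_n-2(n+3-l)H_{n+1-l}-6l+6$ for $1\le l\le n$. For $n\ge1$, $1\le i\le n$: $C(n,0,i)=0$ and for $1\le l\le n$, $C(n,l,i)=\frac1n\Big(n-1-a(n,l)+\mathbf 1_{l<i}\,a(i-1,l)+\mathbf 1_{l\ge i}\,a(i-1,i-1)+\mathbf 1_{l>i}\,a(n-i,l-i)\Big)$. Set $I^v_n=\lceil nU^v\rceil$, $U^v_n=I^v_n/n$. Discrete processes (all built from the same $U^v$): $Y^v_0=Y^v_1\equiv0$ and for $n\ge2$, $t\in[0,1]$, $Y^v_n(t)=C(n,\lfloor nt\rfloor,I^v_n)+\mathbf 1_{t<U^v_n}\frac{I^v_n-1}{n}Y^{v1}_{I^v_n-1}\big(1\wedge\frac{\lfloor nt\rfloor}{I^v_n-1}\big)+\mathbf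 1_{t\ge U^v_n}\Big(\frac{I^v_n-1}{n}Y^{v1}_{I^v_n-1}(1)+\frac{n-I^v_n}{n}Y^{v2}_{n-I^v_n}\big(0\vee\frac{t-U^v_n}{1-U^v_n}\big)\Big)$ (terms with vanishing prefactor are $0$). Quicksort process: put $\ell^v_\emptyset=1$, $\ell^v_{w1}=\ell^v_wU^{vw}$, $\ell^v_{w2}=\ell^v_w(1-U^{vw})$, $Q^v=\lim_m\sum_{w\in V_{<m}}\ell^v_wC(U^{vw})$ (a.s. and $L_2$ limit). Define maps on functions $h:[0,1]\to\mathbb R$ by $(T^v_1h)(t)=\mathbf 1_{t<U^v}U^vh(1\wedge t/U^v)$, $(T^v_2h)(t)=\mathbf 1_{t\ge U^v}(1-U^v)h\big(0\vee\frac{t-U^v}{1-U^v}\big)$, $C^v(t)=C(t,U^v)+\mathbf 1_{t\ge U^v}U^vQ^{v1}$, $L^v_\emptyset=\mathrm{id}$, $L^v_{wi}=L^v_w\circ T^{vw}_i$, $R^v_m=\sum_{w\in V_{<m}}L^v_w(C^{vw})$. Then $R^v_m$ converges a.s. uniformly on $[0,1]$ to a càdlàg random function, denoted $Y^v$. *)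

theory Defs
  imports "HOL-Probability.Probability"
begin

definition Vwords :: "nat list set" where
  "Vwords = {w. set w \<subseteq> {1,2}}"

definition Vlt :: "nat \<Rightarrow> nat list set" where
  "Vlt m = {w \<in> Vwords. length w < m}"

definition xlnx :: "real \<Rightarrow> real" where
  "xlnx x = (if x = 0 then 0 else x * ln x)"

definition Cfun :: "real \<Rightarrow> real" where
  "Cfun x = 1 + 2 * xlnx x + 2 * xlnx (1 - x)"

definition Ct :: "real \<Rightarrow> real \<Rightarrow> real" where
  "Ct t x = Cfun x + 2 * (if t < x then
      -1 + x + xlnx (1 - t) - xlnx (1 - x) - xlnx (x - t) else 0)"

definition Harm :: "nat \<Rightarrow> real" where
  "Harm j = (\<Sum>i=1..j. 1 / real i)"

definition acoef :: "nat \<Rightarrow> nat \<Rightarrow> real" where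
  "acoef n l = (if l = 0 then 0 else
     2 * real n + 2 * (real n + 1) * Harm n
     - 2 * (real n + 3 - real l) * Harm (n + 1 - l) - 6 * real l + 6)"

definition Cd :: "nat \<Rightarrow> nat \<Rightarrow> nat \<Rightarrow> real" where
  "Cd n l i = (if l = 0 then 0 else
     (1 / real n) * (real n - 1 - acoef n l
       + (if l < i then acoef (i - 1) l else 0)
       + (if l \<ge> i then acoef (i - 1) (i - 1) else 0)
       + (if l > i then acoef (n - i) (l - i) else 0)))"

text \<open>Discrete processes, for a fixed realisation u of the family (U^v).
  The guard 1 \<le> I \<le> n only excludes the null event U^v \<notin> (0,1].\<close>
function Yd :: "(nat list \<Rightarrow> real) \<Rightarrow> nat list \<Rightarrow> nat \<Rightarrow> real \<Rightarrow> real" where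
  "Yd u v n t =
    (if n < 2 then 0 else
     (let I = nat \<lceil>real n * u v\<rceil>; Unv = real I / real n; l = nat \<lfloor>real n * t\<rfloor> in
      if I < 1 \<or> n < I then 0 else
      Cd n l I
      + (if t < Unv
         then (real (I - 1) / real n) * Yd u (v @ [1]) (I - 1) (min 1 (real l / real (I - 1)))
         else (real (I - 1) / real n) * Yd u (v @ [1]) (I - 1) 1
              + (real (n - I) / real n) * Yd u (v @ [2]) (n - I) (max 0 ((t - Unv) / (1 - Unv))))))"
  by pat_completeness auto
termination
  by (relation "Wellfounded.measure (\<lambda>(u, v, n, t). n)") auto

definition ell :: "(nat list \<Rightarrow> real) \<Rightarrow> nat list \<Rightarrow> nat list \<Rightarrow> real" where
  "ell u v w = (\<Prod>k<length w. (if w ! k = 1 then u (v @ take k w) else 1 - u (v @ take k w)))"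

definition Qp :: "(nat list \<Rightarrow> real) \<Rightarrow> nat list \<Rightarrow> real" where
  "Qp u v = lim (\<lambda>m. \<Sum>w\<in>Vlt m. ell u v w * Cfun (u (v @ w)))"

definition Top :: "(nat list \<Rightarrow> real) \<Rightarrow> nat list \<Rightarrow> nat \<Rightarrow> (real \<Rightarrow> real) \<Rightarrow> real \<Rightarrow> real" where
  "Top u v i h t = (if i = 1
     then (if t < u v then u v * h (min 1 (t / u v)) else 0)
     else (if t \<ge> u v then (1 - u v) * h (max 0 ((t - u v) / (1 - u v))) else 0))"

definition Cc :: "(nat list \<Rightarrow> real) \<Rightarrow> nat list \<Rightarrow> real \<Rightarrow> real" where
  "Cc u v t = Ct t (u v) + (if t \<ge> u v then u v * Qp u (v @ [1]) else 0)"

definition Lop :: "(nat list \<Rightarrow> real) \<Rightarrow> nat list \<Rightarrow> nat list \<Rightarrow> (real \<Rightarrow> real) \<Rightarrow> real \<Rightarrow> real" where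
  "Lop u v w h = foldr (\<lambda>k g. Top u (v @ take k w) (w ! k) g) [0..<length w] h"

definition Rm :: "(nat list \<Rightarrow> real) \<Rightarrow> nat list \<Rightarrow> nat \<Rightarrow> real \<Rightarrow> real" where
  "Rm u v m t = (\<Sum>w\<in>Vlt m. Lop u v w (Cc u (v @ w)) t)"

definition Yc :: "(nat list \<Rightarrow> real) \<Rightarrow> nat list \<Rightarrow> real \<Rightarrow> real" where
  "Yc u v t = lim (\<lambda>m. Rm u v m t)"

end

theory Submission imports Defs "HOL-Real_Asymp.Real_Asymp"
begin

text \<open>
  The tree of uniforms splits into its root \<open>x\<close> and two independent copies of itself, so
  every second moment over the tree is an integral over \<open>x\<close> of a second moment over a
  pair of subtrees. Along this splitting both processes satisfy the same recursion, up to the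
  convergent toll \<open>C(n, l, i) \<rightarrow> C(t, x)\<close>, and the differences in the subtrees enter
  with the weights \<open>x\<^sup>2\<close> and \<open>(1 - x)\<^sup>2\<close>, whose integrals add up to \<open>2/3\<close>.

  At \<open>t = 1\<close> both subtrees contribute, but the contributions are centred and independent, so
  the cross terms vanish and \<open>Q\<^sub>n \<rightarrow> Q\<close> in \<open>L\<^sub>2\<close>. For \<open>t < 1\<close> the recursion follows
  only the subtree containing \<open>t\<close>; the left subtree, once it is passed, enters through
  \<open>Q\<^sub>n\<close> only. Hence the largest \<open>limsup\<close> of the squared distances, taken over all \<open>t\<close>
  and all sequences \<open>l\<^sub>k/n\<^sub>k \<rightarrow> t\<close>, is at most \<open>5/6\<close> of itself (a factor \<open>5/4\<close> being
  spent on separating the toll), and therefore zero.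
\<close>

section \<open>The random tree and its root decomposition\<close>

text \<open>The tolls do not converge uniformly. They jump at \<open>t = x\<close>, where the
  discrete toll stays near the limit from the other side, and at \<open>t = 0\<close> the discrete
  toll vanishes while \<open>Ct 0 x = 2 * x - 1\<close> for \<open>0 < x\<close>. So an error bound
  at size n in terms of smaller sizes, with a uniformly small remainder, is not at hand. Taking
  limsups under the integral over the root value x, by the reverse Fatou lemma, avoids this: the
  remainder only has to vanish for almost every x. The price is two kinds of a priori bounds. One
  must hold uniformly in x, to dominate the integrands; the other bounds the errors themselves,
  because \<open>c \<le> 5/6 * c\<close> forces \<open>c = 0\<close> only for finite c. Most
  explicit constants below serve these bounds, and only their finiteness matters. The factor 5/4
  stands for any number strictly between 1 and 3/2. Both limit objects are given by
  \<open>lim\<close>, so their recursions hold only almost surely, with a null set that depends on x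
  and, for the process, on t. This suffices, as only moments at fixed t are compared.\<close>

abbreviation Unif :: "real measure" where
  "Unif \<equiv> uniform_measure lborel {0..1}"

abbreviation Tree :: "(nat list \<Rightarrow> real) measure" where
  "Tree \<equiv> \<Pi>\<^sub>M w\<in>Vwords. Unif"

definition subtree :: "nat \<Rightarrow> (nat list \<Rightarrow> real) \<Rightarrow> nat list \<Rightarrow> real" where
  "subtree i u = (\<lambda>w. u (i # w))"

text \<open>Restricted to \<open>Vwords\<close> because points of the product space are
  \<open>undefined\<close> outside the index set; only then does \<open>subtree\<close> recover the
  two components exactly.\<close>

definition graft :: "real \<Rightarrow> (nat list \<Rightarrow> real) \<times> (nat list \<Rightarrow> real) \<Rightarrow> nat list \<Rightarrow> real" where
  "graft x ab = (\<lambda>w\<in>Vwords. case w of [] \<Rightarrow> x | j # w' \<Rightarrow> if j = 1 then fst ab w' else snd ab w')"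

lemma prob_space_Unif [simp]: "prob_space Unif"
  by (rule prob_space_uniform_measure) auto

lemma prob_space_Tree [simp]: "prob_space Tree"
  by (intro prob_space_PiM prob_space_Unif)

lemma emeasure_Unif_UNIV [simp]: "emeasure Unif UNIV = 1"
  using prob_space.emeasure_space_1[OF prob_space_Unif] by simp

lemma Nil_in_Vwords [simp]: "[] \<in> Vwords"
  by (simp add: Vwords_def)

lemma Cons_in_Vwords [simp]: "i # w \<in> Vwords \<longleftrightarrow> (i = 1 \<or> i = 2) \<and> w \<in> Vwords"
  by (auto simp: Vwords_def)

lemma append_in_Vwords [simp]: "v @ w \<in> Vwords \<longleftrightarrow> v \<in> Vwords \<and> w \<in> Vwords"
  by (auto simp: Vwords_def)

lemma graft_Nil [simp]: "graft x ab [] = x"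
  by (simp add: graft_def)

text \<open>The left letter is listed in both spellings because the simplifier turns
  \<open>1\<close> into \<open>Suc 0\<close>.\<close>

lemma subtree_graft:
  assumes "ab \<in> space (Tree \<Otimes>\<^sub>M Tree)"
  shows "subtree 1 (graft x ab) = fst ab" "subtree (Suc 0) (graft x ab) = fst ab"
    "subtree 2 (graft x ab) = snd ab"
  using assms
  by (auto simp: subtree_def graft_def fun_eq_iff space_pair_measure space_PiM PiE_def
      extensional_def)

lemma root_measurable: "(\<lambda>u. u []) \<in> borel_measurable Tree"
  by (subst measurable_cong_sets[OF refl, of borel Unif]) (auto intro:
      measurable_component_singleton)

lemma subtree_measurable [measurable]:
  "subtree 1 \<in> Tree \<rightarrow>\<^sub>M Tree" "subtree (Suc 0) \<in> Tree \<rightarrow>\<^sub>M Tree" "subtree 2 \<in> Tree \<rightarrow>\<^sub>M Tree"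
proof -
  have "subtree i \<in> Tree \<rightarrow>\<^sub>M Tree" if "i = 1 \<or> i = 2" for i
  proof (rule measurable_PiM_single')
    show "(\<lambda>u. subtree i u w) \<in> Tree \<rightarrow>\<^sub>M Unif" if "w \<in> Vwords" for w
      unfolding subtree_def using that \<open>i = 1 \<or> i = 2\<close>
          by (intro measurable_component_singleton) auto
    show "subtree i \<in> space Tree \<rightarrow> (\<Pi>\<^sub>E w\<in>Vwords. space Unif)"
      using \<open>i = 1 \<or> i = 2\<close> by (auto simp: subtree_def space_PiM PiE_def extensional_def)
  qed
  then show "subtree 1 \<in> Tree \<rightarrow>\<^sub>M Tree" "subtree (Suc 0) \<in> Tree \<rightarrow>\<^sub>M Tree"
      "subtree 2 \<in> Tree \<rightarrow>\<^sub>M Tree"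
    by auto
qed

lemma graft_measurable:
  "(\<lambda>p. graft (fst p) (snd p)) \<in> Unif \<Otimes>\<^sub>M (Tree \<Otimes>\<^sub>M Tree) \<rightarrow>\<^sub>M Tree"
proof (rule measurable_PiM_single')
  fix w :: "nat list" assume w: "w \<in> Vwords"
  show "(\<lambda>p. graft (fst p) (snd p) w) \<in> Unif \<Otimes>\<^sub>M (Tree \<Otimes>\<^sub>M Tree) \<rightarrow>\<^sub>M Unif"
  proof (cases w)
    case Nil
    have "fst \<in> Unif \<Otimes>\<^sub>M (Tree \<Otimes>\<^sub>M Tree) \<rightarrow>\<^sub>M Unif" by (rule measurable_fst)
    then show ?thesis using Nil by simp
  next
    case (Cons j w')
    with w have w': "w' \<in> Vwords" by simp
    have c: "(\<lambda>u. u w') \<in> Tree \<rightarrow>\<^sub>M Unif" using w' by (rule measurable_component_singleton)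
    have "(\<lambda>p. fst (snd p) w') \<in> Unif \<Otimes>\<^sub>M (Tree \<Otimes>\<^sub>M Tree) \<rightarrow>\<^sub>M Unif"
      by (rule measurable_compose[OF _ c]) (intro measurable_fst'' measurable_snd
          measurable_compose[OF measurable_snd measurable_fst])
    moreover have "(\<lambda>p. snd (snd p) w') \<in> Unif \<Otimes>\<^sub>M (Tree \<Otimes>\<^sub>M Tree) \<rightarrow>\<^sub>M Unif"
      by (rule measurable_compose[OF _ c]) (intro
          measurable_compose[OF measurable_snd measurable_snd])
    ultimately show ?thesis using w Cons by (cases "j = 1") (simp_all add: graft_def)
  qed
next
  show "(\<lambda>p. graft (fst p) (snd p)) \<in> space (Unif \<Otimes>\<^sub>M (Tree \<Otimes>\<^sub>M Tree)) \<rightarrow> (\<Pi>\<^sub>E w\<in>Vwords. space Unif)"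
    by (auto simp: graft_def)
qed

text \<open>The source of all independence used below. A measure on an infinite product is
  determined by its finite cylinders, and a cylinder over \<open>J\<close> factorises into a
  condition at the root and cylinders over the two sets \<open>Ji 1\<close>, \<open>Ji 2\<close> of
  words following a first letter.\<close>

lemma distr_graft: "distr (Unif \<Otimes>\<^sub>M (Tree \<Otimes>\<^sub>M Tree)) Tree (\<lambda>p. graft (fst p) (snd p)) = Tree"
proof (rule measure_eqI_PiM_infinite[symmetric, OF refl])
  interpret Unif: prob_space Unif by simp
  interpret Tree: prob_space Tree by simp
  interpret TT: pair_prob_space Tree Tree ..
  interpret UTT: pair_prob_space Unif "Tree \<Otimes>\<^sub>M Tree" ..
  show "finite_measure Tree" by unfold_locales
  fix J A assume J: "finite J" "J \<subseteq> Vwords"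
    and A: "\<And>w. w \<in> J \<Longrightarrow> A w \<in> sets Unif"
  define Ji where "Ji i = {w. i # w \<in> J}" for i :: nat
  define E where "E i = prod_emb Vwords (\<lambda>_. Unif) (Ji i) (\<Pi>\<^sub>E w\<in>Ji i. A (i # w))" for i :: nat
  define B where "B = (if [] \<in> J then A [] else UNIV)"
  have fin: "finite (Ji i)" for i
  proof -
    have "Ji i = (\<lambda>w. i # w) -` J" by (auto simp: Ji_def)
    then show ?thesis using J(1) by (simp add: finite_vimageI inj_def)
  qed
  have sub: "Ji i \<subseteq> Vwords" for i
    using J(2) by (auto simp: Ji_def)
  have AJi: "\<And>w. w \<in> Ji i \<Longrightarrow> A (i # w) \<in> sets Unif" for i
    using A by (auto simp: Ji_def)
  have Bset: "B \<in> sets Unif" using A by (auto simp: B_def)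
  have Eset: "E i \<in> sets Tree" for i
    unfolding E_def using sub fin AJi by (intro sets_PiM_I) auto
  have Eem: "emeasure Tree (E i) = (\<Prod>w\<in>Ji i. emeasure Unif (A (i # w)))" for i
    unfolding E_def using sub fin AJi by (intro emeasure_PiM_emb) auto
  let ?X = "prod_emb Vwords (\<lambda>_. Unif) J (Pi\<^sub>E J A)"
  have Jdec: "J = (J \<inter> {[]}) \<union> ((#) 1 ` Ji 1 \<union> (#) 2 ` Ji 2)"
  proof (intro equalityI subsetI)
    fix w assume w: "w \<in> J"
    show "w \<in> (J \<inter> {[]}) \<union> ((#) 1 ` Ji 1 \<union> (#) 2 ` Ji 2)"
    proof (cases w)
      case Nil then show ?thesis using w by simp
    next
      case (Cons j w')
      then have "j = 1 \<or> j = 2" using w J(2) by auto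
      then show ?thesis using w Cons by (auto simp: Ji_def)
    qed
  qed (auto simp: Ji_def)
  have "emeasure Tree ?X = (\<Prod>w\<in>J. emeasure Unif (A w))"
    using J A by (intro emeasure_PiM_emb) auto
  also have "\<dots> = (\<Prod>w\<in>J \<inter> {[]}. emeasure Unif (A w)) *
      ((\<Prod>w\<in>(#) 1 ` Ji 1. emeasure Unif (A w)) * (\<Prod>w\<in>(#) 2 ` Ji 2. emeasure Unif (A w)))"
  proof -
    have "(\<Prod>w\<in>(#) 1 ` Ji 1. emeasure Unif (A w)) * (\<Prod>w\<in>(#) 2 ` Ji 2. emeasure Unif (A w)) =
        (\<Prod>w\<in>(#) 1 ` Ji 1 \<union> (#) 2 ` Ji 2. emeasure Unif (A w))"
      using fin by (intro prod.union_disjoint[symmetric]) auto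
    moreover have "(\<Prod>w\<in>J. emeasure Unif (A w)) = (\<Prod>w\<in>J \<inter> {[]}. emeasure Unif (A w)) *
        (\<Prod>w\<in>(#) 1 ` Ji 1 \<union> (#) 2 ` Ji 2. emeasure Unif (A w))"
      by (subst Jdec, rule prod.union_disjoint) (use fin in auto)
    ultimately show ?thesis by simp
  qed
  also have "(\<Prod>w\<in>J \<inter> {[]}. emeasure Unif (A w)) = emeasure Unif B"
    by (auto simp: B_def)
  also have "(\<Prod>w\<in>(#) 1 ` Ji 1. emeasure Unif (A w)) = emeasure Tree (E 1)"
    by (subst prod.reindex) (auto simp: Eem)
  also have "(\<Prod>w\<in>(#) 2 ` Ji 2. emeasure Unif (A w)) = emeasure Tree (E 2)"
    by (subst prod.reindex) (auto simp: Eem)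
  also have "emeasure Unif B * (emeasure Tree (E 1) * emeasure Tree (E 2)) =
      emeasure (Unif \<Otimes>\<^sub>M (Tree \<Otimes>\<^sub>M Tree)) (B \<times> (E 1 \<times> E 2))"
    using Bset Eset by (simp add: Tree.emeasure_pair_measure_Times TT.emeasure_pair_measure_Times)
  also have "B \<times> (E 1 \<times> E 2) = (\<lambda>p. graft (fst p) (snd p)) -` ?X \<inter> space (Unif \<Otimes>\<^sub>M (Tree \<Otimes>\<^sub>M Tree))"
  proof -
    have "graft x (a, b) \<in> ?X \<longleftrightarrow> x \<in> B \<and> a \<in> E 1 \<and> b \<in> E 2" if "a \<in> space Tree" "b \<in> space Tree"
        for x a b
    proof -
      have sp: "graft x (a, b) \<in> extensional Vwords" by (simp add: graft_def)
      have ax: "a \<in> extensional Vwords" "b \<in> extensional Vwords"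
        using that by (auto simp: space_PiM PiE_def)
      have "graft x (a, b) \<in> ?X \<longleftrightarrow> (\<forall>w\<in>J. graft x (a, b) w \<in> A w)"
        using J(2) sp by (auto simp: prod_emb_def PiE_iff extensional_def)
      also have "\<dots> \<longleftrightarrow> (\<forall>w\<in>J \<inter> {[]}. graft x (a, b) w \<in> A w) \<and> (\<forall>w\<in>Ji 1. graft x (a, b) (1 # w)
          \<in> A (1 # w))
          \<and> (\<forall>w\<in>Ji 2. graft x (a, b) (2 # w) \<in> A (2 # w))"
        by (subst Jdec) (simp add: ball_Un)
      also have "(\<forall>w\<in>J \<inter> {[]}. graft x (a, b) w \<in> A w) \<longleftrightarrow> x \<in> B"
        by (auto simp: B_def)
      also have "(\<forall>w\<in>Ji 1. graft x (a, b) (1 # w) \<in> A (1 # w)) \<longleftrightarrow> a \<in> E 1"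
        using sub[of 1] ax by (auto simp: E_def prod_emb_def PiE_iff graft_def extensional_def)
      also have "(\<forall>w\<in>Ji 2. graft x (a, b) (2 # w) \<in> A (2 # w)) \<longleftrightarrow> b \<in> E 2"
        using sub[of 2] ax by (auto simp: E_def prod_emb_def PiE_iff graft_def extensional_def)
      finally show ?thesis .
    qed
    moreover have "E i \<subseteq> space Tree" for i using Eset[of i] by (rule sets.sets_into_space)
    ultimately show ?thesis by (fastforce simp: space_pair_measure)
  qed
  also have "emeasure (Unif \<Otimes>\<^sub>M (Tree \<Otimes>\<^sub>M Tree)) \<dots> =
      emeasure (distr (Unif \<Otimes>\<^sub>M (Tree \<Otimes>\<^sub>M Tree)) Tree (\<lambda>p. graft (fst p) (snd p))) ?X"
    using J A by (intro emeasure_distr[symmetric] graft_measurable sets_PiM_I) auto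
  finally show "emeasure Tree ?X = \<dots>" .
qed simp

lemma nn_integral_graft:
  assumes f: "f \<in> borel_measurable Tree"
  shows "(\<integral>\<^sup>+u. f u \<partial>Tree) = (\<integral>\<^sup>+x. \<integral>\<^sup>+ab. f (graft x ab) \<partial>(Tree \<Otimes>\<^sub>M Tree) \<partial>Unif)"
    and "(\<lambda>x. \<integral>\<^sup>+ab. f (graft x ab) \<partial>(Tree \<Otimes>\<^sub>M Tree)) \<in> borel_measurable Unif"
proof -
  interpret Tree: prob_space Tree by simp
  interpret TT: pair_prob_space Tree Tree ..
  have [measurable]: "(\<lambda>p. f (graft (fst p) (snd p))) \<in> borel_measurable (Unif \<Otimes>\<^sub>M (Tree \<Otimes>\<^sub>M Tree))"
    by (rule measurable_compose[OF graft_measurable f])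
  have "(\<integral>\<^sup>+u. f u \<partial>Tree) = (\<integral>\<^sup>+p. f (graft (fst p) (snd p)) \<partial>(Unif \<Otimes>\<^sub>M (Tree \<Otimes>\<^sub>M Tree)))"
    by (subst distr_graft[symmetric], subst nn_integral_distr) (auto simp: f graft_measurable)
  also have "\<dots> = (\<integral>\<^sup>+x. \<integral>\<^sup>+ab. f (graft x ab) \<partial>(Tree \<Otimes>\<^sub>M Tree) \<partial>Unif)"
    by (subst TT.nn_integral_fst[symmetric]) auto
  finally show "(\<integral>\<^sup>+u. f u \<partial>Tree) = (\<integral>\<^sup>+x. \<integral>\<^sup>+ab. f (graft x ab) \<partial>(Tree \<Otimes>\<^sub>M Tree) \<partial>Unif)" .
  have "(\<lambda>x. \<integral>\<^sup>+ab. (\<lambda>p. f (graft (fst p) (snd p))) (x, ab) \<partial>(Tree \<Otimes>\<^sub>M Tree))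
      \<in> borel_measurable Unif"
    by (rule TT.borel_measurable_nn_integral_fst) measurable
  then show "(\<lambda>x. \<integral>\<^sup>+ab. f (graft x ab) \<partial>(Tree \<Otimes>\<^sub>M Tree)) \<in> borel_measurable Unif" by simp
qed

lemma graft_measurable_snd:
  "graft x \<in> Tree \<Otimes>\<^sub>M Tree \<rightarrow>\<^sub>M Tree"
proof -
  have "Pair x \<in> Tree \<Otimes>\<^sub>M Tree \<rightarrow>\<^sub>M Unif \<Otimes>\<^sub>M (Tree \<Otimes>\<^sub>M Tree)" by measurable
  from measurable_compose[OF this graft_measurable] show ?thesis by simp
qed

section \<open>Asymptotics of the toll function\<close>

lemma Harm_eq_harm: "Harm n = harm n"
  by (simp add: Harm_def harm_def inverse_eq_divide)

lemma Harm_Suc: "Harm (Suc n) = Harm n + 1 / (real n + 1)"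
  by (simp add: Harm_def)

lemma Harm_nonneg: "0 \<le> Harm n"
  by (simp add: Harm_def sum_nonneg)

lemma Harm_mono: "m \<le> n \<Longrightarrow> Harm m \<le> Harm n"
  unfolding Harm_def by (intro sum_mono2) auto

lemma Harm_le: "Harm n \<le> real n"
proof (induction n)
  case (Suc n)
  have "1 / (real n + 1) \<le> 1" by simp
  then show ?case using Suc.IH unfolding Harm_Suc of_nat_Suc by linarith
qed (simp add: Harm_def)

lemma Harm_over_n: "(\<lambda>n. Harm n / real n) \<longlonglongrightarrow> 0"
proof -
  have "(\<lambda>n. (harm n - ln (real n)) * (1 / real n) + ln (real n) / real n) \<longlonglongrightarrow> euler_mascheroni * 0
      + 0"
    by (intro tendsto_intros euler_mascheroni_LIMSEQ lim_ln_over_n lim_1_over_n)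
  moreover have "(harm n - ln (real n)) * (1 / real n) + ln (real n) / real n = Harm n / real n"
      for n
    by (cases "n = 0") (simp_all add: Harm_eq_harm field_simps)
  ultimately show ?thesis by simp
qed

lemma xlnx_bounds:
  assumes "0 \<le> x" "x \<le> 1"
  shows "-1 \<le> xlnx x" "xlnx x \<le> 0"
proof -
  show "xlnx x \<le> 0"
    using assms by (auto simp: xlnx_def intro: mult_nonneg_nonpos)
  show "-1 \<le> xlnx x"
  proof (cases "x = 0")
    case False
    then have x: "x > 0" using assms by simp
    have "ln (1 / x) \<le> 1 / x - 1" by (rule ln_le_minus_one) (use x in simp)
    then have "- ln x \<le> 1 / x" using x by (simp add: ln_div)
    then have "x * (- ln x) \<le> x * (1 / x)" using x by (intro mult_left_mono) auto
    then show ?thesis using x by (simp add: xlnx_def)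
  qed (simp add: xlnx_def)
qed

lemma abs_xlnx_le: "0 \<le> x \<Longrightarrow> x \<le> 1 \<Longrightarrow> \<bar>xlnx x\<bar> \<le> 1"
  using xlnx_bounds[of x] by linarith

lemma continuous_xlnx: "continuous_on {0..} xlnx"
proof -
  have "continuous (at x within {0..}) xlnx" if "x \<in> {0..}" for x
  proof (cases "x = 0")
    case True
    have "((\<lambda>x::real. x * ln x) \<longlongrightarrow> 0) (at_right 0)" by real_asymp
    then have "(xlnx \<longlongrightarrow> 0) (at_right 0)"
      by (rule Lim_transform_eventually)
         (auto simp: xlnx_def eventually_at_filter)
    then show ?thesis using True
      by (simp add: continuous_within xlnx_def at_within_Ici_at_right)
  next
    case False
    with that have x: "x > 0" by simp
    have "((\<lambda>x. x * ln x) \<longlongrightarrow> x * ln x) (at x)"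
      using x by (intro tendsto_intros) auto
    moreover have "eventually (\<lambda>y. y * ln y = xlnx y) (at x)"
      using order_tendstoD(1)[OF tendsto_ident_at x] by eventually_elim (auto simp: xlnx_def)
    ultimately have "(xlnx \<longlongrightarrow> xlnx x) (at x)"
      using x by (simp add: Lim_transform_eventually xlnx_def)
    then show ?thesis
      by (simp add: continuous_at continuous_at_imp_continuous_within isCont_def)
  qed
  then show ?thesis by (simp add: continuous_on_eq_continuous_within)
qed

lemma tendsto_xlnx:
  assumes "(f \<longlongrightarrow> a) F" "eventually (\<lambda>k. 0 \<le> f k) F" "0 \<le> a"
  shows "((\<lambda>k. xlnx (f k)) \<longlongrightarrow> xlnx a) F"
  using continuous_on_tendsto_compose[OF continuous_xlnx assms(1)] assms by simp

lemma xlnx_measurable [measurable]: "xlnx \<in> borel_measurable borel"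
  unfolding xlnx_def[abs_def] by measurable

lemma Cfun_measurable [measurable]: "Cfun \<in> borel_measurable borel"
  unfolding Cfun_def[abs_def] by measurable

lemma Ct_measurable [measurable]:
  assumes [measurable]: "f \<in> borel_measurable M" "g \<in> borel_measurable M"
  shows "(\<lambda>x. Ct (f x) (g x)) \<in> borel_measurable M"
  unfolding Ct_def by measurable

text \<open>A generous bound, chosen to coincide with the one for the discrete tolls in
  \<open>abs_Cd_le\<close>.\<close>

lemma abs_Ct_le:
  assumes "0 \<le> t" "t \<le> 1" "0 \<le> x" "x \<le> 1"
  shows "\<bar>Ct t x\<bar> \<le> 40"
proof -
  have "\<bar>xlnx (1 - t)\<bar> \<le> 1" "\<bar>xlnx x\<bar> \<le> 1" "\<bar>xlnx (1 - x)\<bar> \<le> 1" "t < x \<Longrightarrow> \<bar>xlnx (x - t)\<bar> \<le> 1"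
    using assms by (auto intro!: abs_xlnx_le)
  then show ?thesis using assms unfolding Ct_def Cfun_def
      by (auto simp: abs_le_iff split: if_splits)
qed

lemma Ct_one: "x \<le> 1 \<Longrightarrow> Ct 1 x = Cfun x"
  by (simp add: Ct_def)

lemma abs_Cfun_le: "0 \<le> x \<Longrightarrow> x \<le> 1 \<Longrightarrow> \<bar>Cfun x\<bar> \<le> 40"
  using abs_Ct_le[of 1 x] by (simp add: Ct_one)

text \<open>Since \<open>Harm k\<close> is \<open>ln k\<close> plus Euler's constant up to an error
  of at most \<open>1/k\<close>, multiplying by \<open>k\<close> leaves an error of at most 1,
  uniformly in \<open>k\<close> and \<open>n\<close>. The divergent part is linear in
  \<open>k\<close>, so it disappears from a toll whenever the coefficients of the harmonic numbers
  add up to zero.\<close>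

lemma Harm_scaled:
  assumes n: "n > 0"
  obtains r where "\<bar>r\<bar> \<le> 1"
    "real k * Harm k = real n * xlnx (real k / real n) + real k * (ln (real n) + euler_mascheroni)
        + r"
proof (cases "k = 0")
  case True
  then show ?thesis using that[of 0] by (simp add: xlnx_def)
next
  case False
  have "euler_mascheroni \<le> harm k - ln (real k)"
    using False by (intro LIMSEQ_le_const2[OF euler_mascheroni_LIMSEQ])
      (auto intro!: exI[of _ k] euler_mascheroni_sequence_decreasing)
  moreover have "harm k - ln (real k + 1) \<le> euler_mascheroni"
    using euler_mascheroni_lower[of "k - 1"] False
        by (simp add: add.commute) (smt (verit) divide_nonneg_nonneg of_nat_0_le_iff)
  moreover have "ln (real k + 1) - ln (real k) \<le> 1 / real k"
  proof -
    have "ln (real k + 1) - ln (real k) = ln (1 + 1 / real k)"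
      using False by (subst ln_divide_pos[symmetric]) (auto simp: field_simps)
    then show ?thesis using ln_add_one_self_le_self[of "1 / real k"] by simp
  qed
  ultimately have "0 \<le> harm k - ln (real k) - euler_mascheroni"
      "harm k - ln (real k) - euler_mascheroni \<le> 1 / real k"
    by linarith+
  then have "0 \<le> real k * (harm k - ln (real k) - euler_mascheroni)"
    "real k * (harm k - ln (real k) - euler_mascheroni) \<le> real k * (1 / real k)"
    by (auto intro: mult_left_mono simp del: times_divide_eq_right)
  then have "\<bar>real k * (harm k - ln (real k) - euler_mascheroni)\<bar> \<le> 1"
    using False by simp
  moreover have "real n * xlnx (real k / real n) = real k * (ln (real k) - ln (real n))"
    using n False by (simp add: xlnx_def ln_div)
  ultimately show ?thesis
    by (intro that[of "real k * (harm k - ln (real k) - euler_mascheroni)"])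
       (auto simp: Harm_eq_harm algebra_simps)
qed

section \<open>Expansion of the discrete toll on either side of the pivot\<close>

lemma xlnx_one [simp]: "xlnx 1 = 0" by (simp add: xlnx_def)

lemma abs_le_of_scaled:
  fixes x y a b c :: real
  assumes "real n * x = y" "\<bar>y\<bar> \<le> a + b * c" "n > 0"
  shows "\<bar>x\<bar> \<le> a / real n + b * (c / real n)"
proof -
  have "real n * \<bar>x\<bar> \<le> a + b * c"
    using assms(1,2) by (simp add: abs_mult[symmetric] flip: abs_mult_pos')
  then show ?thesis using assms(3) by (simp add: field_simps)
qed

text \<open>After multiplication by \<open>n\<close> the linear parts of the four applications of
  \<open>Harm_scaled\<close> cancel exactly. What remains are the bounded remainders and single
  harmonic numbers, both negligible against \<open>n\<close>.\<close>

lemma Cd_left: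
  assumes "1 \<le> l" "l < i" "i \<le> n"
  shows "\<bar>Cd n l i - (-1 + 2 * (real (i - 1) / real n) + 2 * (xlnx (real (i - 1) / real n)
      + xlnx (real (n + 1 - l) / real n) - xlnx (real (i - l) / real n)))\<bar> \<le> 9 / real n + 12 * (Harm
          n / real n)"
proof -
  have n: "n > 0" using assms by simp
  obtain r1 where r1: "\<bar>r1\<bar> \<le> 1"
      "real n * Harm n = real n * xlnx (real n / real n) + real n * (ln (real n) + euler_mascheroni)
      + r1"
    using Harm_scaled[OF n] by metis
  obtain r2 where r2: "\<bar>r2\<bar> \<le> 1"
      "real (i-1) * Harm (i-1) = real n * xlnx (real (i-1) / real n) + real (i-1) * (ln (real n)
      + euler_mascheroni) + r2"
    using Harm_scaled[OF n] by metis
  obtain r3 where r3: "\<bar>r3\<bar> \<le> 1"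
      "real (n+1-l) * Harm (n+1-l)
      = real n * xlnx (real (n+1-l) / real n) + real (n+1-l) * (ln (real n) + euler_mascheroni) +
      r3"
    using Harm_scaled[OF n] by metis
  obtain r4 where r4: "\<bar>r4\<bar> \<le> 1"
      "real (i-l) * Harm (i-l) = real n * xlnx (real (i-l) / real n) + real (i-l) * (ln (real n)
      + euler_mascheroni) + r4"
    using Harm_scaled[OF n] by metis
  have H: "0 \<le> Harm (i-1)" "Harm (i-1) \<le> Harm n" "0 \<le> Harm (n+1-l)" "Harm (n+1-l) \<le> Harm n"
     "0 \<le> Harm (i-l)" "Harm (i-l) \<le> Harm n"
    using assms by (auto intro!: Harm_nonneg Harm_mono)
  have e: "real (i - 1) = real i - 1" "real (n + 1 - l) = real n + 1 - real l"
    "real (i - Suc 0) = real i - 1" "real (Suc n - l) = real n + 1 - real l"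
        "real (i - l) = real i - real l"
    using assms by auto
  have "real n * Cd n l i = real n - 1 - 2 * real n + 2 * real (i-1) - 2 * (real n * Harm n
      + Harm n)
    + 2 * (real (i-1) * Harm (i-1) + Harm (i-1)) + 2 * (real (n+1-l) * Harm (n+1-l) + 2 * Harm
        (n+1-l))
    - 2 * (real (i-l) * Harm (i-l) + 2 * Harm (i-l))"
    using assms n unfolding Cd_def acoef_def by (auto simp: e algebra_simps)
  also have "\<dots> = real n * (-1 + 2 * (real (i - 1) / real n) + 2 * (xlnx (real (i - 1) / real n)
      + xlnx (real (n + 1 - l) / real n) - xlnx (real (i - l) / real n)))
      + (-1 + 2 * (- r1 + r2 + r3 - r4) + 2 *
          (- Harm n + Harm (i-1) + 2 * Harm (n+1-l) - 2 * Harm (i-l)))"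
    unfolding r1(2) r2(2) r3(2) r4(2) using n by (simp add: e field_simps)
  finally have "real n * (Cd n l i - (-1 + 2 * (real (i - 1) / real n) + 2 * (xlnx (real (i - 1)
      / real n)
      + xlnx (real (n + 1 - l) / real n) - xlnx (real (i - l) / real n)))) =
      (-1 + 2 * (- r1 + r2 + r3 - r4) + 2 *
          (- Harm n + Harm (i-1) + 2 * Harm (n+1-l) - 2 * Harm (i-l)))"
    by (simp add: algebra_simps)
  moreover have "\<bar>\<dots>\<bar> \<le> 9 + 12 * Harm n"
    using H r1(1) r2(1) r3(1) r4(1) by (auto simp: abs_le_iff)
  ultimately show ?thesis by (rule abs_le_of_scaled[OF _ _ n])
qed

text \<open>The terms with \<open>Harm (n + 1 - l)\<close> in \<open>acoef n l\<close> and in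
  \<open>acoef (n - i) (l - i)\<close> coincide and cancel, so the main part does not depend on
  \<open>l\<close>. The linear parts now add up to -2 rather than 0; the surviving multiple of
  \<open>ln n\<close> plus Euler's constant is absorbed into the error.\<close>

lemma Cd_right:
  assumes "1 \<le> i" "i < l" "l \<le> n"
  shows "\<bar>Cd n l i - (1 + 2 * (xlnx (real (i - 1) / real n) + xlnx (real (n - i) / real n)))\<bar>
      \<le> 11 / real n + 8 * (Harm n / real n)"
proof -
  have n: "n > 0" using assms by simp
  obtain r1 where r1: "\<bar>r1\<bar> \<le> 1"
      "real n * Harm n = real n * xlnx (real n / real n) + real n * (ln (real n) + euler_mascheroni)
      + r1"
    using Harm_scaled[OF n] by metis
  obtain r2 where r2: "\<bar>r2\<bar> \<le> 1"
      "real (i-1) * Harm (i-1) = real n * xlnx (real (i-1) / real n) + real (i-1) * (ln (real n)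
      + euler_mascheroni) + r2"
    using Harm_scaled[OF n] by metis
  obtain r3 where r3: "\<bar>r3\<bar> \<le> 1"
      "real (n-i) * Harm (n-i) = real n * xlnx (real (n-i) / real n) + real (n-i) * (ln (real n)
      + euler_mascheroni) + r3"
    using Harm_scaled[OF n] by metis
  have H: "0 \<le> Harm (i-1)" "Harm (i-1) \<le> Harm n" "0 \<le> Harm (n-i)" "Harm (n-i) \<le> Harm n"
    using assms by (auto intro!: Harm_nonneg Harm_mono)
  have ln: "0 \<le> ln (real n)" "ln (real n) \<le> Harm n"
    using n harm_ge_ln[of n] by (auto simp: Harm_eq_harm intro:
        order_trans[of "ln (real n)" "ln (real n + 1)"])
  have em: "0 \<le> (euler_mascheroni::real)" "(euler_mascheroni::real) \<le> 1"
    using euler_mascheroni_pos euler_mascheroni_upper[of 0] ln2_ge_two_thirds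
        by (auto simp: harm_expand)
  have e: "real (i - 1) = real i - 1" "real (i - Suc 0) = real i - 1"
      "real (n - i) = real n - real i" "real (l - i) = real l - real i"
    "n - i + 1 - (l - i) = n + 1 - l"
    using assms by auto
  \<comment> \<open>The default value \<open>acoef 0 0 = 0\<close> fits the formula, so the case
    \<open>i = 1\<close> is consistent with the others.\<close>
  have aii: "acoef (i - 1) (i - 1) = 2 * real i * Harm (i - 1) - 4 * (real i - 1)"
  proof (cases "i = 1")
    case False
    then have "i - 1 \<noteq> 0" using assms by simp
    then show ?thesis using assms unfolding acoef_def
        by (simp add: Harm_def[of "Suc 0"] e algebra_simps)
  qed (simp add: acoef_def Harm_def)
  have "real n * Cd n l i = real n + 3 - 2 * (real n * Harm n + Harm n)
    + 2 * (real (i-1) * Harm (i-1) + Harm (i-1)) + 2 * (real (n-i) * Harm (n-i) + Harm (n-i))"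
    using assms n unfolding Cd_def aii by (simp add: acoef_def e algebra_simps)
  also have "\<dots> = real n * (1 + 2 * (xlnx (real (i - 1) / real n)
      + xlnx (real (n - i) / real n)))
      + (3 + 2 * (- r1 + r2 + r3) - 2 * (ln (real n) + euler_mascheroni) + 2 *
          (- Harm n + Harm (i-1) + Harm (n-i)))"
    unfolding r1(2) r2(2) r3(2) using n by (simp add: e field_simps)
  finally have "real n * (Cd n l i - (1 + 2 * (xlnx (real (i - 1) / real n)
      + xlnx (real (n - i) / real n)))) =
      (3 + 2 * (- r1 + r2 + r3) - 2 * (ln (real n) + euler_mascheroni) + 2 *
          (- Harm n + Harm (i-1) + Harm (n-i)))"
    by (simp add: algebra_simps)
  moreover have "\<bar>\<dots>\<bar> \<le> 11 + 8 * Harm n"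
    using H r1(1) r2(1) r3(1) ln em by (auto simp: abs_le_iff)
  ultimately show ?thesis by (rule abs_le_of_scaled[OF _ _ n])
qed

text \<open>At \<open>l = i\<close> the toll is close to the limit from the left, not to the value
  \<open>Ct x x\<close>, so only boundedness is recorded. That is enough, because
  \<open>x = t\<close> is a null event.\<close>

lemma Cd_middle:
  assumes "1 \<le> i" "i \<le> n"
  shows "\<bar>Cd n i i\<bar> \<le> 40"
proof -
  have n: "n > 0" using assms by simp
  obtain r1 where r1: "\<bar>r1\<bar> \<le> 1"
      "real n * Harm n = real n * xlnx (real n / real n) + real n * (ln (real n) + euler_mascheroni)
      + r1"
    using Harm_scaled[OF n] by metis
  obtain r2 where r2: "\<bar>r2\<bar> \<le> 1"
      "real (i-1) * Harm (i-1) = real n * xlnx (real (i-1) / real n) + real (i-1) * (ln (real n)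
      + euler_mascheroni) + r2"
    using Harm_scaled[OF n] by metis
  obtain r3 where r3: "\<bar>r3\<bar> \<le> 1"
      "real (n+1-i) * Harm (n+1-i)
      = real n * xlnx (real (n+1-i) / real n) + real (n+1-i) * (ln (real n) + euler_mascheroni) +
      r3"
    using Harm_scaled[OF n] by metis
  have H: "0 \<le> Harm (i-1)" "Harm (i-1) \<le> Harm n" "0 \<le> Harm (n+1-i)" "Harm (n+1-i) \<le> Harm n"
    using assms by (auto intro!: Harm_nonneg Harm_mono)
  have e: "real (i - 1) = real i - 1" "real (n + 1 - i) = real n + 1 - real i"
    "real (i - Suc 0) = real i - 1" "real (Suc n - i) = real n + 1 - real i"
    using assms by auto
  have aii: "acoef (i - 1) (i - 1) = 2 * real i * Harm (i - 1) - 4 * (real i - 1)"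
  proof (cases "i = 1")
    case False
    then have "i - 1 \<noteq> 0" using assms by simp
    then show ?thesis using assms unfolding acoef_def
        by (simp add: Harm_def[of "Suc 0"] e algebra_simps)
  qed (simp add: acoef_def Harm_def)
  have "real n * Cd n i i = - real n + 2 * real i - 3 - 2 * (real n * Harm n + Harm n)
    + 2 * (real (i-1) * Harm (i-1) + Harm (i-1)) + 2 * (real (n+1-i) * Harm (n+1-i) + 2 * Harm
        (n+1-i))"
    using assms n unfolding Cd_def aii by (simp add: acoef_def e algebra_simps)
  also have "\<dots> = - real n + 2 * real i - 3 + real n * (2 * (xlnx (real (i - 1) / real n)
      + xlnx (real (n + 1 - i) / real n)))
      + (2 * (- r1 + r2 + r3) + 2 * (- Harm n + Harm (i-1) + 2 * Harm (n+1-i)))"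
    unfolding r1(2) r2(2) r3(2) using n by (simp add: e field_simps)
  finally have *: "real n * Cd n i i
      = - real n + 2 * real i - 3 + real n * (2 * (xlnx (real (i - 1) / real n)
      + xlnx (real (n + 1 - i) / real n)))
      + (2 * (- r1 + r2 + r3) + 2 * (- Harm n + Harm (i-1) + 2 * Harm (n+1-i)))" .
  have "\<bar>xlnx (real (i - 1) / real n)\<bar> \<le> 1" "\<bar>xlnx (real (n + 1 - i) / real n)\<bar> \<le> 1"
    using assms n by (auto intro!: abs_xlnx_le)
  then have X: "\<bar>2 * (xlnx (real (i - 1) / real n) + xlnx (real (n + 1 - i) / real n))\<bar> \<le> 4"
    by (auto simp: abs_le_iff)
  have "\<bar>real n * (2 * (xlnx (real (i - 1) / real n) + xlnx (real (n + 1 - i) / real n)))\<bar>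
      \<le> real n * 4"
    using X unfolding abs_mult[of "real n"] abs_of_nat by (intro mult_left_mono) auto
  then have "\<bar>real n * Cd n i i\<bar> \<le> 40 * real n"
  proof -
    define h1 h2 where "h1 = Harm (i - 1)" "h2 = Harm (n + 1 - i)"
    define Z where "Z = real n * (2 * (xlnx (real (i - 1) / real n) + xlnx (real (n + 1 - i)
        / real n)))"
    assume "\<bar>real n * (2 * (xlnx (real (i - 1) / real n) + xlnx (real (n + 1 - i) / real n)))\<bar>
        \<le> real n * 4"
    then have "Z \<le> real n * 4" "- (real n * 4) \<le> Z" by (auto simp: Z_def abs_le_iff)
    moreover have "1 \<le> real i" "real i \<le> real n" "1 \<le> real n" using assms by auto
    ultimately show ?thesis
      unfolding * Z_def[symmetric]
          using H[folded h1_h2_def] Harm_le[of n] abs_le_D1[OF r1(1)] abs_le_D1[OF r2(1)]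
          abs_le_D1[OF r3(1)]
        abs_le_D2[OF r1(1)] abs_le_D2[OF r2(1)] abs_le_D2[OF r3(1)]
      unfolding h1_h2_def[symmetric] by argo
  qed
  then show ?thesis using n by (simp add: abs_mult)
qed

lemma abs_Cd_le:
  assumes "1 \<le> i" "i \<le> n" "l \<le> n"
  shows "\<bar>Cd n l i\<bar> \<le> 40"
proof -
  have n: "n > 0" using assms by simp
  \<comment> \<open>Off the diagonal \<open>l = i\<close> the main part is at most 10 in modulus; by
    \<open>Harm n \<le> n\<close> the error is at most the sum of its coefficients, hence at most
    30.\<close>
  have le: "\<bar>c\<bar> \<le> 40" if "\<bar>c - g\<bar> \<le> a / real n + b * (Harm n / real n)" "\<bar>g\<bar> \<le> 10"
    "0 \<le> a" "0 \<le> b" "a + b \<le> 30" for c g a b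
  proof -
    have "a / real n + b * (Harm n / real n) \<le> a * 1 + b * 1"
      using Harm_le[of n] n that unfolding divide_inverse
      by (intro add_mono mult_left_mono) (auto simp: field_simps)
    then show ?thesis using that by linarith
  qed
  consider "l = 0" | "1 \<le> l" "l < i" | "l = i" | "i < l" by linarith
  then show ?thesis
  proof cases
    case 1 then show ?thesis by (simp add: Cd_def)
  next
    case 2
    have "xlnx (real (i - 1) / real n) \<le> 0" "- 1 \<le> xlnx (real (i - 1) / real n)"
      "xlnx (real (n + 1 - l) / real n) \<le> 0" "- 1 \<le> xlnx (real (n + 1 - l) / real n)"
      "xlnx (real (i - l) / real n) \<le> 0" "- 1 \<le> xlnx (real (i - l) / real n)"
      "real (i - 1) / real n \<le> 1" "0 \<le> real (i - 1) / real n"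
      using assms n 2 by (auto intro!: xlnx_bounds)
    then have "\<bar>-1 + 2 * (real (i - 1) / real n) + 2 * (xlnx (real (i - 1) / real n)
      + xlnx (real (n + 1 - l) / real n) - xlnx (real (i - l) / real n))\<bar> \<le> 10"
      by argo
    then show ?thesis by (rule le[OF Cd_left[OF 2 assms(2)]]) auto
  next
    case 3 then show ?thesis using Cd_middle assms by simp
  next
    case 4
    have "xlnx (real (i - 1) / real n) \<le> 0" "- 1 \<le> xlnx (real (i - 1) / real n)"
      "xlnx (real (n - i) / real n) \<le> 0" "- 1 \<le> xlnx (real (n - i) / real n)"
      using assms n 4 by (auto intro!: xlnx_bounds)
    then have "\<bar>1 + 2 * (xlnx (real (i - 1) / real n) + xlnx (real (n - i) / real n))\<bar> \<le> 10"
      by argo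
    then show ?thesis by (rule le[OF Cd_right[OF assms(1) 4 assms(3)]]) auto
  qed
qed

text \<open>Stated for arbitrary index sequences because ranks and sizes in subtrees are not of the
  form \<open>\<lfloor>n * t\<rfloor>\<close> and \<open>n\<close>. Positivity of \<open>t\<close>
  keeps \<open>L k\<close> away from the special value \<open>Cd n 0 i = 0\<close>, and
  \<open>t \<noteq> x\<close> decides which branch is eventually in force.\<close>

lemma Cd_tendsto:
  fixes N L I :: "nat \<Rightarrow> nat"
  assumes N: "filterlim N at_top sequentially"
    and L: "(\<lambda>k. real (L k) / real (N k)) \<longlonglongrightarrow> t" "\<And>k. L k \<le> N k"
    and I: "(\<lambda>k. real (I k) / real (N k)) \<longlonglongrightarrow> x" "eventually (\<lambda>k. 1 \<le> I k \<and> I k \<le> N k) sequentially"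
    and t: "0 < t" "t \<le> 1" and x: "0 \<le> x" "x \<le> 1" and tx: "t \<noteq> x"
  shows "(\<lambda>k. Cd (N k) (L k) (I k)) \<longlonglongrightarrow> Ct t x"
proof -
  have N1: "(\<lambda>k. 1 / real (N k)) \<longlonglongrightarrow> 0"
    using filterlim_compose[OF lim_1_over_n N] .
  have NH: "(\<lambda>k. Harm (N k) / real (N k)) \<longlonglongrightarrow> 0"
    using filterlim_compose[OF Harm_over_n N] .
  have Npos: "eventually (\<lambda>k. 0 < N k) sequentially"
    using N eventually_gt_at_top[of 0] by (simp add: filterlim_iff)
  have Lpos: "eventually (\<lambda>k. 1 \<le> L k) sequentially"
    using order_tendstoD(1)[OF L(1) t(1)]
        by eventually_elim (auto simp: Suc_le_eq zero_less_divide_iff)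
  have I1: "(\<lambda>k. real (I k - 1) / real (N k)) \<longlonglongrightarrow> x"
  proof (rule Lim_transform_eventually)
    show "(\<lambda>k. real (I k) / real (N k) - 1 / real (N k)) \<longlonglongrightarrow> x"
      using tendsto_diff[OF I(1) N1] by simp
    show "eventually (\<lambda>k. real (I k) / real (N k) - 1 / real (N k)
        = real (I k - 1) / real (N k)) sequentially"
      using I(2) by eventually_elim (auto simp: of_nat_diff diff_divide_distrib)
  qed
  from tx consider "t < x" | "x < t" by linarith
  then show ?thesis
  proof cases
    case 1
    have LI: "eventually (\<lambda>k. L k < I k) sequentially"
      using order_tendstoD(1)[OF tendsto_diff[OF I(1) L(1)], of 0] 1
      by (auto elim!: eventually_mono simp: diff_divide_distrib[symmetric] zero_less_divide_iff)
    let ?G = "\<lambda>k. -1 + 2 * (real (I k - 1) / real (N k)) + 2 * (xlnx (real (I k - 1) / real (N k))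
      + xlnx (real (N k + 1 - L k) / real (N k)) - xlnx (real (I k - L k) / real (N k)))"
    have A: "(\<lambda>k. real (N k + 1 - L k) / real (N k)) \<longlonglongrightarrow> 1 - t"
    proof (rule Lim_transform_eventually)
      show "(\<lambda>k. 1 + 1 / real (N k) - real (L k) / real (N k)) \<longlonglongrightarrow> 1 - t"
        using tendsto_diff[OF tendsto_add[OF tendsto_const N1] L(1), of 1] by simp
      show "eventually (\<lambda>k. 1 + 1 / real (N k) - real (L k) / real (N k)
          = real (N k + 1 - L k) / real (N k)) sequentially"
        using Npos by eventually_elim (use L(2) in \<open>auto simp: of_nat_diff le_SucI field_simps\<close>)
    qed
    have B: "(\<lambda>k. real (I k - L k) / real (N k)) \<longlonglongrightarrow> x - t"
    proof (rule Lim_transform_eventually)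
      show "(\<lambda>k. real (I k) / real (N k) - real (L k) / real (N k)) \<longlonglongrightarrow> x - t"
        using tendsto_diff[OF I(1) L(1)] .
      show "eventually (\<lambda>k. real (I k) / real (N k) - real (L k) / real (N k)
          = real (I k - L k) / real (N k)) sequentially"
        using LI by eventually_elim (auto simp: of_nat_diff diff_divide_distrib)
    qed
    have "?G \<longlonglongrightarrow> -1 + 2 * x + 2 * (xlnx x + xlnx (1 - t) - xlnx (x - t))"
      by (intro tendsto_intros tendsto_xlnx I1 A B) (use t x 1 in auto)
    also have "-1 + 2 * x + 2 * (xlnx x + xlnx (1 - t) - xlnx (x - t)) = Ct t x"
      using 1 by (simp add: Ct_def Cfun_def)
    finally have G: "?G \<longlonglongrightarrow> Ct t x" .
    have "(\<lambda>k. Cd (N k) (L k) (I k) - ?G k) \<longlonglongrightarrow> 0"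
    proof (rule Lim_null_comparison)
      show "eventually (\<lambda>k. norm (Cd (N k) (L k) (I k) - ?G k)
          \<le> 9 * (1 / real (N k)) + 12 * (Harm (N k) / real (N k))) sequentially"
        using LI Lpos I(2)
      proof eventually_elim
        case (elim k)
        then show ?case using Cd_left[of "L k" "I k" "N k"] by (simp add: algebra_simps)
      qed
      show "(\<lambda>k. 9 * (1 / real (N k)) + 12 * (Harm (N k) / real (N k))) \<longlonglongrightarrow> 0"
        using tendsto_add[OF tendsto_mult_left[OF N1, of 9] tendsto_mult_left[OF NH, of 12]] by simp
    qed
    from tendsto_add[OF this G] show ?thesis by simp
  next
    case 2
    have LI: "eventually (\<lambda>k. I k < L k) sequentially"
      using order_tendstoD(1)[OF tendsto_diff[OF L(1) I(1)], of 0] 2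
      by (auto elim!: eventually_mono simp: diff_divide_distrib[symmetric] zero_less_divide_iff)
    let ?G = "\<lambda>k. 1 + 2 * (xlnx (real (I k - 1) / real (N k)) + xlnx (real (N k - I k)
        / real (N k)))"
    have A: "(\<lambda>k. real (N k - I k) / real (N k)) \<longlonglongrightarrow> 1 - x"
    proof (rule Lim_transform_eventually)
      show "(\<lambda>k. 1 - real (I k) / real (N k)) \<longlonglongrightarrow> 1 - x"
        using tendsto_diff[OF tendsto_const I(1), of 1] by simp
      show "eventually (\<lambda>k. 1 - real (I k) / real (N k)
          = real (N k - I k) / real (N k)) sequentially"
        using Npos I(2) by eventually_elim (auto simp: of_nat_diff field_simps)
    qed
    have "?G \<longlonglongrightarrow> 1 + 2 * (xlnx x + xlnx (1 - x))"
      by (intro tendsto_intros tendsto_xlnx I1 A) (use t x 2 in auto)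
    also have "1 + 2 * (xlnx x + xlnx (1 - x)) = Ct t x"
      using 2 by (simp add: Ct_def Cfun_def)
    finally have G: "?G \<longlonglongrightarrow> Ct t x" .
    have "(\<lambda>k. Cd (N k) (L k) (I k) - ?G k) \<longlonglongrightarrow> 0"
    proof (rule Lim_null_comparison)
      show "eventually (\<lambda>k. norm (Cd (N k) (L k) (I k) - ?G k)
          \<le> 11 * (1 / real (N k)) + 8 * (Harm (N k) / real (N k))) sequentially"
        using LI Lpos I(2)
      proof eventually_elim
        case (elim k)
        then show ?case using Cd_right[of "I k" "L k" "N k"] L(2)[of k] by (simp add: algebra_simps)
      qed
      show "(\<lambda>k. 11 * (1 / real (N k)) + 8 * (Harm (N k) / real (N k))) \<longlonglongrightarrow> 0"
        using tendsto_add[OF tendsto_mult_left[OF N1, of 11] tendsto_mult_left[OF NH, of 8]] by simp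
    qed
    from tendsto_add[OF this G] show ?thesis by simp
  qed
qed

section \<open>Recursions at the root\<close>

declare Yd.simps [simp del]

text \<open>Indexed by the integer rank instead of the time, since the recursion transforms ranks
  exactly while rescaled times involve rounding.\<close>

definition yd :: "nat \<Rightarrow> nat \<Rightarrow> (nat list \<Rightarrow> real) \<Rightarrow> real" where
  "yd n l u = Yd u [] n (real l / real n)"

lemma Yd_shift: "Yd u (v @ w) n t = Yd (\<lambda>w. u (v @ w)) w n t"
proof (induction n arbitrary: w t rule: less_induct)
  case (less n)
  show ?case
  proof (cases "n < 2")
    case True
    then show ?thesis by (subst (1 2) Yd.simps) simp
  next
    case False
    define I where "I = nat \<lceil>real n * u (v @ w)\<rceil>"
    show ?thesis
    proof (cases "I < 1 \<or> n < I")
      case True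
      then show ?thesis using False by (subst (1 2) Yd.simps) (simp add: I_def[symmetric])
    next
      case I: False
      then have "I - 1 < n" "n - I < n" by auto
      then have IH: "Yd u (v @ w @ [Suc 0]) (I - Suc 0) s
          = Yd (\<lambda>w. u (v @ w)) (w @ [Suc 0]) (I - Suc 0) s"
        "Yd u (v @ w @ [2]) (n - I) s = Yd (\<lambda>w. u (v @ w)) (w @ [2]) (n - I) s" for s
        using less.IH[of "I - 1" "w @ [Suc 0]" s] less.IH[of "n - I" "w @ [2]" s] by simp_all
      show ?thesis using False I
        by (subst (1 2) Yd.simps) (simp add: I_def[symmetric] IH Let_def)
    qed
  qed
qed

lemma Yd_subtree: "Yd u [1] n t = Yd (subtree 1 u) [] n t" "Yd u [2] n t = Yd (subtree 2 u) [] n t"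
  using Yd_shift[of u "[1]" "[]"] Yd_shift[of u "[2]" "[]"] by (simp_all add: subtree_def)

lemma floor_lt_index_iff: "n > 0 \<Longrightarrow> 0 \<le> t \<Longrightarrow> t < real i / real n \<longleftrightarrow> nat \<lfloor>real n * t\<rfloor> < i"
proof -
  assume n: "n > 0" and t: "0 \<le> t"
  have "t < real i / real n \<longleftrightarrow> real n * t < real_of_int (int i)"
    using n by (simp add: field_simps)
  also have "\<dots> \<longleftrightarrow> \<lfloor>real n * t\<rfloor> < int i" by (simp add: floor_less_iff)
  also have "\<dots> \<longleftrightarrow> nat \<lfloor>real n * t\<rfloor> < i"
  proof -
    have "0 \<le> \<lfloor>real n * t\<rfloor>" using t by simp
    then show ?thesis by linarith
  qed
  finally show ?thesis .
qed

text \<open>\<open>Yd\<close> is a step function with jumps at multiples of \<open>1/n\<close> only.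
  The toll and the left branch see the time through its integer part alone. The right branch
  receives the unrounded time, but \<open>n - I\<close> times the rescaled time is
  \<open>n * t - I\<close>, whose integer part is \<open>l - I\<close>; this is where the induction
  enters.\<close>

lemma Yd_eq_yd:
  assumes "0 \<le> t" "t \<le> 1" "n \<noteq> 0"
  shows "Yd u [] n t = yd n (nat \<lfloor>real n * t\<rfloor>) u"
  using assms
proof (induction n arbitrary: t u rule: less_induct)
  case (less n)
  let ?l = "nat \<lfloor>real n * t\<rfloor>"
  have n: "n > 0" using less by simp
  have t': "0 \<le> real ?l / real n" by simp
  have l': "nat \<lfloor>real n * (real ?l / real n)\<rfloor> = ?l" using n by simp
  show ?case
  proof (cases "n < 2")
    case True
    then show ?thesis unfolding yd_def by (subst (1 2) Yd.simps) simp
  next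
    case False
    define I where "I = nat \<lceil>real n * u []\<rceil>"
    show ?thesis
    proof (cases "I < 1 \<or> n < I")
      case True
      then show ?thesis using False unfolding yd_def
          by (subst (1 2) Yd.simps) (simp add: I_def[symmetric])
    next
      case I: False
      note lt = floor_lt_index_iff[OF n less.prems(1), of I]
          floor_lt_index_iff[OF n t', of I, unfolded l']
      have last: "real (n - I) / real n * Yd u [2] (n - I) (max 0 ((t - real I / real n) / (1
          - real I / real n)))
         = real (n - I) / real n * Yd u [2] (n - I) (max 0
             ((real ?l / real n - real I / real n) / (1 - real I / real n)))"
        if "\<not> ?l < I"
      proof (cases "I = n")
        case False
        with I have In: "I < n" by simp
        have tI: "real I / real n \<le> t" using that lt by simp
        have "(t - real I / real n) / (1 - real I / real n)
            = (real n * t - real I) / (real n - real I)"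
          using n In by (simp add: field_simps)
        moreover have "0 \<le> (real n * t - real I) / (real n - real I)"
          using tI In n by (intro divide_nonneg_nonneg) (simp_all add: field_simps)
        moreover have ntn: "real n * t \<le> real n * 1" using less.prems(2)
            by (intro mult_left_mono) auto
        have "(real n * t - real I) / (real n - real I) \<le> 1"
          using In ntn by (simp add: field_simps)
        moreover have "(real ?l / real n - real I / real n) / (1 - real I / real n)
            = real (?l - I) / real (n - I)"
          using n In that by (simp add: field_simps of_nat_diff)
        moreover have "real (n - I) * ((real n * t - real I) / (real n - real I))
            = real n * t - of_nat I"
          using In by (simp add: of_nat_diff)
        moreover have "nat \<lfloor>real n * t - real I\<rfloor> = ?l - I"
          using floor_diff_of_int[of "real n * t" "int I"] by (simp add: nat_diff_distrib')
        moreover have "n - I < n" using I by simp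
        ultimately show ?thesis
          using less.IH[of "n - I" "(real n * t - real I) / (real n - real I)" "subtree 2 u"] In
          by (simp add: Yd_subtree yd_def)
      qed simp
      show ?thesis using False I last lt l' unfolding yd_def
        by (subst (1 2) Yd.simps) (simp add: I_def[symmetric] Let_def)
    qed
  qed
qed

lemma yd_less2: "n < 2 \<Longrightarrow> yd n l u = 0"
  unfolding yd_def by (subst Yd.simps) simp

lemma yd_out: "i = nat \<lceil>real n * u []\<rceil> \<Longrightarrow> i < 1 \<or> n < i \<Longrightarrow> yd n l u = 0"
  unfolding yd_def by (subst Yd.simps) auto

lemma yd_rec:
  assumes "2 \<le> n" "l \<le> n" and i: "i = nat \<lceil>real n * u []\<rceil>" "1 \<le> i" "i \<le> n"
  shows "yd n l u = Cd n l i + (real (i - 1) / real n) * yd (i - 1) (if l < i then l else i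
      - 1) (subtree 1 u)
      + (if l < i then 0 else (real (n - i) / real n) * yd (n - i) (l - i) (subtree 2 u))"
proof -
  have n: "n > 0" using assms by simp
  have lt: "real l / real n < real i / real n \<longleftrightarrow> l < i" using n by (simp add: field_simps)
  have l: "nat \<lfloor>real n * (real l / real n)\<rfloor> = l" using n by simp
  \<comment> \<open>For \<open>i = 1\<close> the time is a quotient by zero, which is harmless
    because the prefactor vanishes.\<close>
  have A: "real (i - 1) / real n * Yd (subtree 1 u) [] (i - 1) (min 1 (real l / real (i - 1))) =
    (real (i - 1) / real n) * yd (i - 1) l (subtree 1 u)" if "l < i"
    using that by (cases "i = 1") (auto simp: yd_def min_absorb2 divide_le_eq_1)
  have B: "real (i - 1) / real n * Yd (subtree 1 u) [] (i - 1) 1 =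
    (real (i - 1) / real n) * yd (i - 1) (i - 1) (subtree 1 u)"
    by (cases "i = 1") (auto simp: yd_def)
  have C: "real (n - i) / real n * Yd (subtree 2 u) [] (n - i) (max 0 ((real l / real n - real i
      / real n) / (1 - real i / real n))) =
    (real (n - i) / real n) * yd (n - i) (l - i) (subtree 2 u)" if "\<not> l < i"
  proof (cases "i = n")
    case False
    then have "i < n" using i(3) by linarith
    then have "(real l / real n - real i / real n) / (1 - real i / real n)
        = real (l - i) / real (n - i)"
      using that n by (simp add: field_simps of_nat_diff)
    then show ?thesis by (simp add: yd_def)
  qed simp
  have "yd n l u = Yd u [] n (real l / real n)" by (simp add: yd_def)
  also have "\<dots> = Cd n l i + (if l < i
         then (real (i - 1) / real n) * Yd u ([] @ [1]) (i - 1) (min 1 (real l / real (i - 1)))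
         else (real (i - 1) / real n) * Yd u ([] @ [1]) (i - 1) 1
              + (real (n - i) / real n) * Yd u ([] @ [2]) (n - i) (max 0
                  ((real l / real n - real i / real n) / (1 - real i / real n))))"
    using assms(1) i(2,3) by (subst Yd.simps) (simp only: i(1)[symmetric] Let_def lt l, simp)
  finally show ?thesis
    using A B C by (simp only: append.simps Yd_subtree split: if_split) auto
qed

section \<open>Root recursions for the partial sums of the limit objects\<close>

lemma Vlt_0: "Vlt 0 = {}"
  by (simp add: Vlt_def)

lemma Vlt_Suc: "Vlt (Suc m) = insert [] ((#) 1 ` Vlt m \<union> (#) 2 ` Vlt m)"
proof (intro equalityI subsetI)
  fix w assume w: "w \<in> Vlt (Suc m)"
  show "w \<in> insert [] ((#) 1 ` Vlt m \<union> (#) 2 ` Vlt m)"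
    using w by (cases w) (auto simp: Vlt_def)
qed (auto simp: Vlt_def)

lemma finite_Vlt: "finite (Vlt m)"
  by (induction m) (auto simp: Vlt_0 Vlt_Suc)

lemma sum_Vlt_Suc:
  fixes f :: "nat list \<Rightarrow> real"
  shows "(\<Sum>w\<in>Vlt (Suc m). f w) = f [] + (\<Sum>w\<in>Vlt m. f (1 # w)) + (\<Sum>w\<in>Vlt m. f (2 # w))"
proof -
  have "(\<Sum>w\<in>Vlt (Suc m). f w) = f [] + (\<Sum>w\<in>(#) 1 ` Vlt m \<union> (#) 2 ` Vlt m. f w)"
    unfolding Vlt_Suc using finite_Vlt by (subst sum.insert) auto
  also have "(\<Sum>w\<in>(#) 1 ` Vlt m \<union> (#) 2 ` Vlt m. f w)
      = (\<Sum>w\<in>(#) 1 ` Vlt m. f w) + (\<Sum>w\<in>(#) 2 ` Vlt m. f w)"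
    using finite_Vlt by (intro sum.union_disjoint) auto
  finally show ?thesis by (simp add: sum.reindex)
qed

lemma ell_Nil: "ell u v [] = 1"
  by (simp add: ell_def)

lemma ell_Cons: "ell u v (i # w) = (if i = 1 then u v else 1 - u v) * ell u (v @ [i]) w"
  unfolding ell_def by (simp add: prod.lessThan_Suc_shift del: prod.lessThan_Suc cong: prod.cong
      if_cong)

lemma ell_shift: "ell u (v @ v') w = ell (\<lambda>w. u (v @ w)) v' w"
  by (simp add: ell_def cong: if_cong)

lemma Lop_Nil: "Lop u v [] h = h"
  by (simp add: Lop_def)

lemma Lop_Cons: "Lop u v (i # w) h = Top u v i (Lop u (v @ [i]) w h)"
proof -
  have "[0..<length (i # w)] = 0 # map Suc [0..<length w]"
    by (simp add: map_Suc_upt upt_conv_Cons del: upt_Suc)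
  then show ?thesis unfolding Lop_def by (simp add: foldr_map o_def)
qed

lemma Top_shift: "Top u (v @ v') = Top (\<lambda>w. u (v @ w)) v'"
  by (simp add: Top_def fun_eq_iff)

lemma Lop_shift: "Lop u (v @ v') w h = Lop (\<lambda>w. u (v @ w)) v' w h"
  unfolding Lop_def append_assoc Top_shift[of u v] ..

lemma Qp_shift: "Qp u (v @ v') = Qp (\<lambda>w. u (v @ w)) v'"
  by (simp add: Qp_def ell_shift[of u v])

lemma Cc_shift: "Cc u (v @ v') = Cc (\<lambda>w. u (v @ w)) v'"
  by (simp add: Cc_def Qp_shift[of u v] fun_eq_iff)

lemma Rm_shift: "Rm u (v @ v') m t = Rm (\<lambda>w. u (v @ w)) v' m t"
  by (simp add: Rm_def Lop_shift[of u v] Cc_shift[of u v])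

lemma Yc_shift: "Yc u (v @ v') t = Yc (\<lambda>w. u (v @ w)) v' t"
  by (simp add: Yc_def Rm_shift[of u v])

definition Qs :: "nat \<Rightarrow> (nat list \<Rightarrow> real) \<Rightarrow> real" where
  "Qs m u = (\<Sum>w\<in>Vlt m. ell u [] w * Cfun (u w))"

lemma Qp_eq: "Qp u [] = lim (\<lambda>m. Qs m u)"
  by (simp add: Qp_def Qs_def)

lemma Qs_0: "Qs 0 u = 0"
  by (simp add: Qs_def Vlt_0)

lemma Qs_Suc: "Qs (Suc m) u
    = Cfun (u []) + u [] * Qs m (subtree 1 u) + (1 - u []) * Qs m (subtree 2 u)"
proof -
  have "ell u [i] w = ell (subtree i u) [] w" for w i
    using ell_shift[of u "[i]" "[]" w] by (simp add: subtree_def)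
  then show ?thesis
    unfolding Qs_def sum_Vlt_Suc
        by (simp add: ell_Nil ell_Cons sum_distrib_left subtree_def mult.assoc)
qed

lemma Top_sum: "finite A \<Longrightarrow> Top u v i (\<lambda>t. \<Sum>w\<in>A. h w t) t = (\<Sum>w\<in>A. Top u v i (h w) t)"
  by (simp add: Top_def sum_distrib_left)

lemma Rm_0: "Rm u v 0 t = 0"
  by (simp add: Rm_def Vlt_0)

lemma Rm_Suc: "Rm u [] (Suc m) t = Cc u [] t + Top u [] 1 (Rm (subtree 1 u) [] m) t
    + Top u [] 2 (Rm (subtree 2 u) [] m) t"
proof -
  have "Lop u [i] w (Cc u (i # w)) = Lop (subtree i u) [] w (Cc (subtree i u) w)" for w i
    using Lop_shift[of u "[i]" "[]" w] Cc_shift[of u "[i]" w] by (simp add: subtree_def)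
  then show ?thesis
    unfolding Rm_def sum_Vlt_Suc by (simp add: Lop_Nil Lop_Cons Top_sum[OF finite_Vlt])
qed

lemma Cc_subtree: "Cc u [] t = Ct t (u []) + (if t \<ge> u [] then u [] * Qp (subtree 1 u) [] else 0)"
  using Qp_shift[of u "[1]" "[]"] by (simp add: Cc_def subtree_def)

section \<open>Second moments\<close>

text \<open>The squared L2 norm, taken in \<open>ennreal\<close> so that recursions can be written
  down before any integrability is known.\<close>

definition sqn :: "'b measure \<Rightarrow> ('b \<Rightarrow> real) \<Rightarrow> ennreal" where
  "sqn M f = (\<integral>\<^sup>+x. ennreal ((f x)\<^sup>2) \<partial>M)"

lemma sqn_cong_AE: "AE x in M. f x = g x \<Longrightarrow> sqn M f = sqn M g"
  unfolding sqn_def by (intro nn_integral_cong_AE) auto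

lemma sqn_cong: "(\<And>x. x \<in> space M \<Longrightarrow> f x = g x) \<Longrightarrow> sqn M f = sqn M g"
  unfolding sqn_def by (intro nn_integral_cong) auto

lemma sqn_zero [simp]: "sqn M (\<lambda>x. 0) = 0"
  by (simp add: sqn_def)

text \<open>Young's inequality with a free weight: \<open>c = 1\<close> serves for crude bounds,
  \<open>c = 1/4\<close> where the factor of \<open>g\<close> must stay below 3/2.\<close>

lemma sqn_add_le:
  assumes [measurable]: "f \<in> borel_measurable M" "g \<in> borel_measurable M" and c: "0 < c"
  shows "sqn M (\<lambda>x. f x + g x) \<le> ennreal (1 + 1 / c) * sqn M f + ennreal (1 + c) * sqn M g"
proof -
  have ineq: "(a + b)\<^sup>2 \<le> (1 + 1 / c) * a\<^sup>2 + (1 + c) * b\<^sup>2" for a b :: real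
  proof -
    have "0 \<le> (a / sqrt c - sqrt c * b)\<^sup>2" by simp
    also have "\<dots> = a\<^sup>2 / c - 2 * a * b + c * b\<^sup>2"
      using c by (simp add: power2_diff power_divide power_mult_distrib)
    finally show ?thesis by (simp add: power2_sum algebra_simps)
  qed
  have "sqn M (\<lambda>x. f x + g x)
      \<le> (\<integral>\<^sup>+x. ennreal (1 + 1 / c) * ennreal ((f x)\<^sup>2) + ennreal (1 + c) * ennreal ((g x)\<^sup>2) \<partial>M)"
    unfolding sqn_def
  proof (intro nn_integral_mono)
    fix x
    have "ennreal ((f x + g x)\<^sup>2) \<le> ennreal ((1 + 1 / c) * (f x)\<^sup>2 + (1 + c) * (g x)\<^sup>2)"
      by (rule ennreal_leI[OF ineq])
    also have "\<dots> = ennreal (1 + 1 / c) * ennreal ((f x)\<^sup>2) + ennreal (1 + c) * ennreal ((g x)\<^sup>2)"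
      using c by (subst ennreal_plus) (auto simp: ennreal_mult)
    finally show "ennreal ((f x + g x)\<^sup>2) \<le> \<dots>" .
  qed
  also have "\<dots> = ennreal (1 + 1 / c) * sqn M f + ennreal (1 + c) * sqn M g"
    unfolding sqn_def by (subst nn_integral_add) (auto simp: nn_integral_cmult)
  finally show ?thesis .
qed

lemma sqn_cmult:
  assumes [measurable]: "f \<in> borel_measurable M"
  shows "sqn M (\<lambda>x. c * f x) = ennreal (c\<^sup>2) * sqn M f"
  unfolding sqn_def by (subst nn_integral_cmult[symmetric]) (auto simp: power_mult_distrib
      ennreal_mult)

lemma (in prob_space) sqn_const [simp]: "sqn M (\<lambda>x. c) = ennreal (c\<^sup>2)"
  by (simp add: sqn_def emeasure_space_1)

lemma (in prob_space) integrable_of_sqn: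
  assumes [measurable]: "f \<in> borel_measurable M" and fin: "sqn M f < \<infinity>"
  shows "integrable M (\<lambda>x. (f x)\<^sup>2)" "integrable M f"
proof -
  show *: "integrable M (\<lambda>x. (f x)\<^sup>2)"
    using fin by (intro integrableI_bounded) (auto simp: sqn_def)
  have "\<bar>a\<bar> \<le> 1 + a\<^sup>2" for a :: real
  proof -
    have "0 \<le> (\<bar>a\<bar> - 1)\<^sup>2" by simp
    then have "2 * \<bar>a\<bar> \<le> a\<^sup>2 + 1" by (simp add: power2_diff)
    moreover have "0 \<le> a\<^sup>2" by simp
    ultimately show ?thesis by linarith
  qed
  then show "integrable M f"
    using * by (intro Bochner_Integration.integrable_bound[of M "\<lambda>x. 1
        + (f x)\<^sup>2" f]) (auto intro!: AE_I2)
qed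

lemma (in prob_space) sqn_const_add_centred:
  assumes [measurable]: "f \<in> borel_measurable M" and f: "(\<integral>x. f x \<partial>M) = 0" "sqn M f < \<infinity>"
  shows "sqn M (\<lambda>x. c + f x) = ennreal (c\<^sup>2) + sqn M f"
proof -
  note int = integrable_of_sqn[OF assms(1) f(2)]
  have e: "(c + f x)\<^sup>2 = c\<^sup>2 + (2 * c * f x + (f x)\<^sup>2)" for x by (simp add: power2_sum)
  have "sqn M (\<lambda>x. c + f x) = ennreal (\<integral>x. (c + f x)\<^sup>2 \<partial>M)"
    unfolding sqn_def
  proof (rule nn_integral_eq_integral)
    show "integrable M (\<lambda>x. (c + f x)\<^sup>2)" unfolding e using int by simp
  qed simp
  also have "(\<integral>x. (c + f x)\<^sup>2 \<partial>M) = c\<^sup>2 + (\<integral>x. (f x)\<^sup>2 \<partial>M)"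
    unfolding e using int f(1) by (simp add: prob_space)
  also have "ennreal \<dots> = ennreal (c\<^sup>2) + ennreal (\<integral>x. (f x)\<^sup>2 \<partial>M)"
    by (intro ennreal_plus) auto
  also have "ennreal (\<integral>x. (f x)\<^sup>2 \<partial>M) = sqn M f"
    unfolding sqn_def using int by (intro nn_integral_eq_integral[symmetric]) auto
  finally show ?thesis .
qed

text \<open>Pythagoras applied twice: for a fixed first coordinate, \<open>c + f x\<close> is a
  constant added to the centred \<open>g\<close>.\<close>

lemma sqn_const_add_two_centred:
  assumes M: "prob_space M" and [measurable]: "f \<in> borel_measurable M" "g \<in> borel_measurable M"
    and f: "(\<integral>x. f x \<partial>M) = 0" "sqn M f < \<infinity>" and g: "(\<integral>x. g x \<partial>M) = 0" "sqn M g < \<infinity>"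
  shows "sqn (M \<Otimes>\<^sub>M M) (\<lambda>p. c + f (fst p) + g (snd p)) = ennreal (c\<^sup>2) + sqn M f + sqn M g"
proof -
  interpret prob_space M by fact
  have "sqn (M \<Otimes>\<^sub>M M) (\<lambda>p. c + f (fst p) + g (snd p)) = (\<integral>\<^sup>+x. sqn M (\<lambda>y. (c + f x) + g y) \<partial>M)"
    unfolding sqn_def by (subst nn_integral_fst[symmetric]) auto
  also have "\<dots> = (\<integral>\<^sup>+x. ennreal ((c + f x)\<^sup>2) + sqn M g \<partial>M)"
    using g by (subst sqn_const_add_centred) auto
  also have "\<dots> = sqn M (\<lambda>x. c + f x) + sqn M g"
    by (subst nn_integral_add) (auto simp: emeasure_space_1 sqn_def)
  finally show ?thesis using f by (simp add: sqn_const_add_centred)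
qed

lemma sqn_fst_snd:
  assumes M: "prob_space M" and [measurable]: "f \<in> borel_measurable M"
  shows "sqn (M \<Otimes>\<^sub>M M) (\<lambda>p. f (fst p)) = sqn M f" "sqn (M \<Otimes>\<^sub>M M) (\<lambda>p. f (snd p)) = sqn M f"
proof -
  interpret prob_space M by fact
  show "sqn (M \<Otimes>\<^sub>M M) (\<lambda>p. f (fst p)) = sqn M f"
    unfolding sqn_def by (subst nn_integral_fst[symmetric]) (auto simp: emeasure_space_1)
  show "sqn (M \<Otimes>\<^sub>M M) (\<lambda>p. f (snd p)) = sqn M f"
    unfolding sqn_def by (subst nn_integral_fst[symmetric]) (auto simp: emeasure_space_1)
qed

text \<open>Weighting the squared increments with \<open>(100/81)^m\<close>, a ratio between \<open>1\<close> and \<open>3/2\<close>, bounds them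
  pointwise by a geometric series with ratio \<open>9/10\<close>.\<close>

lemma (in prob_space) geometric_L2_increments:
  fixes R :: "nat \<Rightarrow> 'a \<Rightarrow> real"
  assumes [measurable]: "\<And>m. R m \<in> borel_measurable M"
    and R0: "\<And>x. R 0 x = 0" and K: "0 \<le> K"
    and inc: "\<And>m. sqn M (\<lambda>x. R (Suc m) x - R m x) \<le> ennreal (K * (2/3) ^ m)"
  shows "AE x in M. convergent (\<lambda>m. R m x)"
    and "sqn M (\<lambda>x. lim (\<lambda>m. R m x)) \<le> ennreal (600 * K)"
    and "(\<And>m. (\<integral>x. R m x \<partial>M) = 0) \<Longrightarrow> (\<integral>x. lim (\<lambda>m. R m x) \<partial>M) = 0"
proof -
  define d where "d m x = R (Suc m) x - R m x" for m x
  have [measurable]: "d m \<in> borel_measurable M" for m unfolding d_def by measurable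
  define S where "S x = (\<Sum>m. ennreal ((100/81) ^ m * (d m x)\<^sup>2))" for x
  have [measurable]: "S \<in> borel_measurable M" unfolding S_def by measurable
  have "(\<integral>\<^sup>+x. S x \<partial>M) = (\<Sum>m. \<integral>\<^sup>+x. ennreal ((100/81) ^ m * (d m x)\<^sup>2) \<partial>M)"
    unfolding S_def by (subst nn_integral_suminf) auto
  also have "\<dots> = (\<Sum>m. ennreal ((100/81) ^ m) * sqn M (d m))"
    by (simp add: ennreal_mult nn_integral_cmult sqn_def)
  also have "\<dots> \<le> (\<Sum>m. ennreal ((100/81) ^ m) * ennreal (K * (2/3) ^ m))"
    by (intro suminf_le mult_left_mono) (auto simp: inc[folded d_def])
  also have "\<dots> = (\<Sum>m. ennreal (K * (200/243) ^ m))"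
  proof -
    have "(100/81) ^ m * (K * (2/3) ^ m) = K * (200/243) ^ m" for m
    proof -
      have "(200/243 :: real) ^ m = (100/81 * (2/3)) ^ m" by simp
      also have "\<dots> = (100/81) ^ m * (2/3) ^ m" by (rule power_mult_distrib)
      finally show ?thesis by simp
    qed
    then have "ennreal ((100/81) ^ m) * ennreal (K * (2/3) ^ m) = ennreal (K * (200/243) ^ m)" for m
      using K by (subst ennreal_mult[symmetric]) auto
    then show ?thesis by (simp only:)
  qed
  also have "\<dots> = ennreal (\<Sum>m. K * (200/243) ^ m)"
    using K by (intro suminf_ennreal2) (auto intro!: summable_mult summable_geometric)
  also have "(\<Sum>m. K * (200/243) ^ m) = K * (243/43)"
    by (subst suminf_mult) (auto simp: suminf_geometric)
  \<comment> \<open>Rounded up from \<open>243/43\<close>. Together with the square of 10, the sum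
    of the geometric series with ratio 9/10, it produces the factor 600.\<close>
  also have "ennreal (K * (243/43)) \<le> ennreal (6 * K)"
    using K by (intro ennreal_leI) auto
  finally have ES: "(\<integral>\<^sup>+x. S x \<partial>M) \<le> ennreal (6 * K)" .
  then have "(\<integral>\<^sup>+x. S x \<partial>M) \<noteq> \<infinity>" by (auto simp: top_unique)
  then have fin: "AE x in M. S x \<noteq> \<infinity>" by (intro nn_integral_PInf_AE) auto
  have d_le: "\<bar>d m x\<bar> \<le> (9/10) ^ m * sqrt (enn2real (S x))" if "S x \<noteq> \<infinity>" for m x
  proof -
    have "ennreal ((100/81) ^ m * (d m x)\<^sup>2) \<le> S x"
    proof -
      have "(\<Sum>k\<in>{m}. ennreal ((100/81) ^ k * (d k x)\<^sup>2)) \<le> S x"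
        unfolding S_def by (rule sum_le_suminf) auto
      then show ?thesis by (simp only: sum.insert sum.empty finite.emptyI empty_iff
          not_False_eq_True add_0_right)
    qed
    also have "S x = ennreal (enn2real (S x))" using that by (simp add: ennreal_enn2real_if)
    finally have "(100/81) ^ m * (d m x)\<^sup>2 \<le> enn2real (S x)"
      by (simp add: ennreal_le_iff)
    then have "(81/100) ^ m * ((100/81) ^ m * (d m x)\<^sup>2) \<le> (81/100) ^ m * enn2real (S x)"
      by (intro mult_left_mono) auto
    then have "(d m x)\<^sup>2 \<le> (81/100) ^ m * enn2real (S x)"
      by (simp add: power_divide)
    then have "sqrt ((d m x)\<^sup>2) \<le> sqrt ((81/100) ^ m * enn2real (S x))"
      by (rule real_sqrt_le_mono)
    also have "\<dots> = (9/10) ^ m * sqrt (enn2real (S x))"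
    proof -
      have "(81/100::real) ^ m = ((9/10) ^ m)\<^sup>2"
        by (subst power2_eq_square, subst power_mult_distrib[symmetric]) simp
      then show ?thesis by (simp add: real_sqrt_mult)
    qed
    finally show ?thesis by simp
  qed
  have R_eq: "R m x = (\<Sum>k<m. d k x)" for m x
    using sum_lessThan_telescope[of "\<lambda>k. R k x" m] R0 by (simp add: d_def)
  have geo: "summable (\<lambda>m. (9/10) ^ m * sqrt (enn2real (S x)))" for x
    by (intro summable_mult2 summable_geometric) auto
  have R_le: "\<bar>R m x\<bar> \<le> 10 * sqrt (enn2real (S x))" if "S x \<noteq> \<infinity>" for m x
  proof -
    have "\<bar>R m x\<bar> \<le> (\<Sum>k<m. \<bar>d k x\<bar>)" unfolding R_eq by (rule sum_abs)
    also have "\<dots> \<le> (\<Sum>k<m. (9/10) ^ k * sqrt (enn2real (S x)))"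
      by (intro sum_mono d_le that)
    also have "\<dots> \<le> (\<Sum>k. (9/10) ^ k * sqrt (enn2real (S x)))"
      by (intro sum_le_suminf geo) auto
    also have "\<dots> = 10 * sqrt (enn2real (S x))"
      by (subst suminf_mult2[symmetric]) (auto simp: suminf_geometric)
    finally show ?thesis .
  qed
  have conv: "convergent (\<lambda>m. R m x)" if "S x \<noteq> \<infinity>" for x
  proof -
    have "summable (\<lambda>k. d k x)"
      by (rule summable_comparison_test'[OF geo[of x], of 0]) (use d_le[OF that] in auto)
    then show ?thesis unfolding R_eq summable_iff_convergent .
  qed
  show "AE x in M. convergent (\<lambda>m. R m x)"
    using fin by eventually_elim (rule conv)
  have lim: "(\<lambda>m. R m x) \<longlonglongrightarrow> lim (\<lambda>m. R m x)" if "S x \<noteq> \<infinity>" for x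
    using conv[OF that] by (simp add: convergent_LIMSEQ_iff)
  have "sqn M (\<lambda>x. lim (\<lambda>m. R m x)) \<le> (\<integral>\<^sup>+x. ennreal 100 * S x \<partial>M)"
    unfolding sqn_def
  proof (rule nn_integral_mono_AE, use fin in eventually_elim)
    case (elim x)
    have "\<bar>lim (\<lambda>m. R m x)\<bar> \<le> 10 * sqrt (enn2real (S x))"
      by (rule LIMSEQ_le_const2[OF tendsto_rabs[OF lim[OF elim]]]) (use R_le[OF elim] in auto)
    then have "\<bar>lim (\<lambda>m. R m x)\<bar>\<^sup>2 \<le> (10 * sqrt (enn2real (S x)))\<^sup>2"
      by (intro power_mono) auto
    then have "(lim (\<lambda>m. R m x))\<^sup>2 \<le> 100 * enn2real (S x)"
      by (simp add: power_mult_distrib)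
    then have "ennreal ((lim (\<lambda>m. R m x))\<^sup>2) \<le> ennreal (100 * enn2real (S x))" by (rule ennreal_leI)
    also have "\<dots> = ennreal 100 * S x" using elim by (simp add: ennreal_mult ennreal_enn2real_if)
    finally show ?case .
  qed
  also have "\<dots> = ennreal 100 * (\<integral>\<^sup>+x. S x \<partial>M)" by (simp add: nn_integral_cmult)
  also have "\<dots> \<le> ennreal 100 * ennreal (6 * K)" by (intro mult_left_mono ES) auto
  also have "\<dots> = ennreal (600 * K)" using K by (subst ennreal_mult[symmetric]) auto
  finally show "sqn M (\<lambda>x. lim (\<lambda>m. R m x)) \<le> ennreal (600 * K)" .
  show "(\<integral>x. lim (\<lambda>m. R m x) \<partial>M) = 0" if "\<And>m. (\<integral>x. R m x \<partial>M) = 0"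
  proof -
    have "sqn M (\<lambda>x. 10 * sqrt (enn2real (S x))) < \<infinity>"
    proof -
      have "sqn M (\<lambda>x. 10 * sqrt (enn2real (S x))) = (\<integral>\<^sup>+x. ennreal 100 * S x \<partial>M)"
        unfolding sqn_def using fin
        by (intro nn_integral_cong_AE, eventually_elim) (simp add: power_mult_distrib ennreal_mult
            ennreal_enn2real_if)
      also have "\<dots> = ennreal 100 * (\<integral>\<^sup>+x. S x \<partial>M)" by (simp add: nn_integral_cmult)
      also have "\<dots> < \<infinity>" using \<open>(\<integral>\<^sup>+x. S x \<partial>M) \<noteq> \<infinity>\<close>
        by (simp add: ennreal_mult_less_top top.not_eq_extremum)
      finally show ?thesis .
    qed
    then have w: "integrable M (\<lambda>x. 10 * sqrt (enn2real (S x)))"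
      by (intro integrable_of_sqn) auto
    \<comment> \<open>The partial sums are dominated by \<open>10 * sqrt S\<close>, which is square
      integrable and hence integrable on a probability space.\<close>
    have "(\<lambda>m. \<integral>x. R m x \<partial>M) \<longlonglongrightarrow> (\<integral>x. lim (\<lambda>m. R m x) \<partial>M)"
    proof (rule integral_dominated_convergence[OF _ _ w])
      show "AE x in M. (\<lambda>m. R m x) \<longlonglongrightarrow> lim (\<lambda>m. R m x)"
        using fin by eventually_elim (rule lim)
      show "AE x in M. norm (R m x) \<le> 10 * sqrt (enn2real (S x))" for m
        using fin by eventually_elim (use R_le in auto)
    qed auto
    then show ?thesis using that by (simp add: LIMSEQ_const_iff)
  qed
qed

lemma borel_measurable_Unif [simp]: "borel_measurable Unif = borel_measurable borel"
  by (rule measurable_cong_sets) auto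

lemma nn_integral_Unif: "f \<in> borel_measurable borel \<Longrightarrow>
    (\<integral>\<^sup>+x. f x \<partial>Unif) = (\<integral>\<^sup>+x. f x * indicator {0..1} x \<partial>lborel)"
  by (subst nn_integral_uniform_measure) (auto simp: divide_ennreal_def)

text \<open>The extra excluded point is meant for the jump of the toll at \<open>x = t\<close>;
  where no such point matters, \<open>t = 0\<close> is inserted.\<close>

lemma AE_Unif: "AE x in Unif. 0 < x \<and> x < 1 \<and> x \<noteq> t"
proof (rule AE_uniform_measureI)
  have "AE x in lborel. x \<noteq> (0::real)" "AE x in lborel. x \<noteq> (1::real)" "AE x in lborel. x \<noteq> t"
    by (rule AE_lborel_singleton)+
  then show "AE x in lborel. x \<in> {0..1} \<longrightarrow> 0 < x \<and> x < 1 \<and> x \<noteq> t"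
    by eventually_elim auto
qed simp

section \<open>The contraction argument\<close>

lemma nn_integral_squares: "(\<integral>\<^sup>+x. ennreal (x\<^sup>2 + (1 - x)\<^sup>2) \<partial>Unif) = ennreal (2/3)"
proof -
  have "(\<integral>\<^sup>+x. ennreal (x\<^sup>2 + (1 - x)\<^sup>2) \<partial>Unif) =
      (\<integral>\<^sup>+x. ennreal (x\<^sup>2 + (1 - x)\<^sup>2) * indicator {0..1} x \<partial>lborel)"
    by (rule nn_integral_Unif) measurable
  also have "\<dots> = ennreal ((1 ^ 3 / 3 - (1 - 1) ^ 3 / 3) - (0 ^ 3 / 3 - (1 - 0) ^ 3 / 3 :: real))"
    by (rule nn_integral_FTC_Icc)
       (auto intro!: derivative_eq_intros simp: power2_eq_square)
  finally show ?thesis by simp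
qed

lemma limsup_two_terms_le:
  fixes p e1 e2 J :: "nat \<Rightarrow> ennreal"
  assumes p: "p \<longlonglongrightarrow> 0" and e: "limsup e1 \<le> c" "limsup e2 \<le> c" and c: "c < \<infinity>"
    and ab: "0 \<le> a" "0 \<le> b"
    and J: "eventually (\<lambda>k. J k \<le> p k + ennreal a * e1 k + ennreal b * e2 k) sequentially"
  shows "limsup J \<le> ennreal (a + b) * c"
proof (rule ennreal_le_epsilon)
  fix \<epsilon> :: real assume \<epsilon>: "0 < \<epsilon>"
  \<comment> \<open>Chosen so that the three errors \<open>\<delta>\<close>,
    \<open>a * \<delta>\<close> and \<open>b * \<delta>\<close> add up to
    \<open>\<epsilon>\<close>.\<close>
  define \<delta> where "\<delta> = \<epsilon> / (1 + a + b)"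
  have \<delta>: "0 < \<delta>" "\<delta> + (a + b) * \<delta> = \<epsilon>"
  proof -
    show "0 < \<delta>" using \<epsilon> ab by (simp add: \<delta>_def)
    have "\<delta> * (1 + a + b) = \<epsilon>" using ab by (simp add: \<delta>_def)
    then show "\<delta> + (a + b) * \<delta> = \<epsilon>" by (simp add: algebra_simps)
  qed
  obtain c' where c': "c = ennreal c'" "0 \<le> c'" using c by (cases c) auto
  have "c < ennreal (c' + \<delta>)" using c' \<delta> by (simp add: ennreal_less_iff)
  then have E: "eventually (\<lambda>k. e1 k < ennreal (c' + \<delta>)) sequentially"
      "eventually (\<lambda>k. e2 k < ennreal (c' + \<delta>)) sequentially"
    using e by (auto intro!: Limsup_lessD)
  have P: "eventually (\<lambda>k. p k < ennreal \<delta>) sequentially"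
    using p \<delta> by (intro order_tendstoD(2)) auto
  have "limsup J \<le> ennreal \<delta> + ennreal a * ennreal (c' + \<delta>) + ennreal b * ennreal (c' + \<delta>)"
  proof (rule Limsup_bounded)
    show "eventually (\<lambda>k. J k
        \<le> ennreal \<delta> + ennreal a * ennreal (c' + \<delta>) + ennreal b * ennreal (c' + \<delta>)) sequentially"
      using J E P
    proof eventually_elim
      case (elim k)
      then show ?case
        by (intro order_trans[OF elim(1)] add_mono mult_left_mono) auto
    qed
  qed
  also have "\<dots> = ennreal (\<delta> + a * (c' + \<delta>) + b * (c' + \<delta>))"
    using ab c' \<delta> by (simp add: ennreal_plus ennreal_mult)
  also have "\<delta> + a * (c' + \<delta>) + b * (c' + \<delta>) = (a + b) * c' + \<epsilon>"
    using \<delta>(2) by (simp add: algebra_simps)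
  also have "ennreal \<dots> = ennreal (a + b) * c + ennreal \<epsilon>"
    using ab c' \<epsilon> by (simp add: ennreal_plus ennreal_mult)
  finally show "limsup J \<le> ennreal (a + b) * c + ennreal \<epsilon>" .
qed

text \<open>\<open>P\<close> is a family of error sequences that is closed under the root split up
  to null sequences. The sequences \<open>e1\<close>, \<open>e2\<close>, \<open>p\<close> may depend
  on the root value \<open>x\<close>, which is why the supremum of limsups over the whole family is
  compared with itself instead of a single limsup. The bound \<open>B'\<close> dominates the
  integrands for the reverse Fatou lemma, and \<open>B\<close> makes the supremum finite.\<close>

lemma contraction:
  fixes P :: "(nat \<Rightarrow> ennreal) set"
  assumes bound: "\<And>e k. e \<in> P \<Longrightarrow> e k \<le> ennreal B"
    and step: "\<And>e. e \<in> P \<Longrightarrow> \<exists>J. (\<forall>k. J k \<in> borel_measurable Unif) \<and> (\<forall>k. AE x in Unif. J k x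
        \<le> ennreal B')
      \<and> (\<forall>k. e k = (\<integral>\<^sup>+x. J k x \<partial>Unif))
      \<and> (AE x in Unif. \<exists>e1\<in>P. \<exists>e2\<in>P. \<exists>p. p \<longlonglongrightarrow> 0 \<and>
          eventually (\<lambda>k. J k x \<le> p k + ennreal (5/4 * x\<^sup>2) * e1 k + ennreal (5/4 * (1 - x)\<^sup>2) * e2
              k) sequentially)"
    and e: "e \<in> P"
  shows "e \<longlonglongrightarrow> 0"
proof -
  define c where "c = (SUP e\<in>P. limsup e)"
  have "c \<le> ennreal B"
    unfolding c_def by (intro SUP_least Limsup_bounded) (auto simp: bound)
  then have c: "c < \<infinity>" by (simp add: le_less_trans[OF _ ennreal_less_top])
  have le_c: "limsup e \<le> c" if "e \<in> P" for e
    unfolding c_def using that by (rule SUP_upper)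
  have "limsup e \<le> ennreal (5/6) * c" if e: "e \<in> P" for e
  proof -
    from step[OF e] obtain J where J: "\<And>k. J k \<in> borel_measurable Unif"
        "\<And>k. AE x in Unif. J k x \<le> ennreal B'"
      "\<And>k. e k = (\<integral>\<^sup>+x. J k x \<partial>Unif)"
      "AE x in Unif. \<exists>e1\<in>P. \<exists>e2\<in>P. \<exists>p. p \<longlonglongrightarrow> 0 \<and>
          eventually (\<lambda>k. J k x \<le> p k + ennreal (5/4 * x\<^sup>2) * e1 k + ennreal (5/4 * (1 - x)\<^sup>2) * e2
              k) sequentially"
      by blast
    have "limsup e = limsup (\<lambda>k. \<integral>\<^sup>+x. J k x \<partial>Unif)" by (simp only: J(3)[symmetric])
    also have "\<dots> \<le> (\<integral>\<^sup>+x. limsup (\<lambda>k. J k x) \<partial>Unif)"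
      by (rule nn_integral_limsup[where w = "\<lambda>_. ennreal B'"]) (use J in auto)
    also have "\<dots> \<le> (\<integral>\<^sup>+x. ennreal (5/4) * c * ennreal (x\<^sup>2 + (1 - x)\<^sup>2) \<partial>Unif)"
    proof (rule nn_integral_mono_AE, use J(4) in eventually_elim)
      case (elim x)
      then obtain e1 e2 p where "e1 \<in> P" "e2 \<in> P" "p \<longlonglongrightarrow> 0"
        "eventually (\<lambda>k. J k x
            \<le> p k + ennreal (5/4 * x\<^sup>2) * e1 k + ennreal (5/4 * (1 - x)\<^sup>2) * e2 k) sequentially"
        by blast
      then have "limsup (\<lambda>k. J k x) \<le> ennreal (5/4 * x\<^sup>2 + 5/4 * (1 - x)\<^sup>2) * c"
        using c by (intro limsup_two_terms_le[OF _ le_c le_c]) auto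
      also have "5/4 * x\<^sup>2 + 5/4 * (1 - x)\<^sup>2 = 5/4 * (x\<^sup>2 + (1 - x)\<^sup>2)" by simp
      also have "ennreal \<dots> = ennreal (5/4) * ennreal (x\<^sup>2 + (1 - x)\<^sup>2)" by (intro ennreal_mult) auto
      finally show ?case by (simp add: ac_simps)
    qed
    also have "\<dots> = ennreal (5/4) * c * (\<integral>\<^sup>+x. ennreal (x\<^sup>2 + (1 - x)\<^sup>2) \<partial>Unif)"
      by (rule nn_integral_cmult) (unfold borel_measurable_Unif, measurable)
    also have "\<dots> = ennreal (5/4) * ennreal (2/3) * c"
      unfolding nn_integral_squares by (simp add: ac_simps)
    also have "ennreal (5/4) * ennreal (2/3) = ennreal (5/6)"
      by (subst ennreal_mult[symmetric]) auto
    finally show ?thesis .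
  qed
  then have "c \<le> ennreal (5/6) * c"
    unfolding c_def by (intro SUP_least)
  then have "c = 0"
    using c by (cases c) (auto simp: ennreal_mult[symmetric] simp flip: ennreal_0)
  then have "limsup e \<le> 0" using le_c[OF e] by simp
  then show ?thesis
    by (intro tendsto_0_if_Limsup_eq_0_ennreal) simp
qed

section \<open>Integrals over the root and a pair of independent trees\<close>

lemma (in prob_space) distr_pair_snd:
  assumes "sigma_finite_measure N"
  shows "distr (M \<Otimes>\<^sub>M N) N snd = N"
proof (rule measure_eqI)
  interpret N: sigma_finite_measure N by fact
  fix A assume A: "A \<in> sets (distr (M \<Otimes>\<^sub>M N) N snd)"
  then have "emeasure (distr (M \<Otimes>\<^sub>M N) N snd) A = emeasure (M \<Otimes>\<^sub>M N) (space M \<times> A)"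
    by (auto simp: emeasure_distr space_pair_measure dest: sets.sets_into_space intro!:
        arg_cong2[where f=emeasure])
  with A show "emeasure (distr (M \<Otimes>\<^sub>M N) N snd) A = emeasure N A"
    by (simp add: N.emeasure_pair_measure_Times emeasure_space_1)
qed simp

lemma distr_Tree: "distr (Tree \<Otimes>\<^sub>M Tree) Tree fst = Tree" "distr (Tree \<Otimes>\<^sub>M Tree) Tree snd = Tree"
proof -
  interpret Tree: prob_space Tree by simp
  show "distr (Tree \<Otimes>\<^sub>M Tree) Tree fst = Tree" by (rule Tree.distr_pair_fst)
  show "distr (Tree \<Otimes>\<^sub>M Tree) Tree snd = Tree" by (rule Tree.distr_pair_snd) unfold_locales
qed

lemma prob_space_Tree_pair [simp]: "prob_space (Tree \<Otimes>\<^sub>M Tree)"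
proof -
  interpret Tree: prob_space Tree by simp
  interpret pair_prob_space Tree Tree ..
  show ?thesis by unfold_locales
qed

lemma AE_Tree_pair:
  assumes "AE u in Tree. P u"
  shows "AE ab in Tree \<Otimes>\<^sub>M Tree. P (fst ab)" "AE ab in Tree \<Otimes>\<^sub>M Tree. P (snd ab)"
proof -
  show "AE ab in Tree \<Otimes>\<^sub>M Tree. P (fst ab)"
  proof (rule AE_distrD[OF measurable_fst])
    show "AE u in distr (Tree \<Otimes>\<^sub>M Tree) Tree fst. P u" unfolding distr_Tree by fact
  qed
  show "AE ab in Tree \<Otimes>\<^sub>M Tree. P (snd ab)"
  proof (rule AE_distrD[OF measurable_snd])
    show "AE u in distr (Tree \<Otimes>\<^sub>M Tree) Tree snd. P u" unfolding distr_Tree by fact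
  qed
qed

lemma integral_Tree_pair:
  fixes f g :: "(nat list \<Rightarrow> real) \<Rightarrow> real"
  assumes "integrable Tree f" "integrable Tree g"
  shows "(\<integral>ab. c + f (fst ab) + g (snd ab) \<partial>(Tree \<Otimes>\<^sub>M Tree))
      = c + (\<integral>u. f u \<partial>Tree) + (\<integral>u. g u \<partial>Tree)"
proof -
  interpret TT: prob_space "Tree \<Otimes>\<^sub>M Tree" by simp
  have f: "integrable (Tree \<Otimes>\<^sub>M Tree) (\<lambda>ab. f (fst ab))"
      "(\<integral>ab. f (fst ab) \<partial>(Tree \<Otimes>\<^sub>M Tree)) = (\<integral>u. f u \<partial>Tree)"
    using assms(1) integrable_distr[of fst "Tree \<Otimes>\<^sub>M Tree" Tree f] integral_distr[of fst "Tree \<Otimes>\<^sub>M Tree" Tree f]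
    by (simp_all add: distr_Tree)
  have g: "integrable (Tree \<Otimes>\<^sub>M Tree) (\<lambda>ab. g (snd ab))"
      "(\<integral>ab. g (snd ab) \<partial>(Tree \<Otimes>\<^sub>M Tree)) = (\<integral>u. g u \<partial>Tree)"
    using assms(2) integrable_distr[of snd "Tree \<Otimes>\<^sub>M Tree" Tree g] integral_distr[of snd "Tree \<Otimes>\<^sub>M Tree" Tree g]
    by (simp_all add: distr_Tree)
  show ?thesis using f g by (simp add: TT.prob_space)
qed

lemma integral_graft:
  fixes f :: "(nat list \<Rightarrow> real) \<Rightarrow> real"
  assumes f: "integrable Tree f"
  shows "(\<integral>u. f u \<partial>Tree) = (\<integral>x. (\<integral>ab. f (graft x ab) \<partial>(Tree \<Otimes>\<^sub>M Tree)) \<partial>Unif)"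
    "(\<lambda>x. \<integral>ab. f (graft x ab) \<partial>(Tree \<Otimes>\<^sub>M Tree)) \<in> borel_measurable borel"
proof -
  interpret Unif: prob_space Unif by simp
  interpret TT: prob_space "Tree \<Otimes>\<^sub>M Tree" by simp
  interpret UTT: pair_prob_space Unif "Tree \<Otimes>\<^sub>M Tree" ..
  have int: "integrable (Unif \<Otimes>\<^sub>M (Tree \<Otimes>\<^sub>M Tree)) (\<lambda>p. f (graft (fst p) (snd p)))"
    using f by (subst (asm) distr_graft[symmetric]) (erule integrable_distr[OF graft_measurable])
  have "(\<integral>u. f u \<partial>Tree) = (\<integral>p. f (graft (fst p) (snd p)) \<partial>(Unif \<Otimes>\<^sub>M (Tree \<Otimes>\<^sub>M Tree)))"
    using f by (subst distr_graft[symmetric], intro integral_distr graft_measurable) simp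
  also have "\<dots> = (\<integral>x. (\<integral>ab. f (graft x ab) \<partial>(Tree \<Otimes>\<^sub>M Tree)) \<partial>Unif)"
    using UTT.integral_fst'[OF int] by simp
  finally show "(\<integral>u. f u \<partial>Tree) = (\<integral>x. (\<integral>ab. f (graft x ab) \<partial>(Tree \<Otimes>\<^sub>M Tree)) \<partial>Unif)" .
  have "(\<lambda>x. \<integral>ab. f (graft x ab) \<partial>(Tree \<Otimes>\<^sub>M Tree)) \<in> borel_measurable Unif"
    using TT.borel_measurable_lebesgue_integral[of "\<lambda>x ab. f (graft x ab)" Unif]
      borel_measurable_integrable[OF int] by (simp add: case_prod_unfold)
  then show "(\<lambda>x. \<integral>ab. f (graft x ab) \<partial>(Tree \<Otimes>\<^sub>M Tree)) \<in> borel_measurable borel" by simp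
qed

lemma sqn_graft:
  assumes [measurable]: "f \<in> borel_measurable Tree"
  shows "sqn Tree f = (\<integral>\<^sup>+x. sqn (Tree \<Otimes>\<^sub>M Tree) (\<lambda>ab. f (graft x ab)) \<partial>Unif)"
    "(\<lambda>x. sqn (Tree \<Otimes>\<^sub>M Tree) (\<lambda>ab. f (graft x ab))) \<in> borel_measurable Unif"
proof -
  have "(\<lambda>u. ennreal ((f u)\<^sup>2)) \<in> borel_measurable Tree" by measurable
  from nn_integral_graft[OF this]
  show "sqn Tree f = (\<integral>\<^sup>+x. sqn (Tree \<Otimes>\<^sub>M Tree) (\<lambda>ab. f (graft x ab)) \<partial>Unif)"
    "(\<lambda>x. sqn (Tree \<Otimes>\<^sub>M Tree) (\<lambda>ab. f (graft x ab))) \<in> borel_measurable Unif"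
    unfolding sqn_def by auto
qed

text \<open>Turns a bound given the root value into an unconditional one. Since \<open>B\<close>
  will be a multiple of the bound assumed in the subtrees, an inductive bound \<open>K\<close> only
  has to satisfy \<open>A + B * (2/3) \<le> K\<close>.\<close>

lemma sqn_Tree_le:
  assumes f: "f \<in> borel_measurable Tree" and AB: "0 \<le> A" "0 \<le> B"
    and le: "\<And>x. 0 < x \<Longrightarrow> x < 1 \<Longrightarrow> x \<noteq> t \<Longrightarrow>
      sqn (Tree \<Otimes>\<^sub>M Tree) (\<lambda>ab. f (graft x ab)) \<le> ennreal (A + B * (x\<^sup>2 + (1 - x)\<^sup>2))"
  shows "sqn Tree f \<le> ennreal (A + B * (2/3))"
proof -
  interpret Unif: prob_space Unif by simp
  have "sqn Tree f \<le> (\<integral>\<^sup>+x. ennreal A + ennreal B * ennreal (x\<^sup>2 + (1 - x)\<^sup>2) \<partial>Unif)"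
    unfolding sqn_graft(1)[OF f]
  proof (rule nn_integral_mono_AE, use AE_Unif[of t] in eventually_elim)
    case (elim x)
    then show ?case
      using le[of x] AB by (simp add: ennreal_plus ennreal_mult)
  qed
  also have "\<dots> = ennreal A + ennreal B * (\<integral>\<^sup>+x. ennreal (x\<^sup>2 + (1 - x)\<^sup>2) \<partial>Unif)"
    by (subst nn_integral_add) (auto simp: nn_integral_cmult)
  also have "\<dots> = ennreal (A + B * (2/3))"
    unfolding nn_integral_squares using AB
    by (subst ennreal_mult[symmetric], simp, simp) (subst ennreal_plus[symmetric], auto)
  finally show ?thesis .
qed

section \<open>The discrete process in terms of the root split\<close>

text \<open>The sizes of the subtrees depend on the random root, so the recursion is not a
  composition of fixed measurable maps. It is measurable for each of the countably many values of
  the split index, and the pieces are glued along that index.\<close>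

lemma yd_measurable: "l \<le> n \<Longrightarrow> yd n l \<in> borel_measurable Tree"
proof (induction n arbitrary: l rule: less_induct)
  case (less n)
  show ?case
  proof (cases "n < 2")
    case True
    then have "yd n l = (\<lambda>u. 0)" by (simp add: yd_less2 fun_eq_iff)
    then show ?thesis by simp
  next
    case False
    define G where "G i u = (if i < 1 \<or> n < i then 0 else
      Cd n l i + (real (i - 1) / real n) * yd (i - 1) (if l < i then l else i - 1) (subtree 1 u)
      + (if l < i then 0 else (real (n - i) / real n) * yd (n - i) (l - i) (subtree 2 u)))" for i u
    have "G i \<in> borel_measurable Tree" for i
    proof (cases "i < 1 \<or> n < i")
      case True then show ?thesis by (simp add: G_def[abs_def])
    next
      case i: False
      have "yd (i - 1) (if l < i then l else i - 1) \<in> borel_measurable Tree"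
        using i by (intro less.IH) auto
      from measurable_compose[OF subtree_measurable(1) this]
      have [measurable]: "(\<lambda>u. yd (i - 1) (if l < i then l else i - 1) (subtree 1 u))
          \<in> borel_measurable Tree" .
      have "yd (n - i) (l - i) \<in> borel_measurable Tree"
        using i less.prems by (intro less.IH) auto
      from measurable_compose[OF subtree_measurable(3) this]
      have [measurable]: "(\<lambda>u. yd (n - i) (l - i) (subtree 2 u)) \<in> borel_measurable Tree" .
      have "G i = (\<lambda>u. Cd n l i + (real (i - 1) / real n) * yd (i - 1) (if l < i then l else i
          - 1) (subtree 1 u)
          + (if l < i then 0 else real (n - i) / real n) * yd (n - i) (l - i) (subtree 2 u))"
        using i by (auto simp: G_def fun_eq_iff)
      also have "\<dots> \<in> borel_measurable Tree" by measurable
      finally show ?thesis .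
    qed
    then have "(\<lambda>u. G (nat \<lceil>real n * u []\<rceil>) u) \<in> borel_measurable Tree"
      by (rule measurable_compose_countable) (use root_measurable in measurable)
    moreover have "G (nat \<lceil>real n * u []\<rceil>) u = yd n l u" for u
    proof -
      define i where "i = nat \<lceil>real n * u []\<rceil>"
      show ?thesis unfolding i_def[symmetric] G_def
        using False less.prems yd_out[of i n u l, OF i_def] yd_rec[of n l i u, OF _ _ i_def]
            by (simp add: not_less)
    qed
    ultimately show ?thesis by simp
  qed
qed

text \<open>Counting \<open>i - 1\<close> elements on the left and \<open>n - i\<close> on the right
  makes the discrete weights at most \<open>x\<close> and \<open>1 - x\<close>, so the discrete
  moments can be bounded with the weights of the limit. The last three bounds control the
  rounding.\<close>

lemma split_index:
  assumes "0 < x" "x < 1" "1 \<le> n" and i: "i = nat \<lceil>real n * x\<rceil>"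
  shows "1 \<le> i" "i \<le> n" "real (i - 1) / real n \<le> x" "real (n - i) / real n \<le> 1 - x"
    "\<bar>real (i - 1) / real n - x\<bar> \<le> 1 / real n" "\<bar>real (n - i) / real n - (1 - x)\<bar> \<le> 1 / real n"
    "\<bar>real i / real n - x\<bar> \<le> 1 / real n"
proof -
  have nx: "0 < real n * x" "real n * x < real n" using assms by auto
  have ii: "real i = of_int \<lceil>real n * x\<rceil>" using nx i by simp
  have c: "real n * x \<le> real i" "real i < real n * x + 1" unfolding ii by linarith+
  show 1: "1 \<le> i" using c nx by (cases i) auto
  have "real i < real n + 1" using c nx by linarith
  then show 2: "i \<le> n" by linarith
  have e: "real (i - 1) = real i - 1" "real (i - Suc 0) = real i - 1"
      "real (n - i) = real n - real i"
    using 1 2 by auto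
  show "real (i - 1) / real n \<le> x" "real (n - i) / real n \<le> 1 - x"
    using c assms(3) by (auto simp: e field_simps)
  have "\<bar>(real i - 1) - real n * x\<bar> \<le> 1" "\<bar>(real n - real i) - (real n - real n * x)\<bar> \<le> 1"
      "\<bar>real i - real n * x\<bar> \<le> 1"
    using c by auto
  moreover have "\<bar>a / real n - y\<bar> \<le> 1 / real n" if "\<bar>a - real n * y\<bar> \<le> 1" for a y
  proof -
    have "a / real n - y = (a - real n * y) / real n" using assms(3) by (simp add: field_simps)
    then show ?thesis using that assms(3) by (simp add: abs_divide divide_right_mono)
  qed
  ultimately show "\<bar>real (i - 1) / real n - x\<bar> \<le> 1 / real n"
      "\<bar>real (n - i) / real n - (1 - x)\<bar> \<le> 1 / real n"
    "\<bar>real i / real n - x\<bar> \<le> 1 / real n"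
    unfolding e by (auto simp: right_diff_distrib)
qed

lemma yd_graft:
  assumes "2 \<le> n" "l \<le> n" "0 < x" "x < 1" "ab \<in> space (Tree \<Otimes>\<^sub>M Tree)" "i = nat \<lceil>real n * x\<rceil>"
  shows "yd n l (graft x ab)
      = Cd n l i + (real (i - 1) / real n) * yd (i - 1) (if l < i then l else i - 1) (fst ab)
      + (if l < i then 0 else (real (n - i) / real n) * yd (n - i) (l - i) (snd ab))"
  using yd_rec[of n l i "graft x ab"] split_index(1,2)[OF assms(3,4) _ assms(6)] assms
  by (simp add: subtree_graft)

lemma acoef_diag: "acoef k k = 2 * (real k + 1) * Harm k - 4 * real k"
  by (simp add: acoef_def Harm_def[of "Suc 0"] Harm_def[of 0] algebra_simps)

text \<open>The recursion of the expected number of comparisons; it is what makes the discrete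
  tolls centred.\<close>

lemma sum_acoef_diag: "2 * (\<Sum>k<n. acoef k k) = real n * acoef n n - real n * (real n - 1)"
proof (induction n)
  case (Suc n)
  have "(real n + 1) * Harm (Suc n) = (real n + 1) * Harm n + 1"
    by (simp add: Harm_Suc distrib_left)
  moreover have "(real n + 1) * acoef (Suc n) (Suc n) =
      2 * (real n + 2) * ((real n + 1) * Harm (Suc n)) - 4 * (real n + 1)\<^sup>2"
    unfolding acoef_diag by (simp add: algebra_simps power2_eq_square)
  ultimately have *: "(real n + 1) * acoef (Suc n) (Suc n) =
      2 * (real n + 2) * ((real n + 1) * Harm n + 1) - 4 * (real n + 1)\<^sup>2"
    by simp
  show ?case unfolding sum.lessThan_Suc distrib_left Suc of_nat_Suc
    using * by (simp add: acoef_diag algebra_simps power2_eq_square)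
qed (simp add: acoef_def)

lemma sum_Cd_diag: "(\<Sum>i=1..n. Cd n n i) = 0"
proof (cases "n = 0")
  case False
  have "(\<Sum>i=1..n. acoef (i - 1) (i - 1)) = (\<Sum>k<n. acoef k k)"
    by (rule sum.reindex_bij_witness[of _ Suc "\<lambda>i. i - 1"]) auto
  moreover have "(\<Sum>i=1..n. acoef (n - i) (n - i)) = (\<Sum>k<n. acoef k k)"
    by (rule sum.reindex_bij_witness[of _ "\<lambda>k. n - k" "\<lambda>i. n - i"]) auto
  moreover have "Cd n n i = 1 / real n * (real n - 1 - acoef n n + acoef (i - 1) (i - 1) + acoef (n
      - i) (n - i))"
    \<comment> \<open>At \<open>i = n\<close> the last indicator of the toll is off, in agreement
      with \<open>acoef 0 0 = 0\<close>.\<close>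
    if "i \<in> {1..n}" for i
    using False that by (cases "i = n") (auto simp: Cd_def acoef_def)
  ultimately have "(\<Sum>i=1..n. Cd n n i)
      = 1 / real n * (real n * (real n - 1 - acoef n n) + 2 * (\<Sum>k<n. acoef k k))"
    by (simp add: sum.distrib sum_distrib_left[symmetric] sum_divide_distrib[symmetric])
  then show ?thesis unfolding sum_acoef_diag by (simp add: algebra_simps)
qed simp

text \<open>The ceiling equals \<open>i\<close> exactly on the half-open interval \<open>A i\<close>
  of length \<open>1/n\<close>, so the split index is uniform on \<open>{1..n}\<close>.\<close>

lemma integral_split_index:
  fixes g :: "nat \<Rightarrow> real"
  assumes n: "1 \<le> n"
  shows "(\<integral>x. g (nat \<lceil>real n * x\<rceil>) \<partial>Unif) = (\<Sum>i=1..n. g i) / real n"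
proof -
  interpret Unif: prob_space Unif by simp
  define A where "A i = {(real i - 1) / real n <.. real i / real n}" for i :: nat
  have meas: "measure Unif (A i) = 1 / real n" if "i \<in> {1..n}" for i
  proof -
    have "{0..1} \<inter> A i = A i"
    proof -
      have "0 \<le> (real i - 1) / real n" "real i / real n \<le> 1" using that n
          by (auto simp: divide_le_eq_1)
      then show ?thesis by (auto simp: A_def intro: order_trans less_imp_le)
    qed
    moreover have "measure lborel (A i) = 1 / real n"
      using n by (simp add: A_def divide_right_mono diff_divide_distrib[symmetric])
    ultimately show ?thesis by (subst measure_uniform_measure) (auto simp: A_def)
  qed
  have "(\<integral>x. g (nat \<lceil>real n * x\<rceil>) \<partial>Unif) = (\<integral>x. (\<Sum>i=1..n. g i * indicator (A i) x) \<partial>Unif)"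
  proof (rule integral_cong_AE)
    show "AE x in Unif. g (nat \<lceil>real n * x\<rceil>) = (\<Sum>i=1..n. g i * indicator (A i) x)"
      using AE_Unif[of 0]
    proof eventually_elim
      case (elim x)
      define i where "i = nat \<lceil>real n * x\<rceil>"
      have i: "1 \<le> i" "i \<le> n" using split_index(1,2)[of x n i] elim n by (auto simp: i_def)
      have iff: "x \<in> A j \<longleftrightarrow> j = i" if "j \<in> {1..n}" for j
      proof -
        have "x \<in> A j \<longleftrightarrow> real_of_int (int j) - 1 < real n * x \<and> real n * x \<le> real_of_int (int j)"
          using n by (simp add: A_def field_simps)
        also have "\<dots> \<longleftrightarrow> \<lceil>real n * x\<rceil> = int j" by linarith
        also have "\<dots> \<longleftrightarrow> j = i" unfolding i_def using that by auto
        finally show ?thesis .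
      qed
      have "(\<Sum>j=1..n. g j * indicator (A j) x) = (\<Sum>j=1..n. if j = i then g j else 0)"
        by (intro sum.cong) (auto simp: iff indicator_def)
      also have "\<dots> = g i" using i by simp
      finally show ?case by (simp add: i_def)
    qed
    show "(\<lambda>x. g (nat \<lceil>real n * x\<rceil>)) \<in> borel_measurable Unif"
      unfolding borel_measurable_Unif by measurable
    show "(\<lambda>x. \<Sum>i=1..n. g i * indicator (A i) x) \<in> borel_measurable Unif"
      unfolding borel_measurable_Unif A_def by measurable
  qed
  also have "\<dots> = (\<Sum>i=1..n. g i * measure Unif (A i))"
    by (subst Bochner_Integration.integral_sum) (auto simp: A_def intro!: integrable_mult_right
        Unif.integrable_const_bound[where B=1])
  also have "\<dots> = (\<Sum>i=1..n. g i) / real n"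
    by (simp add: meas sum_divide_distrib)
  finally show ?thesis .
qed

section \<open>Moments of the discrete and limiting Quicksort costs\<close>

text \<open>Because both branches are centred, no factor is lost in separating them from the toll,
  and the weights enter with coefficient exactly \<open>K\<close>.\<close>

lemma sqn_two_branches_le:
  fixes f g :: "(nat list \<Rightarrow> real) \<Rightarrow> real"
  assumes [measurable]: "f \<in> borel_measurable Tree" "g \<in> borel_measurable Tree"
    and f: "(\<integral>u. f u \<partial>Tree) = 0" "sqn Tree f \<le> ennreal K"
        and g: "(\<integral>u. g u \<partial>Tree) = 0" "sqn Tree g \<le> ennreal K"
    and c: "\<bar>c\<bar> \<le> C" and ab: "\<bar>a\<bar> \<le> x" "\<bar>b\<bar> \<le> 1 - x" and K: "0 \<le> K"
  shows "sqn (Tree \<Otimes>\<^sub>M Tree) (\<lambda>ab. c + a * f (fst ab) + b * g (snd ab))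
      \<le> ennreal (C\<^sup>2 + K * (x\<^sup>2 + (1 - x)\<^sup>2))"
proof -
  have fin: "sqn Tree f < \<infinity>" "sqn Tree g < \<infinity>"
    using f(2) g(2) by (auto simp: le_less_trans[OF _ ennreal_less_top])
  have sq: "sqn Tree (\<lambda>u. a * f u) \<le> ennreal (x\<^sup>2 * K)"
      "sqn Tree (\<lambda>u. b * g u) \<le> ennreal ((1 - x)\<^sup>2 * K)"
  proof -
    have "a\<^sup>2 \<le> x\<^sup>2" "b\<^sup>2 \<le> (1 - x)\<^sup>2" using ab by (auto simp: abs_le_square_iff[symmetric])
    then show "sqn Tree (\<lambda>u. a * f u) \<le> ennreal (x\<^sup>2 * K)"
        "sqn Tree (\<lambda>u. b * g u) \<le> ennreal ((1 - x)\<^sup>2 * K)"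
      using f(2) g(2) K by (auto simp: sqn_cmult ennreal_mult intro!: mult_mono ennreal_leI)
  qed
  have lt: "sqn Tree (\<lambda>u. a * f u) < \<infinity>" "sqn Tree (\<lambda>u. b * g u) < \<infinity>"
    using le_less_trans[OF sq(1) ennreal_less_top] le_less_trans[OF sq(2) ennreal_less_top] by auto
  have "sqn (Tree \<Otimes>\<^sub>M Tree) (\<lambda>ab. c + a * f (fst ab) + b * g (snd ab)) =
      ennreal (c\<^sup>2) + sqn Tree (\<lambda>u. a * f u) + sqn Tree (\<lambda>u. b * g u)"
    by (rule sqn_const_add_two_centred[OF prob_space_Tree]) (use f(1) g(1) lt in auto)
  also have "\<dots> \<le> ennreal (C\<^sup>2) + ennreal (x\<^sup>2 * K) + ennreal ((1 - x)\<^sup>2 * K)"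
  proof -
    have "c\<^sup>2 \<le> C\<^sup>2" using c by (simp add: abs_le_square_iff[symmetric])
    then show ?thesis by (intro add_mono sq ennreal_leI)
  qed
  also have "\<dots> = ennreal (C\<^sup>2 + K * (x\<^sup>2 + (1 - x)\<^sup>2))"
    using K by (simp add: ennreal_plus[symmetric] algebra_simps del: ennreal_plus)
  finally show ?thesis .
qed

lemma sqn_le_integrable:
  assumes "f \<in> borel_measurable Tree" "sqn Tree f \<le> ennreal K"
  shows "integrable Tree f"
proof -
  interpret prob_space Tree by simp
  show ?thesis
    using assms(1) le_less_trans[OF assms(2) ennreal_less_top] by (intro integrable_of_sqn) auto
qed

text \<open>The bound \<open>4800\<close> is the fixed point of \<open>K = 40\<^sup>2 + 2/3 * K\<close>.\<close>

lemma quicksort_moments: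
  "(\<integral>u. yd n n u \<partial>Tree) = 0 \<and> sqn Tree (yd n n) \<le> ennreal 4800"
proof (induction n rule: less_induct)
  case (less n)
  show ?case
  proof (cases "n < 2")
    case True
    then have "yd n n = (\<lambda>u. 0)" by (simp add: yd_less2 fun_eq_iff)
    then show ?thesis by simp
  next
    case False
    have gr: "yd n n (graft x ab) = Cd n n i + (real (i - 1) / real n) * yd (i - 1) (i - 1) (fst ab)
      + (real (n - i) / real n) * yd (n - i) (n - i) (snd ab)"
      if x: "0 < x" "x < 1" "ab \<in> space (Tree \<Otimes>\<^sub>M Tree)" "i = nat \<lceil>real n * x\<rceil>" for x ab i
    proof -
      have "\<not> n < i" using split_index(2)[OF x(1,2) _ x(4)] False by simp
      then show ?thesis using yd_graft[OF _ _ x, where l = n] False by simp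
    qed
    \<comment> \<open>The second moment comes before the mean, since it supplies the integrability
      that Fubini's theorem needs for the mean.\<close>
    have le: "sqn Tree (yd n n) \<le> ennreal (40\<^sup>2 + 4800 * (2/3))"
    proof (rule sqn_Tree_le[where t = 0])
      fix x :: real assume x: "0 < x" "x < 1"
      define i where "i = nat \<lceil>real n * x\<rceil>"
      note i = split_index[OF x _ i_def]
      have n: "1 \<le> n" using False by simp
      have "sqn (Tree \<Otimes>\<^sub>M Tree) (\<lambda>ab. yd n n (graft x ab)) = sqn (Tree \<Otimes>\<^sub>M Tree) (\<lambda>ab. Cd n n i +
          (real (i - 1) / real n) * yd (i - 1) (i - 1) (fst ab) + (real (n - i) / real n) * yd (n -
              i) (n - i) (snd ab))"
        by (intro sqn_cong gr x i_def)
      also have "\<dots> \<le> ennreal (40\<^sup>2 + 4800 * (x\<^sup>2 + (1 - x)\<^sup>2))"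
        using i n less.IH[of "i - 1"] less.IH[of "n - i"]
        by (intro sqn_two_branches_le yd_measurable abs_Cd_le) auto
      finally show "sqn (Tree \<Otimes>\<^sub>M Tree) (\<lambda>ab. yd n n (graft x ab))
          \<le> ennreal (40\<^sup>2 + 4800 * (x\<^sup>2 + (1 - x)\<^sup>2))" .
    qed (auto intro: yd_measurable)
    have int: "integrable Tree (yd n n)"
      by (rule sqn_le_integrable[OF _ le]) (auto intro: yd_measurable)
    have "(\<integral>u. yd n n u \<partial>Tree) = (\<integral>x. (\<integral>ab. yd n n (graft x ab) \<partial>(Tree \<Otimes>\<^sub>M Tree)) \<partial>Unif)"
      by (rule integral_graft(1)[OF int])
    also have "\<dots> = (\<integral>x. Cd n n (nat \<lceil>real n * x\<rceil>) \<partial>Unif)"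
    proof (rule integral_cong_AE)
      show "AE x in Unif. (\<integral>ab. yd n n (graft x ab) \<partial>(Tree \<Otimes>\<^sub>M Tree)) = Cd n n (nat \<lceil>real n * x\<rceil>)"
        using AE_Unif[of 0]
      proof eventually_elim
        case (elim x)
        define i where "i = nat \<lceil>real n * x\<rceil>"
        have "1 \<le> i" "i \<le> n"
          using split_index(1,2)[OF _ _ _ i_def] elim False by auto
        then have i: "i - 1 < n" "n - i < n" by auto
        have "(\<integral>ab. yd n n (graft x ab) \<partial>(Tree \<Otimes>\<^sub>M Tree)) = (\<integral>ab. Cd n n i +
          (real (i - 1) / real n) * yd (i - 1) (i - 1) (fst ab) + (real (n - i) / real n) * yd (n -
              i) (n - i) (snd ab) \<partial>(Tree \<Otimes>\<^sub>M Tree))"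
          using elim by (intro Bochner_Integration.integral_cong refl gr i_def) auto
        also have "\<dots> = Cd n n i + (\<integral>u. (real (i - 1) / real n) * yd (i - 1) (i - 1) u \<partial>Tree)
            + (\<integral>u. (real (n - i) / real n) * yd (n - i) (n - i) u \<partial>Tree)"
          using less.IH[OF i(1)] less.IH[OF i(2)]
          by (intro integral_Tree_pair integrable_mult_right sqn_le_integrable[of _ 4800]) (auto
              intro: yd_measurable)
        also have "\<dots> = Cd n n i"
          using less.IH[OF i(1)] less.IH[OF i(2)] by simp
        finally show ?case by (simp add: i_def)
      qed
      show "(\<lambda>x. \<integral>ab. yd n n (graft x ab) \<partial>(Tree \<Otimes>\<^sub>M Tree)) \<in> borel_measurable Unif"
        using integral_graft(2)[OF int] by simp
      show "(\<lambda>x. Cd n n (nat \<lceil>real n * x\<rceil>)) \<in> borel_measurable Unif"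
        unfolding borel_measurable_Unif by measurable
    qed
    also have "\<dots> = 0"
      using False sum_Cd_diag[of n] by (subst integral_split_index) simp_all
    finally show ?thesis using le by simp
  qed
qed

text \<open>Obtained from the discrete tolls, which average to zero, by dominated convergence.\<close>

lemma integral_Cfun: "(\<integral>x. Cfun x \<partial>Unif) = 0"
proof -
  interpret Unif: prob_space Unif by simp
  have "(\<lambda>k. \<integral>x. Cd (Suc k) (Suc k) (nat \<lceil>real (Suc k) * x\<rceil>) \<partial>Unif) \<longlonglongrightarrow> (\<integral>x. Cfun x \<partial>Unif)"
  proof (rule integral_dominated_convergence[where w = "\<lambda>_. 40"])
    show "AE x in Unif. (\<lambda>k. Cd (Suc k) (Suc k) (nat \<lceil>real (Suc k) * x\<rceil>)) \<longlonglongrightarrow> Cfun x"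
      using AE_Unif[of 0]
    proof eventually_elim
      case (elim x)
      have x: "0 < x" "x < 1" using elim by auto
      have "(\<lambda>k. Cd (Suc k) (Suc k) (nat \<lceil>real (Suc k) * x\<rceil>)) \<longlonglongrightarrow> Ct 1 x"
      proof (rule Cd_tendsto[of "\<lambda>k. Suc k"])
        show "(\<lambda>k. real (nat \<lceil>real (Suc k) * x\<rceil>) / real (Suc k)) \<longlonglongrightarrow> x"
        proof (rule LIM_zero_cancel, rule Lim_null_comparison)
          show "eventually (\<lambda>k. norm (real (nat \<lceil>real (Suc k) * x\<rceil>) / real (Suc k) - x)
              \<le> 1 / real (Suc k)) sequentially"
          proof (intro always_eventually allI)
            fix k
            show "norm (real (nat \<lceil>real (Suc k) * x\<rceil>) / real (Suc k) - x) \<le> 1 / real (Suc k)"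
              using split_index(7)[of x "Suc k", OF x _ refl] unfolding real_norm_def by linarith
          qed
          show "(\<lambda>k. 1 / real (Suc k)) \<longlonglongrightarrow> 0" by (rule LIMSEQ_Suc[OF lim_1_over_n])
        qed
        show "eventually (\<lambda>k. 1 \<le> nat \<lceil>real (Suc k) * x\<rceil> \<and> nat \<lceil>real (Suc k) * x\<rceil>
            \<le> Suc k) sequentially"
        proof (intro always_eventually allI)
          fix k :: nat
          have "1 \<le> Suc k" by simp
          from split_index(1,2)[OF x this refl]
          show "1 \<le> nat \<lceil>real (Suc k) * x\<rceil> \<and> nat \<lceil>real (Suc k) * x\<rceil> \<le> Suc k" by blast
        qed
        show "(\<lambda>k. real (Suc k) / real (Suc k)) \<longlonglongrightarrow> 1" by simp
      qed (use x filterlim_Suc in auto)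
      then show ?case using x by (simp add: Ct_one)
    qed
    show "AE x in Unif. norm (Cd (Suc k) (Suc k) (nat \<lceil>real (Suc k) * x\<rceil>)) \<le> 40" for k
      using AE_Unif[of 0]
    proof eventually_elim
      case (elim x)
      then show ?case using split_index(1,2)[of x "Suc k", OF _ _ _ refl]
          by (auto intro!: abs_Cd_le)
    qed
    show "(\<lambda>x. Cd (Suc k) (Suc k) (nat \<lceil>real (Suc k) * x\<rceil>)) \<in> borel_measurable Unif" for k
      unfolding borel_measurable_Unif by measurable
  qed auto
  moreover have "(\<integral>x. Cd (Suc k) (Suc k) (nat \<lceil>real (Suc k) * x\<rceil>) \<partial>Unif) = 0" for k
    by (subst integral_split_index) (simp, simp only: sum_Cd_diag div_0)
  ultimately show ?thesis by (simp add: LIMSEQ_const_iff)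
qed

section \<open>Convergence of the partial sums of the limiting Quicksort cost\<close>

lemma Qs_measurable: "Qs m \<in> borel_measurable Tree"
proof (induction m)
  case 0 then show ?case by (simp add: Qs_0[abs_def])
next
  case (Suc m)
  show ?case unfolding Qs_Suc[abs_def]
    by (intro borel_measurable_add borel_measurable_times borel_measurable_diff measurable_const
       root_measurable measurable_compose[OF root_measurable Cfun_measurable]
       measurable_compose[OF subtree_measurable(1) Suc]
           measurable_compose[OF subtree_measurable(3) Suc]) auto
qed

text \<open>The contribution of the words of length \<open>m\<close> alone. From \<open>m\<close> to
  \<open>Suc m\<close> its recursion has no toll, which gives geometric decay.\<close>

definition Qinc :: "nat \<Rightarrow> (nat list \<Rightarrow> real) \<Rightarrow> real" where
  "Qinc m u = Qs (Suc m) u - Qs m u"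

lemma Qinc_0: "Qinc 0 u = Cfun (u [])"
  by (simp add: Qinc_def Qs_Suc Qs_0)

lemma Qinc_Suc: "Qinc (Suc m) u = u [] * Qinc m (subtree 1 u) + (1 - u []) * Qinc m (subtree 2 u)"
  by (simp add: Qinc_def Qs_Suc algebra_simps)

lemma Qinc_measurable: "Qinc m \<in> borel_measurable Tree"
  unfolding Qinc_def[abs_def] by (intro borel_measurable_diff Qs_measurable)

text \<open>Generation 0 is a single toll, bounded by 40, whence \<open>1600\<close>; every further
  generation only averages two independent centred copies with weights \<open>x\<close> and
  \<open>1 - x\<close>.\<close>

lemma Qinc_moments:
  "(\<integral>u. Qinc m u \<partial>Tree) = 0 \<and> sqn Tree (Qinc m) \<le> ennreal (1600 * (2/3) ^ m)"
proof (induction m)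
  case 0
  interpret TT: prob_space "Tree \<Otimes>\<^sub>M Tree" by simp
  have le: "sqn Tree (Qinc 0) \<le> ennreal (1600 + 0 * (2/3))"
  proof (rule sqn_Tree_le[where t = 0])
    fix x :: real assume x: "0 < x" "x < 1"
    have "(Cfun x)\<^sup>2 \<le> 40\<^sup>2" using abs_Cfun_le[of x] x by (intro iffD1[OF abs_le_square_iff]) simp
    then show "sqn (Tree \<Otimes>\<^sub>M Tree) (\<lambda>ab. Qinc 0 (graft x ab))
        \<le> ennreal (1600 + 0 * (x\<^sup>2 + (1 - x)\<^sup>2))"
      by (simp add: Qinc_0) (drule ennreal_leI, simp)
  qed (auto intro: Qinc_measurable)
  then have int: "integrable Tree (Qinc 0)" by (intro sqn_le_integrable[OF Qinc_measurable])
  have "(\<integral>u. Qinc 0 u \<partial>Tree) = 0"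
    unfolding integral_graft(1)[OF int] using integral_Cfun by (simp add: Qinc_0 TT.prob_space)
  with le show ?case by simp
next
  case (Suc m)
  have gr: "Qinc (Suc m) (graft x ab) = 0 + x * Qinc m (fst ab) + (1 - x) * Qinc m (snd ab)"
    if "ab \<in> space (Tree \<Otimes>\<^sub>M Tree)" for x ab
    using that by (simp add: Qinc_Suc subtree_graft)
  have le: "sqn Tree (Qinc (Suc m)) \<le> ennreal (0\<^sup>2 + 1600 * (2/3) ^ m * (2/3))"
  proof (rule sqn_Tree_le[where t = 0])
    fix x :: real assume x: "0 < x" "x < 1"
    have "sqn (Tree \<Otimes>\<^sub>M Tree) (\<lambda>ab. Qinc (Suc m) (graft x ab)) =
        sqn (Tree \<Otimes>\<^sub>M Tree) (\<lambda>ab. 0 + x * Qinc m (fst ab) + (1 - x) * Qinc m (snd ab))"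
      by (intro sqn_cong gr)
    also have "\<dots> \<le> ennreal (0\<^sup>2 + 1600 * (2/3) ^ m * (x\<^sup>2 + (1 - x)\<^sup>2))"
      using x Suc by (intro sqn_two_branches_le Qinc_measurable) auto
    finally show "sqn (Tree \<Otimes>\<^sub>M Tree) (\<lambda>ab. Qinc (Suc m) (graft x ab)) \<le> \<dots>" .
  qed (auto intro: Qinc_measurable)
  then have int: "integrable Tree (Qinc (Suc m))"
      by (intro sqn_le_integrable[OF Qinc_measurable]) auto
  have intm: "integrable Tree (Qinc m)" using Suc
      by (intro sqn_le_integrable[OF Qinc_measurable]) auto
  have "(\<integral>ab. Qinc (Suc m) (graft x ab) \<partial>(Tree \<Otimes>\<^sub>M Tree)) = 0" for x
  proof -
    have "(\<integral>ab. Qinc (Suc m) (graft x ab) \<partial>(Tree \<Otimes>\<^sub>M Tree)) =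
        (\<integral>ab. 0 + x * Qinc m (fst ab) + (1 - x) * Qinc m (snd ab) \<partial>(Tree \<Otimes>\<^sub>M Tree))"
      by (intro Bochner_Integration.integral_cong refl gr)
    also have "\<dots> = 0 + (\<integral>u. x * Qinc m u \<partial>Tree) + (\<integral>u. (1 - x) * Qinc m u \<partial>Tree)"
      by (intro integral_Tree_pair integrable_mult_right intm)
    finally show ?thesis using Suc by simp
  qed
  then have "(\<integral>u. Qinc (Suc m) u \<partial>Tree) = 0"
    unfolding integral_graft(1)[OF int] by simp
  with le show ?case by (simp add: mult.assoc)
qed

lemma integral_Qs: "(\<integral>u. Qs m u \<partial>Tree) = 0 \<and> integrable Tree (Qs m)"
proof (induction m)
  case 0 then show ?case by (simp add: Qs_0[abs_def])
next
  case (Suc m)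
  have "integrable Tree (Qinc m)" using Qinc_moments[of m]
      by (intro sqn_le_integrable[OF Qinc_measurable]) auto
  moreover have "Qs (Suc m) u = Qs m u + Qinc m u" for u by (simp add: Qinc_def)
  ultimately show ?case using Suc Qinc_moments[of m]
      by (simp add: fun_eq_iff[symmetric] cong: Bochner_Integration.integral_cong)
qed

abbreviation Qlim :: "(nat list \<Rightarrow> real) \<Rightarrow> real" where "Qlim u \<equiv> Qp u []"

lemma Qlim_measurable: "Qlim \<in> borel_measurable Tree"
  unfolding Qp_eq[abs_def] by (intro borel_measurable_lim_metric Qs_measurable)

text \<open>The increments of \<open>Qs\<close> meet the hypothesis of
  \<open>geometric_L2_increments\<close> with \<open>K = 1600\<close>, and
  \<open>960000 = 600 * 1600\<close>.\<close>

lemma Qs_convergent: "AE u in Tree. convergent (\<lambda>m. Qs m u)"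
  and sqn_Qlim: "sqn Tree Qlim \<le> ennreal 960000"
  and integral_Qlim: "(\<integral>u. Qlim u \<partial>Tree) = 0"
proof -
  interpret Tree: prob_space Tree by simp
  note * = Tree.geometric_L2_increments[of Qs 1600, OF Qs_measurable Qs_0 _ conjunct2[OF Qinc_moments, unfolded Qinc_def[abs_def]]]
  show "AE u in Tree. convergent (\<lambda>m. Qs m u)" using *(1) by simp
  show "sqn Tree Qlim \<le> ennreal 960000" using *(2) by (simp add: Qp_eq)
  show "(\<integral>u. Qlim u \<partial>Tree) = 0" using *(3) integral_Qs by (simp add: Qp_eq)
qed

lemma Qlim_graft:
  "AE ab in Tree \<Otimes>\<^sub>M Tree. Qlim (graft x ab) = Cfun x + x * Qlim (fst ab) + (1 - x) * Qlim (snd ab)"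
  using AE_Tree_pair[OF Qs_convergent] AE_space
proof eventually_elim
  case (elim ab)
  then have "(\<lambda>m. Qs m (fst ab)) \<longlonglongrightarrow> Qlim (fst ab)" "(\<lambda>m. Qs m (snd ab)) \<longlonglongrightarrow> Qlim (snd ab)"
    by (simp_all add: Qp_eq convergent_LIMSEQ_iff)
  then have "(\<lambda>m. Cfun x + x * Qs m (fst ab) + (1 - x) * Qs m (snd ab)) \<longlonglongrightarrow>
      Cfun x + x * Qlim (fst ab) + (1 - x) * Qlim (snd ab)"
    by (intro tendsto_intros)
  then have "(\<lambda>m. Qs (Suc m) (graft x ab)) \<longlonglongrightarrow> Cfun x + x * Qlim (fst ab) + (1 - x) * Qlim (snd ab)"
    using elim(3) by (simp add: Qs_Suc subtree_graft)
  then have "(\<lambda>m. Qs m (graft x ab)) \<longlonglongrightarrow> Cfun x + x * Qlim (fst ab) + (1 - x) * Qlim (snd ab)"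
    by (rule LIMSEQ_imp_Suc)
  then show ?case unfolding Qp_eq[of "graft x ab"] by (rule limI)
qed

lemma yd_diag_graft:
  assumes "2 \<le> n" and x: "0 < x" "x < 1" "ab \<in> space (Tree \<Otimes>\<^sub>M Tree)" "i = nat \<lceil>real n * x\<rceil>"
  shows "yd n n (graft x ab) = Cd n n i + (real (i - 1) / real n) * yd (i - 1) (i - 1) (fst ab)
      + (real (n - i) / real n) * yd (n - i) (n - i) (snd ab)"
proof -
  have "\<not> n < i" using split_index(2)[OF x(1,2) _ x(4)] assms(1) by simp
  then show ?thesis using yd_graft[OF _ _ x, where l = n] assms(1) by simp
qed

section \<open>Convergence of the Quicksort costs\<close>

lemma sqn_add_le_real:
  assumes "f \<in> borel_measurable M" "g \<in> borel_measurable M"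
    and "sqn M f \<le> ennreal A" "sqn M g \<le> ennreal B" "0 \<le> A" "0 \<le> B"
  shows "sqn M (\<lambda>x. f x + g x) \<le> ennreal (2 * A + 2 * B)"
proof -
  have "sqn M (\<lambda>x. f x + g x) \<le> ennreal (1 + 1 / 1) * sqn M f + ennreal (1 + 1) * sqn M g"
    by (rule sqn_add_le) (use assms in auto)
  also have "\<dots> \<le> ennreal 2 * ennreal A + ennreal 2 * ennreal B"
    using assms by (intro add_mono mult_mono) auto
  also have "\<dots> = ennreal (2 * A + 2 * B)"
    using assms by (simp add: ennreal_plus ennreal_mult)
  finally show ?thesis .
qed

lemma sqn_diff_le_real:
  assumes "f \<in> borel_measurable M" "g \<in> borel_measurable M"
    and "sqn M f \<le> ennreal A" "sqn M g \<le> ennreal B" "0 \<le> A" "0 \<le> B"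
  shows "sqn M (\<lambda>x. f x - g x) \<le> ennreal (2 * A + 2 * B)"
proof -
  have "sqn M (\<lambda>x. f x + - g x) \<le> ennreal (2 * A + 2 * B)"
    by (rule sqn_add_le_real) (use assms in \<open>auto simp: sqn_def\<close>)
  then show ?thesis by simp
qed

text \<open>\<open>f\<close> collects the errors that tend to zero, so its factor 5 does no harm,
  while the factor 5/4 of the subtree difference keeps \<open>5/4 * 2/3\<close> below 1.\<close>

lemma sqn_add_le_weighted:
  assumes "f \<in> borel_measurable M" "g \<in> borel_measurable M"
    and "sqn M f \<le> ennreal A" "0 \<le> A"
  shows "sqn M (\<lambda>z. f z + x * g z) \<le> ennreal (5 * A) + ennreal (5/4 * x\<^sup>2) * sqn M g"
proof -
  have "sqn M (\<lambda>z. f z + x * g z)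
      \<le> ennreal (1 + 1 / (1/4)) * sqn M f + ennreal (1 + 1/4) * sqn M (\<lambda>z. x * g z)"
    by (rule sqn_add_le) (use assms in auto)
  also have "\<dots> \<le> ennreal 5 * ennreal A + ennreal (5/4) * sqn M (\<lambda>z. x * g z)"
    using assms by (intro add_mono mult_mono) auto
  also have "\<dots> = ennreal (5 * A) + ennreal (5/4) * (ennreal (x\<^sup>2) * sqn M g)"
    using assms by (simp add: sqn_cmult ennreal_mult)
  also have "ennreal (5/4) * (ennreal (x\<^sup>2) * sqn M g) = ennreal (5/4 * x\<^sup>2) * sqn M g"
    unfolding mult.assoc[symmetric] by (subst ennreal_mult) auto
  finally show ?thesis .
qed

lemma sqn_cmult_le:
  assumes "f \<in> borel_measurable M" "sqn M f \<le> ennreal A" "\<bar>c\<bar> \<le> d" "0 \<le> A"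
  shows "sqn M (\<lambda>z. c * f z) \<le> ennreal (d\<^sup>2 * A)"
proof -
  have "c\<^sup>2 \<le> d\<^sup>2" using assms(3) by (intro iffD1[OF abs_le_square_iff]) auto
  then show ?thesis
    using assms by (auto simp: sqn_cmult ennreal_mult intro!: mult_mono ennreal_leI)
qed

text \<open>For \<open>0 < x < 1\<close> both subtree sizes tend to infinity, so the errors in the
  subtrees are again errors along a sequence of sizes of the same kind.\<close>

lemma split_index_limits:
  fixes N :: "nat \<Rightarrow> nat"
  assumes N: "filterlim N at_top sequentially" and x: "0 < x" "x < 1"
    and i: "\<And>k. i k = nat \<lceil>real (N k) * x\<rceil>"
  shows "(\<lambda>k. real (i k) / real (N k)) \<longlonglongrightarrow> x"
    "(\<lambda>k. real (i k - 1) / real (N k)) \<longlonglongrightarrow> x"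
    "(\<lambda>k. real (N k - i k) / real (N k)) \<longlonglongrightarrow> 1 - x"
    "filterlim (\<lambda>k. i k - 1) at_top sequentially" "filterlim (\<lambda>k. N k - i k) at_top sequentially"
    "eventually (\<lambda>k. 2 \<le> N k) sequentially"
    "(\<lambda>k. 1 / real (N k)) \<longlonglongrightarrow> 0"
proof -
  show N1: "(\<lambda>k. 1 / real (N k)) \<longlonglongrightarrow> 0"
    using filterlim_compose[OF lim_1_over_n N] .
  show ev: "eventually (\<lambda>k. 2 \<le> N k) sequentially"
    using N eventually_ge_at_top[of 2] by (simp add: filterlim_iff)
  have *: "f \<longlonglongrightarrow> y" if "eventually (\<lambda>k. \<bar>f k - y\<bar> \<le> 1 / real (N k)) sequentially" for f y
    by (rule LIM_zero_cancel, rule Lim_null_comparison[OF _ N1]) (use that in simp)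
  show "(\<lambda>k. real (i k) / real (N k)) \<longlonglongrightarrow> x"
    by (rule *, use ev in eventually_elim) (use split_index[OF x _ i] in auto)
  show I1: "(\<lambda>k. real (i k - 1) / real (N k)) \<longlonglongrightarrow> x"
    by (rule *, use ev in eventually_elim) (use split_index[OF x _ i] in auto)
  show I2: "(\<lambda>k. real (N k - i k) / real (N k)) \<longlonglongrightarrow> 1 - x"
    by (rule *, use ev in eventually_elim) (use split_index[OF x _ i] in auto)
  have Nr: "filterlim (\<lambda>k. real (N k)) at_top sequentially"
    using filterlim_compose[OF filterlim_real_sequentially N] .
  have **: "filterlim g at_top sequentially" if "(\<lambda>k. real (g k) / real (N k)) \<longlonglongrightarrow> y" "0 < y"
      for g :: "nat \<Rightarrow> nat" and y
  proof -
    have "filterlim (\<lambda>k. real (g k) / real (N k) * real (N k)) at_top sequentially"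
      by (rule filterlim_tendsto_pos_mult_at_top[OF that Nr])
    moreover have "eventually (\<lambda>k. real (g k) / real (N k) * real (N k) = real (g k)) sequentially"
      using ev by eventually_elim auto
    ultimately have "filterlim (\<lambda>k. real (g k)) at_top sequentially"
      by (simp add: filterlim_cong)
    then show ?thesis by (simp add: filterlim_sequentially_iff_filterlim_real)
  qed
  show "filterlim (\<lambda>k. i k - 1) at_top sequentially" "filterlim (\<lambda>k. N k - i k) at_top sequentially"
    using **[OF I1] **[OF I2] x by auto
qed

lemma squares_le_1: "0 \<le> x \<Longrightarrow> x \<le> 1 \<Longrightarrow> x\<^sup>2 + (1 - x)\<^sup>2 \<le> (1::real)"
proof -
  assume x: "0 \<le> x" "x \<le> 1"
  have "x\<^sup>2 + (1 - x)\<^sup>2 = 1 - 2 * (x * (1 - x))" by (simp add: power2_eq_square algebra_simps)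
  moreover have "0 \<le> x * (1 - x)" using x by simp
  ultimately show ?thesis by linarith
qed

lemma graft_compose: "f \<in> borel_measurable Tree
    \<Longrightarrow> (\<lambda>ab. f (graft x ab)) \<in> borel_measurable (Tree \<Otimes>\<^sub>M Tree)"
  by (rule measurable_compose[OF graft_measurable_snd])

lemma fst_compose: "f \<in> borel_measurable Tree
    \<Longrightarrow> (\<lambda>ab. f (fst ab)) \<in> borel_measurable (Tree \<Otimes>\<^sub>M Tree)"
  by (rule measurable_compose[OF measurable_fst])

lemma snd_compose: "f \<in> borel_measurable Tree
    \<Longrightarrow> (\<lambda>ab. f (snd ab)) \<in> borel_measurable (Tree \<Otimes>\<^sub>M Tree)"
  by (rule measurable_compose[OF measurable_snd])

lemma yd_diag_measurable: "yd n n \<in> borel_measurable Tree"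
  by (rule yd_measurable) simp

text \<open>A bound for every single root value, as required for a dominating constant; the moment
  over the whole tree would not give it. Here \<open>6400 = 1600 + 4800\<close>, the squares of the
  weights adding up to at most 1.\<close>

lemma sqn_yd_diag_graft:
  assumes x: "0 < x" "x < 1"
  shows "sqn (Tree \<Otimes>\<^sub>M Tree) (\<lambda>ab. yd n n (graft x ab)) \<le> ennreal 6400"
proof (cases "n < 2")
  case False
  define i where "i = nat \<lceil>real n * x\<rceil>"
  note i = split_index[OF x _ i_def]
  have "sqn (Tree \<Otimes>\<^sub>M Tree) (\<lambda>ab. yd n n (graft x ab)) = sqn (Tree \<Otimes>\<^sub>M Tree) (\<lambda>ab. Cd n n i +
      (real (i - 1) / real n) * yd (i - 1) (i - 1) (fst ab) + (real (n - i) / real n) * yd (n - i)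
          (n - i) (snd ab))"
    using False by (intro sqn_cong yd_diag_graft x i_def) auto
  also have "\<dots> \<le> ennreal (40\<^sup>2 + 4800 * (x\<^sup>2 + (1 - x)\<^sup>2))"
    using i False quicksort_moments[of "i - 1"] quicksort_moments[of "n - i"]
    by (intro sqn_two_branches_le yd_diag_measurable abs_Cd_le) auto
  also have "\<dots> \<le> ennreal 6400" using squares_le_1[of x] x by (intro ennreal_leI) auto
  finally show ?thesis .
qed (simp add: yd_less2)

lemma sqn_Qlim_graft:
  assumes x: "0 < x" "x < 1"
  shows "sqn (Tree \<Otimes>\<^sub>M Tree) (\<lambda>ab. Qlim (graft x ab)) \<le> ennreal 961600"
proof -
  have "sqn (Tree \<Otimes>\<^sub>M Tree) (\<lambda>ab. Qlim (graft x ab)) =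
      sqn (Tree \<Otimes>\<^sub>M Tree) (\<lambda>ab. Cfun x + x * Qlim (fst ab) + (1 - x) * Qlim (snd ab))"
    by (rule sqn_cong_AE[OF Qlim_graft])
  also have "\<dots> \<le> ennreal (40\<^sup>2 + 960000 * (x\<^sup>2 + (1 - x)\<^sup>2))"
    using x abs_Cfun_le[of x] by (intro sqn_two_branches_le Qlim_measurable integral_Qlim sqn_Qlim)
        auto
  also have "\<dots> \<le> ennreal 961600" using squares_le_1[of x] x by (intro ennreal_leI) auto
  finally show ?thesis .
qed

text \<open>Replaces the rounded weight \<open>a\<close> by the limiting weight \<open>x\<close>:
  the correction \<open>(a - x) * f\<close> is of the size of the rounding, and the remainder is
  \<open>x\<close> times the difference.\<close>

lemma sqn_scaled_diff_le:
  assumes [measurable]: "f \<in> borel_measurable M" "g \<in> borel_measurable M"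
    and "sqn M f \<le> ennreal A" "0 \<le> A" "\<bar>a - x\<bar> \<le> d"
  shows "sqn M (\<lambda>z. a * f z - x * g z)
      \<le> ennreal (5 * (d\<^sup>2 * A)) + ennreal (5/4 * x\<^sup>2) * sqn M (\<lambda>z. f z - g z)"
proof -
  have "sqn M (\<lambda>z. (a - x) * f z + x * (f z - g z)) \<le>
      ennreal (5 * (d\<^sup>2 * A)) + ennreal (5/4 * x\<^sup>2) * sqn M (\<lambda>z. f z - g z)"
    by (rule sqn_add_le_weighted) (use assms in \<open>auto intro!: sqn_cmult_le\<close>)
  then show ?thesis by (simp add: algebra_simps)
qed

text \<open>The scaled differences \<open>F\<close> and \<open>G\<close> are centred and
  independent, so they add to the squared toll error without loss. The factor 5/4 comes only from
  the rounding of the weights, whose two contributions \<open>5 * 4800\<close> make up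
  \<open>48000\<close>.\<close>

lemma sqn_diag_diff_step:
  assumes n: "2 \<le> n" and x: "0 < x" "x < 1" and i: "i = nat \<lceil>real n * x\<rceil>"
  shows "sqn (Tree \<Otimes>\<^sub>M Tree) (\<lambda>ab. yd n n (graft x ab) - Qlim (graft x ab)) \<le>
    ennreal ((Cd n n i - Cfun x)\<^sup>2 + 48000 * (1 / real n)\<^sup>2)
    + ennreal (5/4 * x\<^sup>2) * sqn Tree (\<lambda>u. yd (i - 1) (i - 1) u - Qlim u)
    + ennreal (5/4 * (1 - x)\<^sup>2) * sqn Tree (\<lambda>u. yd (n - i) (n - i) u - Qlim u)"
proof -
  define F where "F u = real (i - 1) / real n * yd (i - 1) (i - 1) u - x * Qlim u" for u
  define G where "G u = real (n - i) / real n * yd (n - i) (n - i) u - (1 - x) * Qlim u" for u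
  note [measurable] = yd_diag_measurable Qlim_measurable
  have "1 \<le> n" using n by simp
  note ii = split_index[OF x this i]
  have [measurable]: "F \<in> borel_measurable Tree" "G \<in> borel_measurable Tree"
    unfolding F_def[abs_def] G_def[abs_def] by measurable
  note int = sqn_le_integrable[OF Qlim_measurable sqn_Qlim]
    sqn_le_integrable[OF yd_diag_measurable conjunct2[OF quicksort_moments]]
  have zero: "(\<integral>u. F u \<partial>Tree) = 0" "(\<integral>u. G u \<partial>Tree) = 0"
    unfolding F_def G_def using int integral_Qlim quicksort_moments by simp_all
  have fin: "sqn Tree F \<le> ennreal (2 * 4800 + 2 * 960000)"
      "sqn Tree G \<le> ennreal (2 * 4800 + 2 * 960000)"
  proof -
    have A: "sqn Tree (\<lambda>u. a * yd m m u) \<le> ennreal 4800" if "\<bar>a\<bar> \<le> 1" for a m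
      using sqn_cmult_le[OF yd_diag_measurable conjunct2[OF quicksort_moments] that] by simp
    have B: "sqn Tree (\<lambda>u. a * Qlim u) \<le> ennreal 960000" if "\<bar>a\<bar> \<le> 1" for a
      using sqn_cmult_le[OF Qlim_measurable sqn_Qlim that] by simp
    have c: "\<bar>real (i - 1) / real n\<bar> \<le> 1" "\<bar>real (n - i) / real n\<bar> \<le> 1" "\<bar>x\<bar> \<le> 1" "\<bar>1 - x\<bar> \<le> 1"
      using ii x by (simp_all only: abs_of_nonneg divide_nonneg_nonneg of_nat_0_le_iff)
    show "sqn Tree F \<le> ennreal (2 * 4800 + 2 * 960000)" unfolding F_def
      by (rule sqn_diff_le_real[OF _ _ A[OF c(1)] B[OF c(3)]]) measurable
    show "sqn Tree G \<le> ennreal (2 * 4800 + 2 * 960000)" unfolding G_def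
      by (rule sqn_diff_le_real[OF _ _ A[OF c(2)] B[OF c(4)]]) measurable
  qed
  have lt: "sqn Tree F < \<infinity>" "sqn Tree G < \<infinity>"
    using le_less_trans[OF fin(1) ennreal_less_top] le_less_trans[OF fin(2) ennreal_less_top]
        by auto
  have "sqn (Tree \<Otimes>\<^sub>M Tree) (\<lambda>ab. yd n n (graft x ab) - Qlim (graft x ab)) =
      sqn (Tree \<Otimes>\<^sub>M Tree) (\<lambda>ab. (Cd n n i - Cfun x) + F (fst ab) + G (snd ab))"
  proof (rule sqn_cong_AE, use Qlim_graft[of x] AE_space in eventually_elim)
    case (elim ab)
    show ?case unfolding elim(1) yd_diag_graft[OF n x elim(2) i] F_def G_def by simp
  qed
  also have "\<dots> = ennreal ((Cd n n i - Cfun x)\<^sup>2) + sqn Tree F + sqn Tree G"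
    by (rule sqn_const_add_two_centred[OF prob_space_Tree]) (use zero lt in auto)
  also have "\<dots> \<le> ennreal ((Cd n n i - Cfun x)\<^sup>2)
      + (ennreal (5 * ((1 / real n)\<^sup>2 * 4800)) + ennreal (5/4 * x\<^sup>2) * sqn Tree
          (\<lambda>u. yd (i - 1) (i - 1) u - Qlim u))
      + (ennreal (5 * ((1 / real n)\<^sup>2 * 4800)) + ennreal (5/4 * (1 - x)\<^sup>2) * sqn Tree
          (\<lambda>u. yd (n - i) (n - i) u - Qlim u))"
    unfolding F_def G_def using ii quicksort_moments
    by (intro add_mono sqn_scaled_diff_le order_refl) auto
  also have "\<dots> = (ennreal ((Cd n n i - Cfun x)\<^sup>2) + ennreal (5 * ((1 / real n)\<^sup>2 * 4800))
      + ennreal (5 * ((1 / real n)\<^sup>2 * 4800)))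
      + ennreal (5/4 * x\<^sup>2) * sqn Tree (\<lambda>u. yd (i - 1) (i - 1) u - Qlim u)
      + ennreal (5/4 * (1 - x)\<^sup>2) * sqn Tree (\<lambda>u. yd (n - i) (n - i) u - Qlim u)"
    by (simp only: ac_simps)
  also have "ennreal ((Cd n n i - Cfun x)\<^sup>2) + ennreal (5 * ((1 / real n)\<^sup>2 * 4800)) + ennreal (5
      * ((1 / real n)\<^sup>2 * 4800))
      = ennreal ((Cd n n i - Cfun x)\<^sup>2 + 48000 * (1 / real n)\<^sup>2)"
    by (subst ennreal_plus[symmetric], simp, simp)+ simp
  finally show ?thesis .
qed

text \<open>The sizes are an arbitrary sequence because the contraction family must contain the
  errors along the subtree sizes, and these depend on the root value.\<close>

lemma quicksort_L2_limit:
  assumes "filterlim N at_top sequentially"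
  shows "(\<lambda>k. sqn Tree (\<lambda>u. yd (N k) (N k) u - Qlim u)) \<longlonglongrightarrow> 0"
proof (rule contraction[where P = "{\<lambda>k. sqn Tree (\<lambda>u. yd (N k) (N k) u
    - Qlim u) |N. filterlim N at_top sequentially}"
      and B = "2 * 4800 + 2 * 960000" and B' = "2 * 6400 + 2 * 961600"])
  fix e k assume "e \<in> {\<lambda>k. sqn Tree (\<lambda>u. yd (N k) (N k) u
      - Qlim u) |N. filterlim N at_top sequentially}"
  then obtain N where "e = (\<lambda>k. sqn Tree (\<lambda>u. yd (N k) (N k) u - Qlim u))" by blast
  then show "e k \<le> ennreal (2 * 4800 + 2 * 960000)"
    by (simp only:) (intro sqn_diff_le_real yd_diag_measurable Qlim_measurable sqn_Qlim
      conjunct2[OF quicksort_moments]; simp)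
next
  let ?P = "{\<lambda>k. sqn Tree (\<lambda>u. yd (N k) (N k) u - Qlim u) |N. filterlim N at_top sequentially}"
  fix e assume "e \<in> ?P"
  then obtain N where N: "filterlim N at_top sequentially"
      and e: "e = (\<lambda>k. sqn Tree (\<lambda>u. yd (N k) (N k) u - Qlim u))"
    by auto
  define J where "J k x = sqn (Tree \<Otimes>\<^sub>M Tree) (\<lambda>ab. yd (N k) (N k) (graft x ab)
      - Qlim (graft x ab))" for k x
  have m: "(\<lambda>u. yd (N k) (N k) u - Qlim u) \<in> borel_measurable Tree" for k
    by (intro borel_measurable_diff yd_diag_measurable Qlim_measurable)
  have "J k \<in> borel_measurable Unif" "e k = (\<integral>\<^sup>+x. J k x \<partial>Unif)" for k
    unfolding J_def[abs_def] e using sqn_graft[OF m, of k] by auto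
  moreover have "AE x in Unif. J k x \<le> ennreal (2 * 6400 + 2 * 961600)" for k
    using AE_Unif[of 0]
  proof eventually_elim
    case (elim x)
    then show ?case unfolding J_def
      by (intro sqn_diff_le_real graft_compose yd_diag_measurable Qlim_measurable sqn_yd_diag_graft
          sqn_Qlim_graft) auto
  qed
  moreover have "AE x in Unif. \<exists>e1\<in>?P. \<exists>e2\<in>?P. \<exists>p. p \<longlonglongrightarrow> 0 \<and>
          eventually (\<lambda>k. J k x \<le> p k + ennreal (5/4 * x\<^sup>2) * e1 k + ennreal (5/4 * (1 - x)\<^sup>2) * e2
              k) sequentially"
    using AE_Unif[of 0]
  proof eventually_elim
    case (elim x)
    then have x: "0 < x" "x < 1" by auto
    define i where "i k = nat \<lceil>real (N k) * x\<rceil>" for k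
    note L = split_index_limits[OF N x i_def]
    let ?e1 = "\<lambda>k. sqn Tree (\<lambda>u. yd (i k - 1) (i k - 1) u - Qlim u)"
    let ?e2 = "\<lambda>k. sqn Tree (\<lambda>u. yd (N k - i k) (N k - i k) u - Qlim u)"
    let ?p = "\<lambda>k. (Cd (N k) (N k) (i k) - Cfun x)\<^sup>2 + 48000 * (1 / real (N k))\<^sup>2"
    have "?e1 \<in> ?P" unfolding mem_Collect_eq by (rule exI[of _ "\<lambda>k. i k - 1"]) (use L(4) in simp)
    moreover have "?e2 \<in> ?P" unfolding mem_Collect_eq
        by (rule exI[of _ "\<lambda>k. N k - i k"]) (use L(5) in simp)
    moreover have "(\<lambda>k. ennreal (?p k)) \<longlonglongrightarrow> 0"
    proof -
      have "(\<lambda>k. Cd (N k) (N k) (i k)) \<longlonglongrightarrow> Ct 1 x"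
      proof (rule Cd_tendsto[OF N _ _ L(1)])
        show "(\<lambda>k. real (N k) / real (N k)) \<longlonglongrightarrow> 1"
          by (rule tendsto_eventually, use L(6) in eventually_elim) auto
        show "eventually (\<lambda>k. 1 \<le> i k \<and> i k \<le> N k) sequentially"
          using L(6) by eventually_elim (use split_index(1,2)[OF x _ i_def] in auto)
      qed (use x in auto)
      then have "(\<lambda>k. Cd (N k) (N k) (i k)) \<longlonglongrightarrow> Cfun x" using x by (simp add: Ct_one)
      then have "?p \<longlonglongrightarrow> (Cfun x - Cfun x)\<^sup>2 + 48000 * 0\<^sup>2"
        by (intro tendsto_intros L(7))
      then have "?p \<longlonglongrightarrow> 0" by simp
      from tendsto_ennrealI[OF this] show ?thesis by simp
    qed
    moreover have "eventually (\<lambda>k. J k x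
        \<le> ennreal (?p k) + ennreal (5/4 * x\<^sup>2) * ?e1 k + ennreal (5/4 * (1 - x)\<^sup>2) * ?e2 k)
        sequentially"
      using L(6) unfolding J_def by eventually_elim (rule sqn_diag_diff_step[OF _ x i_def])
    ultimately show ?case
      by (intro bexI[of _ ?e1] bexI[of _ ?e2] exI[of _ "\<lambda>k. ennreal (?p k)"] conjI)
  qed
  ultimately show "\<exists>J. (\<forall>k. J k \<in> borel_measurable Unif) \<and> (\<forall>k. AE x in Unif. J k x
      \<le> ennreal (2 * 6400 + 2 * 961600))
      \<and> (\<forall>k. e k = (\<integral>\<^sup>+x. J k x \<partial>Unif))
      \<and> (AE x in Unif. \<exists>e1\<in>?P. \<exists>e2\<in>?P. \<exists>p. p \<longlonglongrightarrow> 0 \<and>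
          eventually (\<lambda>k. J k x \<le> p k + ennreal (5/4 * x\<^sup>2) * e1 k + ennreal (5/4 * (1 - x)\<^sup>2) * e2
              k) sequentially)"
    by (intro exI[of _ J] conjI allI)
qed (use assms in blast)

section \<open>The limit process\<close>

abbreviation Ylim :: "real \<Rightarrow> (nat list \<Rightarrow> real) \<Rightarrow> real" where "Ylim t u \<equiv> Yc u [] t"

text \<open>Joint measurability in time and tree is needed for the induction, since the time passed
  to a subtree is rescaled by the random root.\<close>

lemma Rm_measurable: "(\<lambda>p. Rm (snd p) [] m (fst p)) \<in> borel_measurable (borel \<Otimes>\<^sub>M Tree)"
proof (induction m)
  case 0
  then show ?case by (simp add: Rm_0)
next
  case (Suc m)
  have [measurable]: "(\<lambda>p. snd p []) \<in> borel_measurable (borel \<Otimes>\<^sub>M Tree)"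
    by (rule measurable_compose[OF measurable_snd root_measurable])
  have sub: "(\<lambda>p. subtree 1 (snd p)) \<in> borel \<Otimes>\<^sub>M Tree \<rightarrow>\<^sub>M Tree"
      "(\<lambda>p. subtree 2 (snd p)) \<in> borel \<Otimes>\<^sub>M Tree \<rightarrow>\<^sub>M Tree"
    by (rule measurable_compose[OF measurable_snd subtree_measurable(1)]
             measurable_compose[OF measurable_snd subtree_measurable(3)])+
  have [measurable]: "(\<lambda>p. Qlim (subtree 1 (snd p))) \<in> borel_measurable (borel \<Otimes>\<^sub>M Tree)"
    by (rule measurable_compose[OF sub(1) Qlim_measurable])
  have "(\<lambda>p. (min 1 (fst p / snd p []), subtree 1 (snd p))) \<in> borel \<Otimes>\<^sub>M Tree \<rightarrow>\<^sub>M borel \<Otimes>\<^sub>M Tree"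
    by (rule measurable_Pair[OF _ sub(1)]) measurable
  from measurable_compose[OF this Suc]
  have [measurable]: "(\<lambda>p. Rm (subtree 1 (snd p)) [] m (min 1 (fst p / snd p [])))
      \<in> borel_measurable (borel \<Otimes>\<^sub>M Tree)"
    by simp
  have "(\<lambda>p. (max 0 ((fst p - snd p []) / (1 - snd p [])), subtree 2 (snd p)))
      \<in> borel \<Otimes>\<^sub>M Tree \<rightarrow>\<^sub>M borel \<Otimes>\<^sub>M Tree"
    by (rule measurable_Pair[OF _ sub(2)]) measurable
  from measurable_compose[OF this Suc]
  have [measurable]: "(\<lambda>p. Rm (subtree 2 (snd p)) [] m (max 0 ((fst p - snd p []) / (1
      - snd p [])))) \<in> borel_measurable (borel \<Otimes>\<^sub>M Tree)"
    by simp
  have "(\<lambda>p. Rm (snd p) [] (Suc m) (fst p)) = (\<lambda>p. Ct (fst p) (snd p [])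
      + (if fst p \<ge> snd p [] then snd p [] * Qlim (subtree 1 (snd p)) else 0)
      + (if fst p < snd p [] then snd p [] * Rm (subtree 1 (snd p)) [] m (min 1 (fst p / snd p []))
          else 0)
      + (if fst p \<ge> snd p [] then (1 - snd p []) * Rm (subtree 2 (snd p)) [] m
          (max 0 ((fst p - snd p []) / (1 - snd p []))) else 0))"
    by (simp add: Rm_Suc Cc_subtree Top_def fun_eq_iff)
  also have "\<dots> \<in> borel_measurable (borel \<Otimes>\<^sub>M Tree)" by measurable
  finally show ?case .
qed

lemma Rm_measurable_fixed: "(\<lambda>u. Rm u [] m t) \<in> borel_measurable Tree"
proof -
  have "(\<lambda>u. (t, u)) \<in> Tree \<rightarrow>\<^sub>M borel \<Otimes>\<^sub>M Tree" by measurable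
  from measurable_compose[OF this Rm_measurable] show ?thesis by simp
qed

lemma Ylim_measurable: "Ylim t \<in> borel_measurable Tree"
  unfolding Yc_def[abs_def] by (intro borel_measurable_lim_metric Rm_measurable_fixed)

definition Yinc :: "nat \<Rightarrow> real \<Rightarrow> (nat list \<Rightarrow> real) \<Rightarrow> real" where
  "Yinc m t u = Rm u [] (Suc m) t - Rm u [] m t"

lemma Yinc_measurable: "Yinc m t \<in> borel_measurable Tree"
  unfolding Yinc_def[abs_def] by (intro borel_measurable_diff Rm_measurable_fixed)

lemma Rm_graft:
  assumes "0 < x" "x < 1" "0 \<le> t" "ab \<in> space (Tree \<Otimes>\<^sub>M Tree)"
  shows "Rm (graft x ab) [] (Suc m) t = Ct t x + (if t < x then x * Rm (fst ab) [] m (t / x)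
     else x * Qlim (fst ab) + (1 - x) * Rm (snd ab) [] m ((t - x) / (1 - x)))"
  using assms by (simp add: Rm_Suc Cc_subtree Top_def subtree_graft min_absorb2)

lemma Yinc_0_graft:
  assumes "0 < x" "x < 1" "0 \<le> t" "ab \<in> space (Tree \<Otimes>\<^sub>M Tree)"
  shows "Yinc 0 t (graft x ab) = Ct t x + (if t < x then 0 else x) * Qlim (fst ab)"
  using assms by (simp add: Yinc_def Rm_graft Rm_0)

lemma Yinc_Suc_graft:
  assumes "0 < x" "x < 1" "0 \<le> t" "ab \<in> space (Tree \<Otimes>\<^sub>M Tree)"
  shows "Yinc (Suc m) t (graft x ab) = (if t < x then x * Yinc m (t / x) (fst ab)
     else (1 - x) * Yinc m ((t - x) / (1 - x)) (snd ab))"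
  using assms by (simp add: Yinc_def Rm_graft algebra_simps)

lemma sqn_const_le:
  assumes "prob_space M" "\<bar>c\<bar> \<le> (C::real)"
  shows "sqn M (\<lambda>z. c) \<le> ennreal (C\<^sup>2)"
proof -
  interpret prob_space M by fact
  have "c\<^sup>2 \<le> C\<^sup>2" using assms(2) by (intro iffD1[OF abs_le_square_iff]) simp
  then show ?thesis by (simp add: ennreal_leI)
qed

text \<open>Uniformity in \<open>t\<close> is essential, since the induction moves to a different
  time in the subtree. The constant is \<open>2 * 1600 + 2 * 960000\<close>, from the toll and from
  the cost of the passed left subtree.\<close>

lemma sqn_Yinc:
  assumes "0 \<le> t" "t \<le> 1"
  shows "sqn Tree (Yinc m t) \<le> ennreal (1923200 * (2/3) ^ m)"
  using assms
proof (induction m arbitrary: t)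
  case 0
  have "sqn Tree (Yinc 0 t) \<le> ennreal (2 * 40\<^sup>2 + 2 * (1\<^sup>2 * 960000) + 0 * (2/3))"
  proof (rule sqn_Tree_le[where t = 0])
    fix x :: real assume x: "0 < x" "x < 1"
    have "sqn (Tree \<Otimes>\<^sub>M Tree) (\<lambda>ab. Yinc 0 t (graft x ab)) =
        sqn (Tree \<Otimes>\<^sub>M Tree) (\<lambda>ab. Ct t x + (if t < x then 0 else x) * Qlim (fst ab))"
      using x 0 by (intro sqn_cong Yinc_0_graft)
    also have "\<dots> \<le> ennreal (2 * 40\<^sup>2 + 2 * (1\<^sup>2 * 960000))"
      using x 0 abs_Ct_le[of t x] sqn_Qlim
      by (intro sqn_add_le_real sqn_const_le sqn_cmult_le borel_measurable_times fst_compose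
          Qlim_measurable)
         (auto simp: sqn_fst_snd[OF prob_space_Tree Qlim_measurable])
    finally show "sqn (Tree \<Otimes>\<^sub>M Tree) (\<lambda>ab. Yinc 0 t (graft x ab))
        \<le> ennreal (2 * 40\<^sup>2 + 2 * (1\<^sup>2 * 960000) + 0 * (x\<^sup>2 + (1 - x)\<^sup>2))"
      by simp
  qed (auto intro: Yinc_measurable)
  then show ?case by simp
next
  case (Suc m)
  let ?K = "1923200 * (2/3) ^ m :: real"
  have "sqn Tree (Yinc (Suc m) t) \<le> ennreal (0 + ?K * (2/3))"
  proof (rule sqn_Tree_le[where t = 0])
    fix x :: real assume x: "0 < x" "x < 1"
    have eq: "sqn (Tree \<Otimes>\<^sub>M Tree) (\<lambda>ab. Yinc (Suc m) t (graft x ab)) =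
        sqn (Tree \<Otimes>\<^sub>M Tree) (\<lambda>ab. if t < x then x * Yinc m (t / x) (fst ab)
          else (1 - x) * Yinc m ((t - x) / (1 - x)) (snd ab))"
      using x Suc.prems by (intro sqn_cong Yinc_Suc_graft)
    show "sqn (Tree \<Otimes>\<^sub>M Tree) (\<lambda>ab. Yinc (Suc m) t (graft x ab))
        \<le> ennreal (0 + ?K * (x\<^sup>2 + (1 - x)\<^sup>2))"
    proof (cases "t < x")
      case True
      have IH: "sqn Tree (Yinc m (t / x)) \<le> ennreal ?K" using x Suc.prems True
          by (intro Suc.IH) auto
      have "sqn (Tree \<Otimes>\<^sub>M Tree) (\<lambda>ab. x * Yinc m (t / x) (fst ab)) \<le> ennreal (x\<^sup>2 * ?K)"
        using x IH by (intro sqn_cmult_le fst_compose Yinc_measurable)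
          (auto simp: sqn_fst_snd[OF prob_space_Tree Yinc_measurable])
      also have "\<dots> \<le> ennreal (0 + ?K * (x\<^sup>2 + (1 - x)\<^sup>2))"
        by (intro ennreal_leI) (simp add: algebra_simps)
      finally show ?thesis unfolding eq using True by simp
    next
      case False
      have IH: "sqn Tree (Yinc m ((t - x) / (1 - x))) \<le> ennreal ?K" using x Suc.prems False
          by (intro Suc.IH) auto
      have "sqn (Tree \<Otimes>\<^sub>M Tree) (\<lambda>ab. (1 - x) * Yinc m ((t - x) / (1 - x)) (snd ab))
          \<le> ennreal ((1 - x)\<^sup>2 * ?K)"
        using x IH by (intro sqn_cmult_le snd_compose Yinc_measurable)
          (auto simp: sqn_fst_snd[OF prob_space_Tree Yinc_measurable])
      also have "\<dots> \<le> ennreal (0 + ?K * (x\<^sup>2 + (1 - x)\<^sup>2))"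
        by (intro ennreal_leI) (simp add: algebra_simps)
      finally show ?thesis unfolding eq using False by simp
    qed
  qed (auto intro: Yinc_measurable)
  then show ?case by (simp add: mult.assoc)
qed

text \<open>The constant is \<open>600 * 1923200\<close>, from
  \<open>geometric_L2_increments\<close>.\<close>

lemma assumes "0 \<le> t" "t \<le> 1"
  shows Rm_convergent: "AE u in Tree. convergent (\<lambda>m. Rm u [] m t)"
    and sqn_Ylim: "sqn Tree (Ylim t) \<le> ennreal 1153920000"
proof -
  interpret Tree: prob_space Tree by simp
  note * = Tree.geometric_L2_increments[of "\<lambda>m u. Rm u [] m t" 1923200, OF Rm_measurable_fixed Rm_0 _ sqn_Yinc[OF assms, unfolded Yinc_def[abs_def]]]
  show "AE u in Tree. convergent (\<lambda>m. Rm u [] m t)" using *(1) by simp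
  show "sqn Tree (Ylim t) \<le> ennreal 1153920000" using *(2) by (simp add: Yc_def)
qed

lemma sub_interval:
  fixes x t :: real
  assumes "0 < x" "x < 1"
  shows "0 \<le> t \<Longrightarrow> t < x \<Longrightarrow> 0 \<le> t / x \<and> t / x \<le> 1"
    "x \<le> t \<Longrightarrow> t \<le> 1 \<Longrightarrow> 0 \<le> (t - x) / (1 - x) \<and> (t - x) / (1 - x) \<le> 1"
  using assms by auto

lemma Ylim_graft:
  assumes x: "0 < x" "x < 1" and t: "0 \<le> t" "t \<le> 1"
  shows "AE ab in Tree \<Otimes>\<^sub>M Tree. Ylim t (graft x ab)
      = Ct t x + (if t < x then x * Ylim (t / x) (fst ab)
     else x * Qlim (fst ab) + (1 - x) * Ylim ((t - x) / (1 - x)) (snd ab))"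
proof -
  have 1: "AE ab in Tree \<Otimes>\<^sub>M Tree. t < x \<longrightarrow> (\<lambda>m. Rm (fst ab) [] m (t / x)) \<longlonglongrightarrow> Ylim (t / x) (fst ab)"
  proof (cases "t < x")
    case True
    with sub_interval(1)[OF x t(1)] have "0 \<le> t / x" "t / x \<le> 1" by auto
    from AE_Tree_pair(1)[OF Rm_convergent[OF this]] show ?thesis
      by eventually_elim (simp add: convergent_LIMSEQ_iff Yc_def)
  qed simp
  have 2: "AE ab in Tree \<Otimes>\<^sub>M Tree. \<not> t < x \<longrightarrow> (\<lambda>m. Rm (snd ab) [] m ((t - x) / (1 - x))) \<longlonglongrightarrow> Ylim ((t
      - x) / (1 - x)) (snd ab)"
  proof (cases "t < x")
    case False
    with sub_interval(2)[OF x _ t(2)] have "0 \<le> (t - x) / (1 - x)" "(t - x) / (1 - x) \<le> 1" by auto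
    from AE_Tree_pair(2)[OF Rm_convergent[OF this]] show ?thesis
      by eventually_elim (simp add: convergent_LIMSEQ_iff Yc_def)
  qed simp
  show ?thesis using 1 2 AE_space
  proof eventually_elim
    case (elim ab)
    have "(\<lambda>m. Rm (graft x ab) [] (Suc m) t) \<longlonglongrightarrow> Ct t x + (if t < x then x * Ylim (t / x) (fst ab)
     else x * Qlim (fst ab) + (1 - x) * Ylim ((t - x) / (1 - x)) (snd ab))"
      using elim(1,2) unfolding Rm_graft[OF x t(1) elim(3)]
      by (cases "t < x") (auto intro!: tendsto_intros)
    then have "(\<lambda>m. Rm (graft x ab) [] m t) \<longlonglongrightarrow> Ct t x + (if t < x then x * Ylim (t / x) (fst ab)
     else x * Qlim (fst ab) + (1 - x) * Ylim ((t - x) / (1 - x)) (snd ab))"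
      by (rule LIMSEQ_imp_Suc)
    then show ?case unfolding Yc_def[of "graft x ab"] by (rule limI)
  qed
qed

text \<open>Again a bound for each root value, to dominate the integrands; the constant is a
  rounded-up version of what both branches give.\<close>

lemma sqn_Ylim_graft:
  assumes x: "0 < x" "x < 1" and t: "0 \<le> t" "t \<le> 1"
  shows "sqn (Tree \<Otimes>\<^sub>M Tree) (\<lambda>ab. Ylim t (graft x ab)) \<le> ennreal 10000000000"
proof -
  note fs = sqn_fst_snd[OF prob_space_Tree Ylim_measurable]
      sqn_fst_snd[OF prob_space_Tree Qlim_measurable]
  note eq = sqn_cong_AE[OF Ylim_graft[OF assms]]
  have c: "\<bar>Ct t x\<bar> \<le> 40" using x t by (intro abs_Ct_le) auto
  show ?thesis
  proof (cases "t < x")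
    case True
    have "sqn (Tree \<Otimes>\<^sub>M Tree) (\<lambda>ab. Ct t x + x * Ylim (t / x) (fst ab))
        \<le> ennreal (2 * 40\<^sup>2 + 2 * (1\<^sup>2 * 1153920000))"
      using x t c sub_interval(1)[OF x t(1) True]
      by (intro sqn_add_le_real sqn_const_le sqn_cmult_le borel_measurable_times fst_compose
          Ylim_measurable)
         (auto simp: fs intro!: sqn_Ylim[simplified])
    also have "\<dots> \<le> ennreal 10000000000" by (intro ennreal_leI) simp
    finally show ?thesis unfolding eq using True by simp
  next
    case False
    have "sqn (Tree \<Otimes>\<^sub>M Tree) (\<lambda>ab. Ct t x + (x * Qlim (fst ab) + (1 - x) * Ylim ((t - x) / (1
        - x)) (snd ab)))
       \<le> ennreal (2 * 40\<^sup>2 + 2 * (2 * (1\<^sup>2 * 960000) + 2 * (1\<^sup>2 * 1153920000)))"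
      using x t c sub_interval(2)[OF x _ t(2)] False sqn_Qlim
      by (intro sqn_add_le_real sqn_const_le sqn_cmult_le borel_measurable_times
          borel_measurable_add
           fst_compose snd_compose Ylim_measurable Qlim_measurable)
         (auto simp: fs intro!: sqn_Ylim[simplified])
    also have "\<dots> \<le> ennreal 10000000000" by (intro ennreal_leI) simp
    finally show ?thesis unfolding eq using False by simp
  qed
qed

section \<open>Convergence of the process\<close>

text \<open>Centring is available only on the diagonal \<open>l = n\<close>. Here just one subtree
  carries a process term, so it is separated from the toll and the passed cost by the weighted
  inequality, whose factor 5/4 the contraction can afford. The constants are
  \<open>64000 = 5 * (2 * 1600 + 2 * 4800)\<close> and \<open>480000 = 5/4 * 384000\<close>.\<close>

lemma sqn_yd_graft_step:
  assumes n: "2 \<le> n" "l \<le> n" and x: "0 < x" "x < 1"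
    and IH: "\<And>m l'. m < n \<Longrightarrow> l' \<le> m \<Longrightarrow> sqn Tree (yd m l') \<le> ennreal 384000"
  shows "sqn (Tree \<Otimes>\<^sub>M Tree) (\<lambda>ab. yd n l (graft x ab))
      \<le> ennreal (64000 + 480000 * (x\<^sup>2 + (1 - x)\<^sup>2))"
proof -
  define i where "i = nat \<lceil>real n * x\<rceil>"
  have "1 \<le> n" using n by simp
  note ii = split_index[OF x this i_def]
  have c: "\<bar>Cd n l i\<bar> \<le> 40" using ii n by (intro abs_Cd_le) auto
  have a: "\<bar>real (i - 1) / real n\<bar> \<le> x" "\<bar>real (n - i) / real n\<bar> \<le> 1 - x"
    using ii(3,4) by (simp_all only: abs_of_nonneg divide_nonneg_nonneg of_nat_0_le_iff)
  show ?thesis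
  proof (cases "l < i")
    case True
    have y: "yd (i - 1) l \<in> borel_measurable Tree" using True by (intro yd_measurable) auto
    have "sqn (Tree \<Otimes>\<^sub>M Tree) (\<lambda>ab. yd n l (graft x ab)) =
        sqn (Tree \<Otimes>\<^sub>M Tree) (\<lambda>ab. Cd n l i + (real (i - 1) / real n) * yd (i - 1) l (fst ab))"
      by (rule sqn_cong) (use yd_graft[OF n x _ i_def] True in simp)
    also have "\<dots> \<le> ennreal (5 * 40\<^sup>2) + ennreal (5/4 * (real (i - 1) / real n)\<^sup>2)
        * sqn (Tree \<Otimes>\<^sub>M Tree) (\<lambda>ab. yd (i - 1) l (fst ab))"
      using c by (intro sqn_add_le_weighted sqn_const_le fst_compose y) auto
    also have "\<dots> \<le> ennreal (5 * 40\<^sup>2) + ennreal (5/4 * x\<^sup>2) * ennreal 384000"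
    proof (rule add_mono[OF order_refl mult_mono[OF ennreal_leI]])
      show "5/4 * (real (i - 1) / real n)\<^sup>2 \<le> 5/4 * x\<^sup>2"
        using a(1) x by (simp add: abs_le_square_iff[symmetric] del: power_divide)
      show "sqn (Tree \<Otimes>\<^sub>M Tree) (\<lambda>ab. yd (i - 1) l (fst ab)) \<le> ennreal 384000"
        unfolding sqn_fst_snd(1)[OF prob_space_Tree y] using True ii by (intro IH) auto
    qed auto
    also have "\<dots> = ennreal (5 * 40\<^sup>2 + 5/4 * x\<^sup>2 * 384000)"
      by (subst ennreal_mult[symmetric], simp, simp, subst ennreal_plus[symmetric]) auto
    also have "\<dots> \<le> ennreal (64000 + 480000 * (x\<^sup>2 + (1 - x)\<^sup>2))"
      by (intro ennreal_leI) simp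
    finally show ?thesis .
  next
    case False
    have y: "yd (n - i) (l - i) \<in> borel_measurable Tree" using n by (intro yd_measurable) auto
    have q: "sqn (Tree \<Otimes>\<^sub>M Tree) (\<lambda>ab. (real (i - 1) / real n) * yd (i - 1) (i - 1) (fst ab))
        \<le> ennreal (1\<^sup>2 * 4800)"
    proof (rule sqn_cmult_le[OF fst_compose[OF yd_diag_measurable]])
      show "sqn (Tree \<Otimes>\<^sub>M Tree) (\<lambda>ab. yd (i - 1) (i - 1) (fst ab)) \<le> ennreal 4800"
        unfolding sqn_fst_snd(1)[OF prob_space_Tree yd_diag_measurable] using quicksort_moments
            by blast
      show "\<bar>real (i - 1) / real n\<bar> \<le> 1" using a(1) x by linarith
    qed simp
    have "sqn (Tree \<Otimes>\<^sub>M Tree) (\<lambda>ab. yd n l (graft x ab)) =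
        sqn (Tree \<Otimes>\<^sub>M Tree) (\<lambda>ab. (Cd n l i + (real (i - 1) / real n) * yd (i - 1) (i - 1) (fst ab))
          + (real (n - i) / real n) * yd (n - i) (l - i) (snd ab))"
      by (rule sqn_cong) (use yd_graft[OF n x _ i_def] False in simp)
    also have "\<dots> \<le> ennreal (5 * (2 * 40\<^sup>2 + 2 * (1\<^sup>2 * 4800))) + ennreal (5/4 * (real (n - i)
        / real n)\<^sup>2) * sqn (Tree \<Otimes>\<^sub>M Tree) (\<lambda>ab. yd (n - i) (l - i) (snd ab))"
      using c by (intro sqn_add_le_weighted sqn_add_le_real q sqn_const_le borel_measurable_add
          borel_measurable_times
        fst_compose yd_diag_measurable snd_compose y) auto
    also have "\<dots> \<le> ennreal (5 * (2 * 40\<^sup>2 + 2 * (1\<^sup>2 * 4800))) + ennreal (5/4 * (1 - x)\<^sup>2)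
        * ennreal 384000"
    proof (rule add_mono[OF order_refl mult_mono[OF ennreal_leI]])
      show "5/4 * (real (n - i) / real n)\<^sup>2 \<le> 5/4 * (1 - x)\<^sup>2"
        using a(2) x by (simp add: abs_le_square_iff[symmetric] del: power_divide)
      show "sqn (Tree \<Otimes>\<^sub>M Tree) (\<lambda>ab. yd (n - i) (l - i) (snd ab)) \<le> ennreal 384000"
        unfolding sqn_fst_snd(2)[OF prob_space_Tree y] using n ii by (intro IH) auto
    qed auto
    also have "\<dots> = ennreal (5 * (2 * 40\<^sup>2 + 2 * (1\<^sup>2 * 4800)) + 5/4 * (1 - x)\<^sup>2 * 384000)"
      by (subst ennreal_mult[symmetric], simp, simp, subst ennreal_plus[symmetric]) auto
    also have "\<dots> \<le> ennreal (64000 + 480000 * (x\<^sup>2 + (1 - x)\<^sup>2))"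
      by (intro ennreal_leI) simp
    finally show ?thesis .
  qed
qed

text \<open>The bound \<open>384000\<close> is the fixed point of \<open>K = 64000 + 5/4 * 2/3 * K\<close>.\<close>

lemma sqn_yd: "l \<le> n \<Longrightarrow> sqn Tree (yd n l) \<le> ennreal 384000"
proof (induction n arbitrary: l rule: less_induct)
  case (less n)
  show ?case
  proof (cases "n < 2")
    case False
    have "sqn Tree (yd n l) \<le> ennreal (64000 + 480000 * (2/3))"
      using False less.prems
      by (intro sqn_Tree_le[where t = 0] yd_measurable sqn_yd_graft_step less.IH) auto
    then show ?thesis by simp
  qed (simp add: yd_less2 sqn_def)
qed

text \<open>The dominating constant for the discrete process:
  \<open>544000 = 64000 + 480000\<close>.\<close>

lemma sqn_yd_graft:
  assumes "0 < x" "x < 1" "l \<le> n"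
  shows "sqn (Tree \<Otimes>\<^sub>M Tree) (\<lambda>ab. yd n l (graft x ab)) \<le> ennreal 544000"
proof (cases "n < 2")
  case False
  have "sqn (Tree \<Otimes>\<^sub>M Tree) (\<lambda>ab. yd n l (graft x ab))
      \<le> ennreal (64000 + 480000 * (x\<^sup>2 + (1 - x)\<^sup>2))"
    using False assms by (intro sqn_yd_graft_step sqn_yd) auto
  also have "\<dots> \<le> ennreal 544000" using squares_le_1[of x] assms by (intro ennreal_leI) auto
  finally show ?thesis .
qed (simp add: yd_less2)

text \<open>The difference consists of the toll error, the rounding of the weight, and
  \<open>x\<close> times the difference in the left subtree. Only the last term is not small in
  itself.\<close>

lemma sqn_diff_step_left:
  assumes n: "2 \<le> n" "l \<le> n" and x: "0 < x" "x < 1" and i: "i = nat \<lceil>real n * x\<rceil>"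
    and t: "0 \<le> t" "t < x" and li: "l < i"
  shows "sqn (Tree \<Otimes>\<^sub>M Tree) (\<lambda>ab. yd n l (graft x ab) - Ylim t (graft x ab)) \<le>
    ennreal (5 * (2 * (Cd n l i - Ct t x)\<^sup>2 + 2 * ((1 / real n)\<^sup>2 * 384000)))
    + ennreal (5/4 * x\<^sup>2) * sqn Tree (\<lambda>u. yd (i - 1) l u - Ylim (t / x) u)"
proof -
  have "1 \<le> n" using n by simp
  note ii = split_index[OF x this i]
  have t1: "t \<le> 1" using t x by simp
  have y: "yd (i - 1) l \<in> borel_measurable Tree" using li by (intro yd_measurable) auto
  have d: "(\<lambda>u. yd (i - 1) l u - Ylim (t / x) u) \<in> borel_measurable Tree"
    by (intro borel_measurable_diff y Ylim_measurable)
  have "sqn (Tree \<Otimes>\<^sub>M Tree) (\<lambda>ab. yd n l (graft x ab) - Ylim t (graft x ab)) =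
      sqn (Tree \<Otimes>\<^sub>M Tree) (\<lambda>ab.
          ((Cd n l i - Ct t x) + (real (i - 1) / real n - x) * yd (i - 1) l (fst ab))
        + x * (yd (i - 1) l (fst ab) - Ylim (t / x) (fst ab)))"
  proof (rule sqn_cong_AE, use Ylim_graft[OF x t(1) t1] AE_space in eventually_elim)
    case (elim ab)
    show ?case unfolding elim(1) yd_graft[OF n x elim(2) i] using li t by (simp add: algebra_simps)
  qed
  also have "\<dots> \<le> ennreal (5 * (2 * (Cd n l i - Ct t x)\<^sup>2 + 2 * ((1 / real n)\<^sup>2 * 384000)))
    + ennreal (5/4 * x\<^sup>2) * sqn (Tree \<Otimes>\<^sub>M Tree) (\<lambda>ab. yd (i - 1) l (fst ab) - Ylim (t / x)
        (fst ab))"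
  proof (rule sqn_add_le_weighted)
    have "sqn (Tree \<Otimes>\<^sub>M Tree) (\<lambda>ab. yd (i - 1) l (fst ab)) \<le> ennreal 384000"
      unfolding sqn_fst_snd(1)[OF prob_space_Tree y] using li by (intro sqn_yd) auto
    moreover have "sqn (Tree \<Otimes>\<^sub>M Tree) (\<lambda>ab. Cd n l i - Ct t x) \<le> ennreal ((Cd n l i - Ct t x)\<^sup>2)"
      by (simp add: prob_space.sqn_const[OF prob_space_Tree_pair])
    ultimately show "sqn (Tree \<Otimes>\<^sub>M Tree) (\<lambda>ab. (Cd n l i - Ct t x) + (real (i - 1) / real n - x)
        * yd (i - 1) l (fst ab))
        \<le> ennreal (2 * (Cd n l i - Ct t x)\<^sup>2 + 2 * ((1 / real n)\<^sup>2 * 384000))"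
      using ii(5) by (intro sqn_add_le_real sqn_cmult_le fst_compose y borel_measurable_times) auto
  qed (use fst_compose[OF y] fst_compose[OF d] in auto)
  finally show ?thesis unfolding sqn_fst_snd(1)[OF prob_space_Tree d] .
qed

text \<open>The passed left subtree contributes the difference \<open>F\<close> of Quicksort costs.
  Its error \<open>r\<close> is already known to vanish along growing sizes, so it is counted among
  the small terms and the right subtree alone enters the contraction.\<close>

lemma sqn_diff_step_right:
  assumes n: "2 \<le> n" "l \<le> n" and x: "0 < x" "x < 1" and i: "i = nat \<lceil>real n * x\<rceil>"
    and t: "x < t" "t \<le> 1" and li: "i \<le> l"
    and r: "sqn Tree (\<lambda>u. yd (i - 1) (i - 1) u - Qlim u) \<le> ennreal r" "0 \<le> r"
  shows "sqn (Tree \<Otimes>\<^sub>M Tree) (\<lambda>ab. yd n l (graft x ab) - Ylim t (graft x ab)) \<le>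
    ennreal (5 * (2 * (2 * (Cd n l i - Ct t x)\<^sup>2 + 2 * (5 * ((1 / real n)\<^sup>2 * 4800) + 5/4 * x\<^sup>2 * r))
      + 2 * ((1 / real n)\<^sup>2 * 384000)))
    + ennreal (5/4 * (1 - x)\<^sup>2) * sqn Tree (\<lambda>u. yd (n - i) (l - i) u - Ylim ((t - x) / (1 - x)) u)"
proof -
  have "1 \<le> n" using n by simp
  note ii = split_index[OF x this i]
  have t0: "0 \<le> t" using t x by simp
  have y: "yd (n - i) (l - i) \<in> borel_measurable Tree" using n by (intro yd_measurable) auto
  have d: "(\<lambda>u. yd (n - i) (l - i) u - Ylim ((t - x) / (1 - x)) u) \<in> borel_measurable Tree"
    by (intro borel_measurable_diff y Ylim_measurable)
  define F where "F u = real (i - 1) / real n * yd (i - 1) (i - 1) u - x * Qlim u" for u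
  have F: "F \<in> borel_measurable Tree"
    unfolding F_def[abs_def] by (intro borel_measurable_diff borel_measurable_times measurable_const
        yd_diag_measurable Qlim_measurable) auto
  have "sqn Tree F \<le> ennreal (5 * ((1 / real n)\<^sup>2 * 4800)) + ennreal (5/4 * x\<^sup>2)
      * sqn Tree (\<lambda>u. yd (i - 1) (i - 1) u - Qlim u)"
    unfolding F_def using quicksort_moments ii(5)
    by (intro sqn_scaled_diff_le yd_diag_measurable Qlim_measurable) auto
  also have "\<dots> \<le> ennreal (5 * ((1 / real n)\<^sup>2 * 4800)) + ennreal (5/4 * x\<^sup>2) * ennreal r"
    by (intro add_mono mult_left_mono r) auto
  also have "\<dots> = ennreal (5 * ((1 / real n)\<^sup>2 * 4800) + 5/4 * x\<^sup>2 * r)"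
    using r by (subst ennreal_mult[symmetric], simp, simp, subst ennreal_plus[symmetric]) auto
  finally have sF: "sqn (Tree \<Otimes>\<^sub>M Tree) (\<lambda>ab. F (fst ab))
      \<le> ennreal (5 * ((1 / real n)\<^sup>2 * 4800) + 5/4 * x\<^sup>2 * r)"
    unfolding sqn_fst_snd(1)[OF prob_space_Tree F] .
  have "sqn (Tree \<Otimes>\<^sub>M Tree) (\<lambda>ab. yd n l (graft x ab) - Ylim t (graft x ab)) =
      sqn (Tree \<Otimes>\<^sub>M Tree) (\<lambda>ab.
          (((Cd n l i - Ct t x) + F (fst ab)) + (real (n - i) / real n - (1 - x)) * yd (n - i)
          (l - i) (snd ab))
        + (1 - x) * (yd (n - i) (l - i) (snd ab) - Ylim ((t - x) / (1 - x)) (snd ab)))"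
  proof (rule sqn_cong_AE, use Ylim_graft[OF x t0 t(2)] AE_space in eventually_elim)
    case (elim ab)
    have a: "\<not> l < i" "\<not> t < x" using li t by auto
    show ?case unfolding elim(1) yd_graft[OF n x elim(2) i] F_def using a
      by (simp only: if_False) (simp add: right_diff_distrib left_diff_distrib)
  qed
  also have "\<dots> \<le> ennreal (5 * (2 * (2 * (Cd n l i - Ct t x)\<^sup>2 + 2 * (5 * ((1 / real n)\<^sup>2 * 4800)
      + 5/4 * x\<^sup>2 * r))
      + 2 * ((1 / real n)\<^sup>2 * 384000)))
    + ennreal (5/4 * (1 - x)\<^sup>2) * sqn (Tree \<Otimes>\<^sub>M Tree) (\<lambda>ab. yd (n - i) (l - i) (snd ab) - Ylim
        ((t - x) / (1 - x)) (snd ab))"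
  proof (rule sqn_add_le_weighted)
    have "sqn (Tree \<Otimes>\<^sub>M Tree) (\<lambda>ab. yd (n - i) (l - i) (snd ab)) \<le> ennreal 384000"
      unfolding sqn_fst_snd(2)[OF prob_space_Tree y] using n by (intro sqn_yd) auto
    moreover have "sqn (Tree \<Otimes>\<^sub>M Tree) (\<lambda>ab. Cd n l i - Ct t x) \<le> ennreal ((Cd n l i - Ct t x)\<^sup>2)"
      by (simp add: prob_space.sqn_const[OF prob_space_Tree_pair])
    ultimately show "sqn (Tree \<Otimes>\<^sub>M Tree) (\<lambda>ab. ((Cd n l i - Ct t x) + F (fst ab)) + (real (n - i)
        / real n - (1 - x)) * yd (n - i) (l - i) (snd ab))
        \<le> ennreal (2 * (2 * (Cd n l i - Ct t x)\<^sup>2 + 2 * (5 * ((1 / real n)\<^sup>2 * 4800) + 5/4 * x\<^sup>2 * r))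
      + 2 * ((1 / real n)\<^sup>2 * 384000))"
      using ii(6) r sF by (intro sqn_add_le_real sqn_cmult_le fst_compose snd_compose y F
          borel_measurable_times borel_measurable_add) auto
  qed (use fst_compose[OF F] snd_compose[OF y] snd_compose[OF d] r in auto)
  finally show ?thesis unfolding sqn_fst_snd(2)[OF prob_space_Tree d] .
qed

text \<open>The contraction is applied to all \<open>t\<close> and all index sequences at once, because
  passing to a subtree changes both.\<close>

lemma process_L2_limit:
  assumes "filterlim N at_top sequentially" "\<And>k. L k \<le> N k"
    "(\<lambda>k. real (L k) / real (N k)) \<longlonglongrightarrow> t" "0 < t" "t \<le> 1"
  shows "(\<lambda>k. sqn Tree (\<lambda>u. yd (N k) (L k) u - Ylim t u)) \<longlonglongrightarrow> 0"
proof -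
  define P where "P = {\<lambda>k. sqn Tree (\<lambda>u. yd (N k) (L k) u
      - Ylim t u) |N L t. filterlim N at_top sequentially
      \<and> (\<forall>k. L k \<le> N k) \<and> (\<lambda>k. real (L k) / real (N k)) \<longlonglongrightarrow> t \<and> 0 < t \<and> t \<le> 1}"
  have PI: "(\<lambda>k. sqn Tree (\<lambda>u. yd (N k) (L k) u - Ylim t u)) \<in> P"
    if "filterlim N at_top sequentially" "\<And>k. L k \<le> N k"
    "(\<lambda>k. real (L k) / real (N k)) \<longlonglongrightarrow> t" "0 < t" "t \<le> 1" for N L t
    unfolding P_def mem_Collect_eq using that by (intro exI[of _ N] exI[of _ L] exI[of _ t]) auto
  have PE: "\<exists>N L t. e
      = (\<lambda>k. sqn Tree (\<lambda>u. yd (N k) (L k) u - Ylim t u)) \<and> filterlim N at_top sequentially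
      \<and> (\<forall>k. L k \<le> N k) \<and> (\<lambda>k. real (L k) / real (N k)) \<longlonglongrightarrow> t \<and> 0 < t \<and> t \<le> 1" if "e \<in> P" for e
    using that unfolding P_def mem_Collect_eq .
  show ?thesis
  proof (rule contraction[where P = P and B = "2 * 384000 + 2 * 1153920000"
      and B' = "2 * 544000 + 2 * 10000000000"])
    fix e k assume "e \<in> P"
    from PE[OF this] obtain N L t where e: "e = (\<lambda>k. sqn Tree (\<lambda>u. yd (N k) (L k) u - Ylim t u))"
      and "\<And>k. L k \<le> N k" "0 < t" "t \<le> 1" by blast
    then show "e k \<le> ennreal (2 * 384000 + 2 * 1153920000)"
      unfolding e by (intro sqn_diff_le_real yd_measurable Ylim_measurable sqn_yd sqn_Ylim) auto
  next
    fix e assume eP: "e \<in> P"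
    from PE[OF this] obtain N L t where e: "e = (\<lambda>k. sqn Tree (\<lambda>u. yd (N k) (L k) u - Ylim t u))"
      and N: "filterlim N at_top sequentially" and LN: "\<And>k. L k \<le> N k"
      and Lt: "(\<lambda>k. real (L k) / real (N k)) \<longlonglongrightarrow> t" and t: "0 < t" "t \<le> 1" by blast
    define J where "J k x = sqn (Tree \<Otimes>\<^sub>M Tree) (\<lambda>ab. yd (N k) (L k) (graft x ab)
        - Ylim t (graft x ab))" for k x
    have m: "(\<lambda>u. yd (N k) (L k) u - Ylim t u) \<in> borel_measurable Tree" for k
      by (intro borel_measurable_diff yd_measurable Ylim_measurable LN)
    have "J k \<in> borel_measurable Unif" "e k = (\<integral>\<^sup>+x. J k x \<partial>Unif)" for k
      unfolding J_def[abs_def] e using sqn_graft[OF m, of k] by auto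
    moreover have "AE x in Unif. J k x \<le> ennreal (2 * 544000 + 2 * 10000000000)" for k
      using AE_Unif[of 0]
    proof eventually_elim
      case (elim x)
      then show ?case unfolding J_def using t LN
        by (intro sqn_diff_le_real graft_compose yd_measurable Ylim_measurable sqn_yd_graft
            sqn_Ylim_graft) auto
    qed
    moreover have "AE x in Unif. \<exists>e1\<in>P. \<exists>e2\<in>P. \<exists>p. p \<longlonglongrightarrow> 0 \<and>
            eventually (\<lambda>k. J k x \<le> p k + ennreal (5/4 * x\<^sup>2) * e1 k + ennreal (5/4 * (1 - x)\<^sup>2) *
                e2 k) sequentially"
      using AE_Unif[of t]
    proof eventually_elim
      case (elim x)
      then have x: "0 < x" "x < 1" and xt: "x \<noteq> t" by auto
      define i where "i k = nat \<lceil>real (N k) * x\<rceil>" for k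
      note S = split_index_limits[OF N x i_def]
      have i_le: "eventually (\<lambda>k. 1 \<le> i k \<and> i k \<le> N k) sequentially"
        using S(6) by eventually_elim (use split_index(1,2)[OF x _ i_def] in auto)
      have Cd: "(\<lambda>k. Cd (N k) (L k) (i k)) \<longlonglongrightarrow> Ct t x"
        using x xt t by (intro Cd_tendsto[OF N Lt LN S(1) i_le]) auto
      from xt consider "t < x" | "x < t" by linarith
      then show ?case
      proof cases
        case 1
        have ev: "eventually (\<lambda>k. L k < i k) sequentially"
          using order_tendstoD(1)[OF tendsto_diff[OF S(1) Lt], of 0] 1
          by (auto elim!: eventually_mono simp: diff_divide_distrib[symmetric] zero_less_divide_iff)
        \<comment> \<open>Membership in \<open>P\<close> demands a rank at most the size for every
          \<open>k\<close>, but \<open>L k < i k\<close> holds only eventually; the minimum repairs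
          the finitely many exceptions.\<close>
        let ?e1 = "\<lambda>k. sqn Tree (\<lambda>u. yd (i k - 1) (min (L k) (i k - 1)) u - Ylim (t / x) u)"
        let ?p = "\<lambda>k. 5 * (2 * (Cd (N k) (L k) (i k) - Ct t x)\<^sup>2 + 2 * ((1 / real (N k))\<^sup>2
            * 384000))"
        have "?e1 \<in> P"
        proof (rule PI[OF S(4)])
          have "(\<lambda>k. (real (L k) / real (N k)) / (real (i k - 1) / real (N k))) \<longlonglongrightarrow> t / x"
            using x by (intro tendsto_divide Lt S(2)) auto
          moreover have "eventually (\<lambda>k. (real (L k) / real (N k)) / (real (i k - 1) / real (N k)) =
              real (min (L k) (i k - 1)) / real (i k - 1)) sequentially"
            using ev S(6) by eventually_elim auto
          ultimately show "(\<lambda>k. real (min (L k) (i k - 1)) / real (i k - 1)) \<longlonglongrightarrow> t / x"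
            by (rule Lim_transform_eventually)
        qed (use x t 1 in auto)
        moreover have "(\<lambda>k. ennreal (?p k)) \<longlonglongrightarrow> 0"
        proof -
          have "?p \<longlonglongrightarrow> 5 * (2 * (Ct t x - Ct t x)\<^sup>2 + 2 * (0\<^sup>2 * 384000))"
            by (intro tendsto_intros Cd S(7))
          then have "?p \<longlonglongrightarrow> 0" by simp
          from tendsto_ennrealI[OF this] show ?thesis by simp
        qed
        \<comment> \<open>The right subtree carries no process term here, so \<open>e\<close> itself
          fills its place in the form required by the contraction; this only enlarges the
          bound.\<close>
        moreover have "eventually (\<lambda>k. J k x \<le> ennreal (?p k) + ennreal (5/4 * x\<^sup>2) * ?e1 k
            + ennreal (5/4 * (1 - x)\<^sup>2) * e k) sequentially"
          using ev S(6)
        proof eventually_elim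
          case (elim k)
          have "min (L k) (i k - 1) = L k" using elim by simp
          then have "J k x \<le> ennreal (?p k) + ennreal (5/4 * x\<^sup>2) * ?e1 k"
            unfolding J_def using sqn_diff_step_left[OF elim(2) LN x i_def _ 1 elim(1)] t by simp
          then show ?case by (rule order_trans) simp
        qed
        ultimately show ?thesis using eP
          by (intro bexI[of _ ?e1] bexI[of _ e] exI[of _ "\<lambda>k. ennreal (?p k)"] conjI)
      next
        case 2
        have ev: "eventually (\<lambda>k. i k < L k) sequentially"
          using order_tendstoD(1)[OF tendsto_diff[OF Lt S(1)], of 0] 2
          by (auto elim!: eventually_mono simp: diff_divide_distrib[symmetric] zero_less_divide_iff)
        \<comment> \<open>Taken as a real number so that the Quicksort error becomes a summand of
          the real null sequence \<open>?p\<close>.\<close>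
        define r where "r m = enn2real (sqn Tree (\<lambda>u. yd m m u - Qlim u))" for m
        have r: "sqn Tree (\<lambda>u. yd m m u - Qlim u) = ennreal (r m)" for m
        proof -
          have "sqn Tree (\<lambda>u. yd m m u - Qlim u) \<le> ennreal (2 * 4800 + 2 * 960000)"
            using quicksort_moments by (intro sqn_diff_le_real yd_diag_measurable Qlim_measurable
                sqn_Qlim) auto
          from le_less_trans[OF this ennreal_less_top] show ?thesis by (simp add: r_def)
        qed
        have r0: "(\<lambda>k. r (i k - 1)) \<longlonglongrightarrow> 0"
          using quicksort_L2_limit[OF S(4)] unfolding r
          by (intro tendsto_ennrealD) (auto simp: r_def)
        let ?e2 = "\<lambda>k. sqn Tree (\<lambda>u. yd (N k - i k) (L k - i k) u - Ylim ((t - x) / (1 - x)) u)"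
        let ?p = "\<lambda>k. 5 * (2 * (2 * (Cd (N k) (L k) (i k) - Ct t x)\<^sup>2
           + 2 * (5 * ((1 / real (N k))\<^sup>2 * 4800) + 5/4 * x\<^sup>2 * r (i k - 1)))
           + 2 * ((1 / real (N k))\<^sup>2 * 384000))"
        have "?e2 \<in> P"
        proof (rule PI[OF S(5)])
          have "(\<lambda>k. (real (L k) / real (N k) - real (i k) / real (N k)) / (real (N k - i k)
              / real (N k)))
              \<longlonglongrightarrow> (t - x) / (1 - x)"
            using x by (intro tendsto_divide tendsto_diff Lt S(1) S(3)) auto
          moreover have "eventually (\<lambda>k. (real (L k) / real (N k) - real (i k) / real (N k))
              / (real (N k - i k) / real (N k)) =
              real (L k - i k) / real (N k - i k)) sequentially"
            using ev S(6) by eventually_elim (auto simp: diff_divide_distrib[symmetric] of_nat_diff)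
          ultimately show "(\<lambda>k. real (L k - i k) / real (N k - i k)) \<longlonglongrightarrow> (t - x) / (1 - x)"
            by (rule Lim_transform_eventually)
        qed (use x t 2 LN in \<open>auto intro: diff_le_mono\<close>)
        moreover have "(\<lambda>k. ennreal (?p k)) \<longlonglongrightarrow> 0"
        proof -
          have "?p \<longlonglongrightarrow> 5 * (2 * (2 * (Ct t x - Ct t x)\<^sup>2
           + 2 * (5 * (0\<^sup>2 * 4800) + 5/4 * x\<^sup>2 * 0)) + 2 * (0\<^sup>2 * 384000))"
            by (intro tendsto_intros Cd S(7) r0)
          then have "?p \<longlonglongrightarrow> 0" by simp
          from tendsto_ennrealI[OF this] show ?thesis by simp
        qed
        moreover have "eventually (\<lambda>k. J k x \<le> ennreal (?p k) + ennreal (5/4 * x\<^sup>2) * e k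
            + ennreal (5/4 * (1 - x)\<^sup>2) * ?e2 k) sequentially"
          using ev S(6)
        proof eventually_elim
          case (elim k)
          have "i k \<le> L k" using elim by simp
          have "J k x \<le> ennreal (?p k) + ennreal (5/4 * (1 - x)\<^sup>2) * ?e2 k"
            unfolding J_def
            by (rule sqn_diff_step_right[OF elim(2) LN x i_def 2 t(2) \<open>i k \<le> L k\<close>]) (simp_all only:
                r, simp_all add: r_def)
          also have "\<dots> \<le> ennreal (?p k) + ennreal (5/4 * x\<^sup>2) * e k + ennreal (5/4 * (1 - x)\<^sup>2)
              * ?e2 k"
            by (intro add_mono) auto
          finally show ?case .
        qed
        ultimately show ?thesis using eP
          by (intro bexI[of _ e] bexI[of _ ?e2] exI[of _ "\<lambda>k. ennreal (?p k)"] conjI)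
      qed
    qed
    ultimately show "\<exists>J. (\<forall>k. J k \<in> borel_measurable Unif) \<and> (\<forall>k. AE x in Unif. J k x
        \<le> ennreal (2 * 544000 + 2 * 10000000000))
        \<and> (\<forall>k. e k = (\<integral>\<^sup>+x. J k x \<partial>Unif))
        \<and> (AE x in Unif. \<exists>e1\<in>P. \<exists>e2\<in>P. \<exists>p. p \<longlonglongrightarrow> 0 \<and>
            eventually (\<lambda>k. J k x \<le> p k + ennreal (5/4 * x\<^sup>2) * e1 k + ennreal (5/4 * (1 - x)\<^sup>2) *
                e2 k) sequentially)"
      by (intro exI[of _ J] conjI allI)
  qed (rule PI[OF assms])
qed

section \<open>Transfer to the given family of uniforms\<close>

lemma take_in_Vwords: "w \<in> Vwords \<Longrightarrow> take k w \<in> Vwords"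
  by (auto simp: Vwords_def dest: in_set_takeD)

lemma Vlt_subset: "w \<in> Vlt m \<Longrightarrow> w \<in> Vwords"
  by (simp add: Vlt_def)

text \<open>Restricting the family of uniforms to \<open>Vwords\<close> replaces all other values by
  \<open>undefined\<close>; this and the following congruences show that these values are never
  read.\<close>

lemma Yd_cong:
  assumes "\<And>w. w \<in> Vwords \<Longrightarrow> u w = u' w" "v \<in> Vwords"
  shows "Yd u v n t = Yd u' v n t"
  using assms(2)
proof (induction n arbitrary: v t rule: less_induct)
  case (less n)
  define I where "I = nat \<lceil>real n * u' v\<rceil>"
  have u: "u v = u' v" using assms(1) less.prems by simp
  show ?case
  proof (cases "n < 2 \<or> I < 1 \<or> n < I")
    case True
    then show ?thesis by (subst (1 2) Yd.simps) (auto simp: u I_def[symmetric])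
  next
    case False
    have "Yd u (v @ [1]) (I - 1) s = Yd u' (v @ [1]) (I - 1) s"
      "Yd u (v @ [2]) (n - I) s = Yd u' (v @ [2]) (n - I) s" for s
      using False less.prems by (auto intro!: less.IH)
    then show ?thesis using False
      by (subst (1 2) Yd.simps) (simp only: u I_def[symmetric] Let_def)
  qed
qed

lemma ell_cong:
  assumes "\<And>w. w \<in> Vwords \<Longrightarrow> u w = u' w" "v \<in> Vwords" "w \<in> Vwords"
  shows "ell u v w = ell u' v w"
  unfolding ell_def using assms by (intro prod.cong refl) (simp add: take_in_Vwords)

lemma Qp_cong:
  assumes "\<And>w. w \<in> Vwords \<Longrightarrow> u w = u' w" "v \<in> Vwords"
  shows "Qp u v = Qp u' v"
proof -
  have "(\<Sum>w\<in>Vlt m. ell u v w * Cfun (u (v @ w))) = (\<Sum>w\<in>Vlt m. ell u' v w * Cfun (u' (v @ w)))" for m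
    using assms by (intro sum.cong refl) (simp add: ell_cong[of u u'] Vlt_subset)
  then show ?thesis by (simp add: Qp_def)
qed

lemma Yc_cong:
  assumes u: "\<And>w. w \<in> Vwords \<Longrightarrow> u w = u' w" and v: "v \<in> Vwords"
  shows "Yc u v t = Yc u' v t"
proof -
  have Cc: "Cc u w = Cc u' w" if "w \<in> Vwords" for w
    using that Qp_cong[of u u' "w @ [1]"] u by (simp add: Cc_def fun_eq_iff)
  have Lop: "Lop u v w h = Lop u' v w h" if "w \<in> Vwords" for w h
    unfolding Lop_def
    by (intro foldr_cong refl) (use u v that in \<open>simp add: Top_def fun_eq_iff take_in_Vwords\<close>)
  have "Rm u v m t = Rm u' v m t" for m
    unfolding Rm_def using v by (intro sum.cong refl) (simp add: Lop Cc Vlt_subset)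
  then show ?thesis by (simp add: Yc_def)
qed

text \<open>Prefixing \<open>v\<close> maps \<open>Vwords\<close> injectively into itself, so
  reindexing the product measure along it does not change the law. Hence the family below any node
  is distributed like the whole tree, and the claim at \<open>v\<close> reduces to the root.\<close>

lemma distr_subtree_eq_Tree:
  assumes M: "prob_space M"
    and U: "\<And>v. v \<in> Vwords \<Longrightarrow> U v \<in> borel_measurable M"
    and indep: "prob_space.indep_vars M (\<lambda>_. borel) U Vwords"
    and unif: "\<And>v. v \<in> Vwords \<Longrightarrow> distr M borel (U v) = uniform_measure lborel {0..1}"
    and v: "v \<in> Vwords"
  shows "(\<lambda>\<omega>. \<lambda>w\<in>Vwords. U (v @ w) \<omega>) \<in> M \<rightarrow>\<^sub>M Tree"
    and "distr M Tree (\<lambda>\<omega>. \<lambda>w\<in>Vwords. U (v @ w) \<omega>) = Tree"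
proof -
  interpret prob_space M by fact
  have Unifm: "U w \<in> M \<rightarrow>\<^sub>M Unif" if "w \<in> Vwords" for w
    using U[OF that] by (simp cong: measurable_cong_sets)
  let ?X = "\<lambda>\<omega>. \<lambda>w\<in>Vwords. U w \<omega>"
  let ?f = "\<lambda>u. \<lambda>w\<in>Vwords. u (v @ w)"
  have X: "?X \<in> M \<rightarrow>\<^sub>M Tree" by (intro measurable_restrict Unifm)
  have f: "?f \<in> Tree \<rightarrow>\<^sub>M Tree"
    using v by (intro measurable_restrict measurable_component_singleton) simp
  have "distr M Tree ?X = distr M (\<Pi>\<^sub>M w\<in>Vwords. borel) ?X"
    by (intro distr_cong sets_PiM_cong) auto
  also have "\<dots> = (\<Pi>\<^sub>M w\<in>Vwords. distr M borel (U w))"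
    using indep U Nil_in_Vwords by (subst (asm) indep_vars_iff_distr_eq_PiM') blast+
  also have "\<dots> = Tree" by (intro PiM_cong refl unif)
  finally have dX: "distr M Tree ?X = Tree" .
  have df: "distr Tree Tree ?f = Tree"
    by (rule distr_PiM_reindex[of Vwords "\<lambda>_. Unif" "(@) v" Vwords]) (use v in \<open>auto simp: inj_on_def\<close>)
  have eq: "(\<lambda>\<omega>. \<lambda>w\<in>Vwords. U (v @ w) \<omega>) = ?f \<circ> ?X"
    using v by (auto simp: fun_eq_iff restrict_def)
  show "(\<lambda>\<omega>. \<lambda>w\<in>Vwords. U (v @ w) \<omega>) \<in> M \<rightarrow>\<^sub>M Tree"
    unfolding eq by (rule measurable_comp[OF X f])
  show "distr M Tree (\<lambda>\<omega>. \<lambda>w\<in>Vwords. U (v @ w) \<omega>) = Tree"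
    unfolding eq by (subst distr_distr[OF f X, symmetric]) (simp only: dX df)
qed

theorem theorem4p8:
  fixes M :: "'a measure" and U :: "nat list \<Rightarrow> 'a \<Rightarrow> real"
  assumes "prob_space M"
    and "\<And>v. v \<in> Vwords \<Longrightarrow> U v \<in> borel_measurable M"
    and "prob_space.indep_vars M (\<lambda>_. borel) U Vwords"
    and "\<And>v. v \<in> Vwords \<Longrightarrow> distr M borel (U v) = uniform_measure lborel {0..1}"
    and "v \<in> Vwords" and "t \<in> {0<..1}"
  shows "(\<lambda>n. \<integral>\<^sup>+ \<omega>. ennreal ((Yd (\<lambda>w. U w \<omega>) v n t - Yc (\<lambda>w. U w \<omega>) v t)\<^sup>2) \<partial>M)
           \<longlonglongrightarrow> 0"
proof -
  let ?X = "\<lambda>\<omega>. \<lambda>w\<in>Vwords. U (v @ w) \<omega>"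
  have X: "?X \<in> M \<rightarrow>\<^sub>M Tree" "distr M Tree ?X = Tree"
    by (rule distr_subtree_eq_Tree; fact)+
  define L where "L n = nat \<lfloor>real n * t\<rfloor>" for n
  have t: "0 < t" "t \<le> 1" using assms(6) by auto
  have Lr: "real (L n) = real_of_int \<lfloor>real n * t\<rfloor>" for n using t by (simp add: L_def)
  have LN: "L n \<le> n" for n
  proof -
    have "real n * t \<le> real n * 1" using t by (intro mult_left_mono) auto
    then have "real (L n) \<le> real n" unfolding Lr by linarith
    then show ?thesis by simp
  qed
  have Lt: "(\<lambda>n. real (L n) / real n) \<longlonglongrightarrow> t"
  proof (rule LIM_zero_cancel, rule Lim_null_comparison[OF _ lim_1_over_n])
    show "eventually (\<lambda>n. norm (real (L n) / real n - t) \<le> 1 / real n) sequentially"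
      using eventually_gt_at_top[of 0]
    proof eventually_elim
      case (elim n)
      have "\<bar>real (L n) - real n * t\<bar> \<le> 1" unfolding Lr by linarith
      moreover have "real (L n) / real n - t = (real (L n) - real n * t) / real n"
        using elim by (simp add: field_simps)
      ultimately show ?case using elim by (simp add: abs_divide divide_right_mono)
    qed
  qed
  have "eventually (\<lambda>n. sqn Tree (\<lambda>u. yd n (L n) u - Ylim t u) =
      (\<integral>\<^sup>+ \<omega>. ennreal ((Yd (\<lambda>w. U w \<omega>) v n t - Yc (\<lambda>w. U w \<omega>) v t)\<^sup>2) \<partial>M)) sequentially"
    using eventually_gt_at_top[of 0]
  proof eventually_elim
    case (elim n)
    have 1: "Yd (\<lambda>w. U w \<omega>) v n t = yd n (L n) (?X \<omega>)" for \<omega>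
    proof -
      have "Yd (\<lambda>w. U w \<omega>) v n t = Yd (\<lambda>w. U (v @ w) \<omega>) [] n t"
        using Yd_shift[of "\<lambda>w. U w \<omega>" v "[]"] by simp
      also have "\<dots> = Yd (?X \<omega>) [] n t" by (rule Yd_cong) auto
      also have "\<dots> = yd n (L n) (?X \<omega>)" unfolding L_def using t elim by (intro Yd_eq_yd) auto
      finally show ?thesis .
    qed
    have 2: "Yc (\<lambda>w. U w \<omega>) v t = Ylim t (?X \<omega>)" for \<omega>
    proof -
      have "Yc (\<lambda>w. U w \<omega>) v t = Yc (\<lambda>w. U (v @ w) \<omega>) [] t"
        using Yc_shift[of "\<lambda>w. U w \<omega>" v "[]"] by simp
      also have "\<dots> = Yc (?X \<omega>) [] t" by (rule Yc_cong) auto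
      finally show ?thesis .
    qed
    note [measurable] = yd_measurable[OF LN[of n]] Ylim_measurable
    have "(\<lambda>u. ennreal ((yd n (L n) u - Ylim t u)\<^sup>2)) \<in> borel_measurable Tree" by measurable
    then have "(\<integral>\<^sup>+ u. ennreal ((yd n (L n) u - Ylim t u)\<^sup>2) \<partial>distr M Tree ?X) =
        (\<integral>\<^sup>+ \<omega>. ennreal ((yd n (L n) (?X \<omega>) - Ylim t (?X \<omega>))\<^sup>2) \<partial>M)"
      by (intro nn_integral_distr X(1)) (simp only: X(2))
    then show ?case unfolding sqn_def X(2) 1 2 .
  qed
  with process_L2_limit[OF filterlim_ident LN Lt t] show ?thesis
    by (rule Lim_transform_eventually)
qed

end
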